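(* Let $\alpha$ and $m$ be positive integers, let $s\ge 9$, let $m_{10},\dots,m_s$ be non-negative integers, and let $p_1,\dots,p_s$ be points of $\mathbb{P}^3$ in general position. Let $\mathcal{L}=\mathcal{L}_{3,2m+\alpha}(m^9,m_{10},\dots,m_s)$ be the linear system of surfaces of degree $2m+\alpha$ in $\mathbb{P}^3$ having multiplicity at least $m$ at each of $p_1,\dots,p_9$ and multiplicity at least $m_i$ at $p_i$ for $10\le i\le s$. Suppose that $\mathcal{L}$ is non-empty. If $m>9\alpha$, then the unique quadric surface $Q$ through the first nine points $p_1,\dots,p_9$ is contained in the base locus of $\mathcal{L}$.
   Context: We work over the complex numbers. A linear system is non-empty if it contains at least one surface, i.e. if the vector space of forms of degree $2m+\alpha$ satisfying the multiplicity conditions is non-zero. *)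

theory Defs
  imports "HOL-Analysis.Analysis" "HOL-Library.Poly_Mapping" "HOL-Library.FuncSet"
begin

text \<open>Polynomials over the complex numbers in the variables \<open>'v\<close>: finitely supported maps
  from exponent vectors to coefficients, with the convolution product of
  \<^theory>\<open>HOL-Library.Poly_Mapping\<close>.\<close>

type_synonym 'v cpoly = "('v \<Rightarrow>\<^sub>0 nat) \<Rightarrow>\<^sub>0 complex"

abbreviation const_poly :: "complex \<Rightarrow> 'v cpoly" where
  "const_poly c \<equiv> Poly_Mapping.single 0 c"

abbreviation var_poly :: "'v \<Rightarrow> 'v cpoly" where
  "var_poly v \<equiv> Poly_Mapping.single (Poly_Mapping.single v 1) 1"

text \<open>The value of a polynomial in a ring \<open>'r\<close>, given the images \<open>h\<close> of the scalars and
  \<open>f\<close> of the variables.\<close>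

definition poly_hom :: "(complex \<Rightarrow> 'r) \<Rightarrow> ('v \<Rightarrow> 'r) \<Rightarrow> 'v cpoly \<Rightarrow> 'r::comm_ring_1" where
  "poly_hom h f F =
     (\<Sum>e\<in>Poly_Mapping.keys F. h (Poly_Mapping.lookup F e) *
        (\<Prod>v\<in>Poly_Mapping.keys e. f v ^ Poly_Mapping.lookup e v))"

definition eval_poly :: "('v \<Rightarrow> complex) \<Rightarrow> 'v cpoly \<Rightarrow> complex" where
  "eval_poly f F = poly_hom (\<lambda>c. c) f F"

definition subst_poly :: "('v \<Rightarrow> 'w cpoly) \<Rightarrow> 'v cpoly \<Rightarrow> 'w cpoly" where
  "subst_poly f F = poly_hom const_poly f F"

definition mdegree :: "('v \<Rightarrow>\<^sub>0 nat) \<Rightarrow> nat" where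
  "mdegree e = (\<Sum>v\<in>Poly_Mapping.keys e. Poly_Mapping.lookup e v)"

text \<open>Forms of degree \<open>d\<close> in the four homogeneous coordinates of projective 3-space; the zero
  polynomial is a form of every degree.\<close>

definition form :: "nat \<Rightarrow> 4 cpoly \<Rightarrow> bool" where
  "form d F \<longleftrightarrow> (\<forall>e\<in>Poly_Mapping.keys F. mdegree e = d)"

text \<open>Points of projective 3-space are the lines through the origin of \<open>complex ^ 4\<close>; the
  nonzero vectors of such a line are the homogeneous coordinate vectors of the point.\<close>

type_synonym point = "(complex ^ 4) set"

definition P3 :: "point set" where
  "P3 = {vec.span {v} |v. v \<noteq> 0}"

definition zero_locus :: "4 cpoly \<Rightarrow> point set" where
  "zero_locus F = {x \<in> P3. \<forall>v\<in>x - {0}. eval_poly (($) v) F = 0}"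

text \<open>Multiplicity is measured on affine charts: on the chart where the coordinate \<open>k\<close> is
  nonzero, the point has a unique coordinate vector \<open>v\<close> with \<open>v $ k = 1\<close>, and \<open>F\<close> is
  dehomogenized by setting the \<open>k\<close>-th variable to \<open>1\<close> and expanded around \<open>v\<close>; the expansion
  must have no term of degree less than \<open>n\<close>.\<close>

definition chart_expansion :: "4 \<Rightarrow> complex ^ 4 \<Rightarrow> 4 cpoly \<Rightarrow> 4 cpoly" where
  "chart_expansion k v F =
     subst_poly (\<lambda>i. if i = k then 1 else var_poly i + const_poly (v $ i)) F"

definition mult_at_least :: "nat \<Rightarrow> point \<Rightarrow> 4 cpoly \<Rightarrow> bool" where
  "mult_at_least n x F \<longleftrightarrow>
     (\<forall>k. \<forall>v\<in>x. v $ k = 1 \<longrightarrow> (\<forall>e\<in>Poly_Mapping.keys (chart_expansion k v F). n \<le> mdegree e))"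

text \<open>A surface is given by a nonzero form, unique up to a nonzero scalar. The linear system
  consists of the equations of its members.\<close>

definition linear_system :: "nat \<Rightarrow> nat \<Rightarrow> (nat \<Rightarrow> nat) \<Rightarrow> (nat \<Rightarrow> point) \<Rightarrow> 4 cpoly set" where
  "linear_system d s \<mu> p =
     {F. F \<noteq> 0 \<and> form d F \<and> (\<forall>i\<in>{1..s}. mult_at_least (\<mu> i) (p i) F)}"

definition base_locus :: "4 cpoly set \<Rightarrow> point set" where
  "base_locus L = {x \<in> P3. \<forall>F\<in>L. x \<in> zero_locus F}"

definition quadrics_through :: "nat set \<Rightarrow> (nat \<Rightarrow> point) \<Rightarrow> 4 cpoly set" where
  "quadrics_through I p = {q. q \<noteq> 0 \<and> form 2 q \<and> (\<forall>i\<in>I. p i \<in> zero_locus q)}"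

definition is_unique_quadric_through :: "nat set \<Rightarrow> (nat \<Rightarrow> point) \<Rightarrow> 4 cpoly \<Rightarrow> bool" where
  "is_unique_quadric_through I p q \<longleftrightarrow>
     q \<in> quadrics_through I p \<and>
     (\<forall>q'\<in>quadrics_through I p. \<exists>c. q' = const_poly c * q)"

text \<open>The Zariski topology on the product of \<open>s\<close> copies of projective 3-space: closed sets are
  the common zero loci of multihomogeneous polynomials, where the variable \<open>(i, j)\<close> is the
  \<open>j\<close>-th homogeneous coordinate of the \<open>i\<close>-th point.\<close>

definition P3_power :: "nat \<Rightarrow> (nat \<Rightarrow> point) set" where
  "P3_power s = {1..s} \<rightarrow>\<^sub>E P3"

definition multihomogeneous :: "nat \<Rightarrow> (nat \<times> 4) cpoly \<Rightarrow> bool" where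
  "multihomogeneous s G \<longleftrightarrow>
     (\<exists>\<delta>. \<forall>e\<in>Poly_Mapping.keys G.
        Poly_Mapping.keys e \<subseteq> {1..s} \<times> UNIV \<and>
        (\<forall>i\<in>{1..s}. (\<Sum>j\<in>UNIV. Poly_Mapping.lookup e (i, j)) = \<delta> i))"

definition multi_zero_locus :: "nat \<Rightarrow> (nat \<times> 4) cpoly \<Rightarrow> (nat \<Rightarrow> point) set" where
  "multi_zero_locus s G =
     {p \<in> P3_power s. \<forall>v. (\<forall>i\<in>{1..s}. v i \<in> p i - {0}) \<longrightarrow> eval_poly (\<lambda>(i, j). v i $ j) G = 0}"

definition zariski_closed :: "nat \<Rightarrow> (nat \<Rightarrow> point) set \<Rightarrow> bool" where
  "zariski_closed s Z \<longleftrightarrow>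
     (\<exists>S. (\<forall>G\<in>S. multihomogeneous s G) \<and> Z = {p \<in> P3_power s. \<forall>G\<in>S. p \<in> multi_zero_locus s G})"

definition zariski_open :: "nat \<Rightarrow> (nat \<Rightarrow> point) set \<Rightarrow> bool" where
  "zariski_open s U \<longleftrightarrow> U \<subseteq> P3_power s \<and> zariski_closed s (P3_power s - U)"

text \<open>A property holds for \<open>s\<close> points in general position if it holds for all tuples in some
  nonempty Zariski open set.\<close>

definition for_general_points :: "nat \<Rightarrow> ((nat \<Rightarrow> point) \<Rightarrow> bool) \<Rightarrow> bool" where
  "for_general_points s P \<longleftrightarrow> (\<exists>U. zariski_open s U \<and> U \<noteq> {} \<and> (\<forall>p\<in>U. P p))"

end

theory Submission
  imports Defs "HOL-Computational_Algebra.Polynomial_Factorial"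
    "HOL-Computational_Algebra.Field_as_Ring"
begin

text \<open>A form of degree \<open>d = 2 m + \<alpha>\<close> restricts to a curve of bidegree \<open>(d, d)\<close> with nine points of
  multiplicity \<open>m\<close> on the quadric, a product of two lines, and this restriction must be shown to
  vanish. Let the nine points be generic. Since \<open>9 d < 19 m\<close>, a nonzero restriction would have an
  irreducible component \<open>C\<close> of some class \<open>(a, b; c\<^sub>1, \<dots>, c\<^sub>9)\<close> with \<open>38 \<Sum> c\<^sub>i > 81 (a + b)\<close>;
  take \<open>a + b\<close> minimal. The derivative of the equation of \<open>C\<close> with respect to the position of the
  point \<open>i\<close> has multiplicity \<open>c\<^sub>i - 1\<close> there and \<open>c\<^sub>j\<close> at the other points, and it is not divisible
  by the equation of \<open>C\<close>, because a rigid curve cannot follow a moving point. Bezout's inequality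
  gives \<open>\<Sum> c\<^sub>j\<^sup>2 \<le> 2 a b + c\<^sub>i\<close>. Together with the inequalities between \<open>C\<close> and its images under
  exchange of two points or of the two factors, this leaves the class \<open>(2, 2; 1, \<dots>, 1)\<close> only, and
  nine generic points lie on no curve of that class.

  Hence the linear conditions on such curves have trivial kernel for one configuration on the
  quadric \<open>X\<^sub>3 X\<^sub>4 = X\<^sub>1 X\<^sub>2\<close>. In space, the multiplicity of the restriction to a quadric is measured
  by vector fields tangent to it. This turns the claim into the injectivity of matrices whose
  entries are polynomial in the nine points, which is an open condition.\<close>

subsection \<open>Linear systems\<close>

text \<open>Positive slope alone is no contradiction: by Cauchy-Schwarz it gives negative
  self-intersection, but special points may lie on rigid negative curves. What genericity adds is
  the possibility to differentiate with respect to the points and to permute them, and both exist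
  once the coordinates are independent variables. This is why the argument on the quadric lives over
  a fraction field, with factorial bivariate polynomials over it. The reduction to an irreducible
  curve works because the slope is additive under products, and its coefficients 38 and 81 make
  \<open>9 * d < 19 * m\<close> the positivity of the class \<open>(d, d; m, ..., m)\<close>. The
  obstacle on the way back to space is that the quadric moves with the nine points and carries no
  fixed parametrisation. Hence its coefficients are found as polynomials in the points, by
  elimination without division, and restriction to it is tested by operators that commute with
  multiplication by its equation. Only at the special configuration are these compared with
  derivatives along the two rulings.\<close>

definition trivial_kernel :: "'i set \<Rightarrow> 'j set \<Rightarrow> ('i \<Rightarrow> 'j \<Rightarrow> 'a::comm_ring_1) \<Rightarrow> bool" where
  "trivial_kernel I J M \<longleftrightarrow>
     (\<forall>c. (\<forall>i\<in>I. (\<Sum>j\<in>J. M i j * c j) = 0) \<longrightarrow> (\<forall>j\<in>J. c j = 0))"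

section \<open>Ring homomorphisms between arbitrary commutative rings\<close>

definition rhom :: "('a::comm_ring_1 \<Rightarrow> 'b::comm_ring_1) \<Rightarrow> bool" where
  "rhom h \<longleftrightarrow> h 1 = 1 \<and> (\<forall>x y. h (x + y) = h x + h y) \<and> (\<forall>x y. h (x * y) = h x * h y)"

lemma rhomI:
  assumes "h 1 = 1" "\<And>x y. h (x + y) = h x + h y" "\<And>x y. h (x * y) = h x * h y"
  shows "rhom h"
  using assms by (simp add: rhom_def)

lemma rhom_1: "rhom h \<Longrightarrow> h 1 = 1"
  and rhom_add: "rhom h \<Longrightarrow> h (x + y) = h x + h y"
  and rhom_mult: "rhom h \<Longrightarrow> h (x * y) = h x * h y"
  by (simp_all add: rhom_def)

lemma rhom_0: "rhom h \<Longrightarrow> h 0 = 0"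
  using rhom_add[of h 0 0] by simp

lemma rhom_minus: "rhom h \<Longrightarrow> h (- x) = - h x"
  using rhom_add[of h x "- x"] by (simp add: rhom_0 eq_neg_iff_add_eq_0 add.commute)

lemma rhom_diff: "rhom h \<Longrightarrow> h (x - y) = h x - h y"
  using rhom_add[of h x "- y"] by (simp add: rhom_minus)

lemma rhom_sum: "rhom h \<Longrightarrow> h (\<Sum>i\<in>A. f i) = (\<Sum>i\<in>A. h (f i))"
  by (induction A rule: infinite_finite_induct) (simp_all add: rhom_0 rhom_add)

lemma rhom_prod: "rhom h \<Longrightarrow> h (\<Prod>i\<in>A. f i) = (\<Prod>i\<in>A. h (f i))"
  by (induction A rule: infinite_finite_induct) (simp_all add: rhom_1 rhom_mult)

lemma rhom_power: "rhom h \<Longrightarrow> h (x ^ n) = h x ^ n"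
  by (induction n) (simp_all add: rhom_1 rhom_mult)

lemma rhom_of_nat: "rhom h \<Longrightarrow> h (of_nat n) = of_nat n"
  by (induction n) (simp_all add: rhom_0 rhom_1 rhom_add)

lemmas rhom_simps = rhom_1 rhom_add rhom_mult rhom_0 rhom_minus rhom_diff rhom_sum rhom_prod
  rhom_power rhom_of_nat

lemma rhom_comp: "rhom g \<Longrightarrow> rhom h \<Longrightarrow> rhom (\<lambda>x. g (h x))"
  by (simp add: rhom_def)

lemma rhom_dvd: "rhom h \<Longrightarrow> a dvd b \<Longrightarrow> h a dvd h b"
  by (auto simp: dvd_def rhom_mult)

section \<open>Gaussian elimination, over a field and without division\<close>

lemma underdetermined_system:
  fixes M :: "'i \<Rightarrow> 'j \<Rightarrow> 'k::field"
  assumes "finite I" "finite J" "card I < card J"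
  shows "\<exists>c. (\<exists>j\<in>J. c j \<noteq> 0) \<and> (\<forall>i\<in>I. (\<Sum>j\<in>J. M i j * c j) = 0)"
  using assms
proof (induction I arbitrary: J M rule: finite_induct)
  case empty
  then obtain j where "j \<in> J"
    by (metis card.empty card_gt_0_iff ex_in_conv)
  then show ?case
    by (intro exI[of _ "\<lambda>_. 1"]) auto
next
  case (insert i I)
  show ?case
  proof (cases "\<forall>j\<in>J. M i j = 0")
    case True
    have "card I < card J"
      using insert.prems insert.hyps by simp
    then obtain c where "\<exists>j\<in>J. c j \<noteq> 0" "\<forall>k\<in>I. (\<Sum>j\<in>J. M k j * c j) = 0"
      using insert.IH insert.prems(1) by blast
    with True show ?thesis
      by (intro exI[of _ c]) auto
  next
    case False
    then obtain p where p: "p \<in> J" "M i p \<noteq> 0"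
      by blast
    define J' where "J' = J - {p}"
    have J: "J = insert p J'" "p \<notin> J'" "finite J'"
      using p insert.prems by (auto simp: J'_def)
    have "card I < card J'"
      using insert.prems insert.hyps p by (simp add: J'_def)
    then obtain c where c: "\<exists>j\<in>J'. c j \<noteq> 0"
      "\<forall>k\<in>I. (\<Sum>j\<in>J'. (M k j - M k p / M i p * M i j) * c j) = 0"
      using insert.IH[of J' "\<lambda>k j. M k j - M k p / M i p * M i j"] J(3) by auto
    define c' where "c' = c(p := - (\<Sum>j\<in>J'. M i j * c j) / M i p)"
    have S: "(\<Sum>j\<in>J. M k j * c' j) = M k p * c' p + (\<Sum>j\<in>J'. M k j * c j)" for k
      using J by (auto simp: c'_def intro!: sum.cong)
    have "(\<Sum>j\<in>J. M k j * c' j) = 0" if "k \<in> I" for k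
    proof -
      have "0 = (\<Sum>j\<in>J'. (M k j - M k p / M i p * M i j) * c j)"
        using c that by simp
      also have "\<dots> = (\<Sum>j\<in>J'. M k j * c j) - M k p / M i p * (\<Sum>j\<in>J'. M i j * c j)"
        by (simp add: sum_subtractf sum_distrib_left algebra_simps)
      finally show ?thesis
        unfolding S by (simp add: c'_def)
    qed
    moreover have "(\<Sum>j\<in>J. M i j * c' j) = 0"
      unfolding S using p by (simp add: c'_def)
    moreover have "\<exists>j\<in>J. c' j \<noteq> 0"
      using c(1) J by (auto simp: c'_def)
    ultimately show ?thesis
      by (intro exI[of _ c']) blast
  qed
qed

lemma trivial_kernel_column:
  fixes M :: "'i \<Rightarrow> 'j \<Rightarrow> 'a::comm_ring_1"
  assumes "trivial_kernel I J M" "finite J" "p \<in> J"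
  shows "\<exists>i\<in>I. M i p \<noteq> 0"
proof (rule ccontr)
  assume "\<not> ?thesis"
  then have "(\<Sum>j\<in>J. M i j * (if j = p then 1 else 0)) = 0" if "i \<in> I" for i
    using that assms(2,3) by (simp add: if_distrib cong: if_cong)
  then have "\<forall>j\<in>J. (if j = p then 1 else 0 :: 'a) = 0"
    using assms(1)[unfolded trivial_kernel_def, THEN spec, of "\<lambda>j. if j = p then 1 else 0"] by simp
  with assms(3) show False
    by auto
qed

text \<open>Clearing the column \<open>p\<close> by cross-multiplication keeps the new entries
  polynomial in the old ones, so the step commutes with ring homomorphisms: elimination takes place
  in a ring while pivots are judged after mapping to a field.\<close>

lemma trivial_kernel_eliminate:
  fixes M :: "'i \<Rightarrow> 'j \<Rightarrow> 'k::field"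
  assumes "trivial_kernel I (insert p J) M" "finite J" "p \<notin> J" "i \<in> I" "M i p \<noteq> 0"
  shows "trivial_kernel (I - {i}) J (\<lambda>k j. M i p * M k j - M i j * M k p)"
  unfolding trivial_kernel_def
proof (intro allI impI)
  fix c assume c: "\<forall>k\<in>I - {i}. (\<Sum>j\<in>J. (M i p * M k j - M i j * M k p) * c j) = 0"
  define c' where "c' = c(p := - (\<Sum>j\<in>J. M i j * c j) / M i p)"
  have S: "(\<Sum>j\<in>insert p J. M k j * c' j) = M k p * c' p + (\<Sum>j\<in>J. M k j * c j)" for k
    using assms(2,3) by (auto simp: c'_def intro!: sum.cong)
  have "(\<Sum>j\<in>insert p J. M k j * c' j) = 0" if "k \<in> I" for k
  proof (cases "k = i")
    case True
    then show ?thesis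
      unfolding S using assms(5) by (simp add: c'_def)
  next
    case False
    have "0 = (\<Sum>j\<in>J. (M i p * M k j - M i j * M k p) * c j)"
      using c that False by simp
    also have "\<dots> = M i p * (\<Sum>j\<in>J. M k j * c j) - M k p * (\<Sum>j\<in>J. M i j * c j)"
      by (simp add: sum_subtractf sum_distrib_left algebra_simps)
    finally show ?thesis
      unfolding S using assms(5) by (simp add: c'_def field_simps)
  qed
  then have "\<forall>j\<in>insert p J. c' j = 0"
    using assms(1) unfolding trivial_kernel_def by blast
  then show "\<forall>j\<in>J. c j = 0"
    using assms(3) by (auto simp: c'_def split: if_splits)
qed

lemma trivial_kernel_uneliminate:
  fixes M :: "'i \<Rightarrow> 'j \<Rightarrow> 'k::field"
  assumes "trivial_kernel (I - {i}) J (\<lambda>k j. M i p * M k j - M i j * M k p)"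
    and "finite J" "p \<notin> J" "i \<in> I" "M i p \<noteq> 0"
  shows "trivial_kernel I (insert p J) M"
  unfolding trivial_kernel_def
proof (intro allI impI)
  fix c assume c: "\<forall>k\<in>I. (\<Sum>j\<in>insert p J. M k j * c j) = 0"
  have c': "M k p * c p = - (\<Sum>j\<in>J. M k j * c j)" if "k \<in> I" for k
    using c that assms(2,3) by (simp add: eq_neg_iff_add_eq_0)
  have "(\<Sum>j\<in>J. (M i p * M k j - M i j * M k p) * c j) = 0" if "k \<in> I - {i}" for k
  proof -
    have "(\<Sum>j\<in>J. (M i p * M k j - M i j * M k p) * c j) =
        M i p * (\<Sum>j\<in>J. M k j * c j) - M k p * (\<Sum>j\<in>J. M i j * c j)"
      by (simp add: sum_subtractf sum_distrib_left algebra_simps)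
    also have "\<dots> = M i p * - (M k p * c p) - M k p * - (M i p * c p)"
      using c'[of k] c'[of i] that assms(4) by simp
    finally show ?thesis
      by simp
  qed
  then have "\<forall>j\<in>J. c j = 0"
    using assms(1) unfolding trivial_kernel_def by blast
  then show "\<forall>j\<in>insert p J. c j = 0"
    using c'[of i] assms(4,5) by simp
qed

text \<open>Injectivity is an open condition. \<open>h\<close> is the product of the pivots met
  while eliminating under \<open>\<phi>\<close>; it replaces a nonvanishing maximal minor. The two
  target fields may differ, since the lemma also transfers injectivity from a fraction field to
  complex points.\<close>

lemma trivial_kernel_generic:
  fixes M :: "'i \<Rightarrow> 'j \<Rightarrow> 'a::comm_ring_1" and \<phi> :: "'a \<Rightarrow> 'k::field"
  assumes "finite J" "rhom \<phi>" "trivial_kernel I J (\<lambda>i j. \<phi> (M i j))"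
  shows "\<exists>h. \<phi> h \<noteq> 0 \<and>
    (\<forall>\<psi>::'a \<Rightarrow> 'l::field. rhom \<psi> \<longrightarrow> \<psi> h \<noteq> 0 \<longrightarrow> trivial_kernel I J (\<lambda>i j. \<psi> (M i j)))"
  using assms(1,3)
proof (induction J arbitrary: I M rule: finite_induct)
  case empty
  then show ?case
    by (intro exI[of _ 1]) (use assms(2) in \<open>auto simp: trivial_kernel_def rhom_1\<close>)
next
  case (insert p J)
  obtain i where i: "i \<in> I" "\<phi> (M i p) \<noteq> 0"
    using trivial_kernel_column[OF insert.prems] insert.hyps by auto
  have "trivial_kernel (I - {i}) J (\<lambda>k j. \<phi> (M i p * M k j - M i j * M k p))"
    using trivial_kernel_eliminate[OF insert.prems] insert.hyps i assms(2)
    by (simp add: rhom_simps)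
  then obtain h where h: "\<phi> h \<noteq> 0" "\<And>\<psi>::'a \<Rightarrow> 'l. rhom \<psi> \<Longrightarrow> \<psi> h \<noteq> 0 \<Longrightarrow>
      trivial_kernel (I - {i}) J (\<lambda>k j. \<psi> (M i p * M k j - M i j * M k p))"
    using insert.IH[of "I - {i}" "\<lambda>k j. M i p * M k j - M i j * M k p"] by blast
  show ?case
  proof (intro exI conjI allI impI)
    show "\<phi> (h * M i p) \<noteq> 0"
      using h i assms(2) by (simp add: rhom_simps)
    fix \<psi> :: "'a \<Rightarrow> 'l"
    assume \<psi>: "rhom \<psi>" "\<psi> (h * M i p) \<noteq> 0"
    then have "trivial_kernel (I - {i}) J (\<lambda>k j. \<psi> (M i p) * \<psi> (M k j) - \<psi> (M i j) * \<psi> (M k p))"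
      using h(2)[of \<psi>] by (simp add: rhom_simps)
    then show "trivial_kernel I (insert p J) (\<lambda>i j. \<psi> (M i j))"
      by (rule trivial_kernel_uneliminate) (use \<psi> insert.hyps i in \<open>auto simp: rhom_simps\<close>)
  qed
qed

text \<open>A substitute for Cramer's rule: with one column more than rows, there is a kernel vector
  with entries in the ring itself. It yields the quadric through nine points with coefficients
  polynomial in the points.\<close>

lemma generic_kernel_vector:
  fixes M :: "'i \<Rightarrow> 'j \<Rightarrow> 'a::comm_ring_1" and \<phi> :: "'a \<Rightarrow> 'k::field"
  assumes "finite J" "e \<notin> J" "rhom \<phi>" "finite I" "card I = card J"
    and "trivial_kernel I J (\<lambda>i j. \<phi> (M i j))"
  shows "\<exists>k. \<phi> (k e) \<noteq> 0 \<and> (\<forall>i\<in>I. (\<Sum>j\<in>insert e J. M i j * k j) = 0)"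
  using assms(1,2,4,5,6)
proof (induction J arbitrary: I M rule: finite_induct)
  case empty
  then show ?case
    by (intro exI[of _ "\<lambda>_. 1"]) (use assms(3) in \<open>auto simp: rhom_1\<close>)
next
  case (insert p J)
  obtain i where i: "i \<in> I" "\<phi> (M i p) \<noteq> 0"
    using trivial_kernel_column[OF insert.prems(4)] insert.hyps by auto
  have "trivial_kernel (I - {i}) J (\<lambda>k j. \<phi> (M i p * M k j - M i j * M k p))"
    using trivial_kernel_eliminate[OF insert.prems(4)] insert.hyps i assms(3)
    by (simp add: rhom_simps)
  moreover have "card (I - {i}) = card J"
    using insert.prems insert.hyps i by simp
  ultimately obtain k where k: "\<phi> (k e) \<noteq> 0"
    "\<And>l. l \<in> I - {i} \<Longrightarrow> (\<Sum>j\<in>insert e J. (M i p * M l j - M i j * M l p) * k j) = 0"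
    using insert.IH[of "I - {i}" "\<lambda>k j. M i p * M k j - M i j * M k p"] insert.prems by auto
  \<comment> \<open>The old coordinates are scaled by the pivot, so that row \<open>i\<close>
    determines the coordinate \<open>p\<close> without division.\<close>
  define k' where "k' j = (if j = p then - (\<Sum>j\<in>insert e J. M i j * k j) else M i p * k j)" for j
  have ep: "e \<noteq> p" "p \<notin> insert e J" "finite (insert e J)"
    using insert.prems insert.hyps by auto
  have S: "(\<Sum>j\<in>insert e (insert p J). M l j * k' j) =
      M l p * k' p + M i p * (\<Sum>j\<in>insert e J. M l j * k j)" for l
  proof -
    have "(\<Sum>j\<in>insert e J. M l j * k' j) = M i p * (\<Sum>j\<in>insert e J. M l j * k j)"
      unfolding sum_distrib_left by (intro sum.cong) (use ep in \<open>auto simp: k'_def mult_ac\<close>)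
    then show ?thesis
      using ep by (subst insert_commute) simp
  qed
  have "(\<Sum>j\<in>insert e (insert p J). M l j * k' j) = 0" if "l \<in> I" for l
  proof (cases "l = i")
    case True
    then show ?thesis
      unfolding S by (simp add: k'_def)
  next
    case False
    then have "0 = (\<Sum>j\<in>insert e J. (M i p * M l j - M i j * M l p) * k j)"
      using k that by simp
    also have "\<dots> = M i p * (\<Sum>j\<in>insert e J. M l j * k j) - M l p * (\<Sum>j\<in>insert e J. M i j * k j)"
      unfolding sum_distrib_left sum_subtractf[symmetric]
      by (intro sum.cong) (simp_all add: algebra_simps)
    finally show ?thesis
      unfolding S by (simp add: k'_def)
  qed
  moreover have "\<phi> (k' e) \<noteq> 0"
    using ep i k assms(3) by (simp add: k'_def rhom_simps)
  ultimately show ?case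
    by blast
qed

subsection \<open>Fraction fields as factorial rings\<close>

text \<open>The division structure of a field is trivial; the instances are there so that bivariate
  polynomials over a fraction field form a factorial ring.\<close>

instantiation fract ::
  (idom) "{unique_euclidean_ring, normalization_euclidean_semiring, normalization_semidom_multiplicative}"
begin

definition [simp]: "normalize_fract = (normalize_field :: 'a fract \<Rightarrow> _)"
definition [simp]: "unit_factor_fract = (unit_factor_field :: 'a fract \<Rightarrow> _)"
definition [simp]: "modulo_fract = (mod_field :: 'a fract \<Rightarrow> _)"
definition [simp]: "euclidean_size_fract = (euclidean_size_field :: 'a fract \<Rightarrow> _)"
definition [simp]: "division_segment (x :: 'a fract) = 1"

instance
  by standard
    (simp_all add: dvd_field_iff field_split_simps split: if_splits)

end

instantiation fract :: (idom) euclidean_ring_gcd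
begin

definition gcd_fract :: "'a fract \<Rightarrow> 'a fract \<Rightarrow> 'a fract" where
  "gcd_fract = Euclidean_Algorithm.gcd"
definition lcm_fract :: "'a fract \<Rightarrow> 'a fract \<Rightarrow> 'a fract" where
  "lcm_fract = Euclidean_Algorithm.lcm"
definition Gcd_fract :: "'a fract set \<Rightarrow> 'a fract" where
 "Gcd_fract = Euclidean_Algorithm.Gcd"
definition Lcm_fract :: "'a fract set \<Rightarrow> 'a fract" where
 "Lcm_fract = Euclidean_Algorithm.Lcm"

instance by standard (simp_all add: gcd_fract_def lcm_fract_def Gcd_fract_def Lcm_fract_def)

end

instance fract :: (idom) field_gcd ..

lemma irreducible_dvd_mult:
  fixes g :: "'k::field_gcd poly poly"
  assumes "irreducible g" "g dvd a * b"
  shows "g dvd a \<or> g dvd b"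
  using assms by (metis irreducible_imp_prime_elem prime_elem_dvd_multD)

subsection \<open>Polynomials in two variables\<close>

text \<open>The outer variable is X and the inner one Y, so \<open>degree\<close> is the degree in X
  and \<open>cf f i j\<close> the coefficient of \<open>X^i Y^j\<close>.\<close>

abbreviation cst :: "'k::comm_ring_1 \<Rightarrow> 'k poly poly" where
  "cst c \<equiv> [:[:c:]:]"

abbreviation XX :: "'k::comm_ring_1 poly poly" where
  "XX \<equiv> [:0, 1:]"

abbreviation YY :: "'k::comm_ring_1 poly poly" where
  "YY \<equiv> [:[:0, 1:]:]"

abbreviation cf :: "'k::comm_ring_1 poly poly \<Rightarrow> nat \<Rightarrow> nat \<Rightarrow> 'k" where
  "cf f i j \<equiv> coeff (coeff f i) j"

text \<open>The exchange of variables, translations and blow-ups are all instances of this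
  substitution; \<open>h\<close> acts on the scalars, so that the target may again be a polynomial
  ring.\<close>

definition ev2 ::
  "('k::comm_ring_1 \<Rightarrow> 'r::comm_ring_1) \<Rightarrow> 'r \<Rightarrow> 'r \<Rightarrow> 'k poly poly \<Rightarrow> 'r" where
  "ev2 h u v f = poly (map_poly (\<lambda>p. poly (map_poly h p) v) f) u"

lemma rhom_map_poly:
  assumes "rhom h"
  shows "rhom (map_poly h)"
proof (rule rhomI)
  show "map_poly h 1 = 1"
    by (intro poly_eqI) (simp add: coeff_map_poly rhom_simps[OF assms] one_pCons coeff_pCons split: nat.split)
  show "map_poly h (p + q) = map_poly h p + map_poly h q" for p q
    by (intro poly_eqI) (simp add: coeff_map_poly rhom_simps[OF assms])
  show "map_poly h (p * q) = map_poly h p * map_poly h q" for p q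
    by (intro poly_eqI) (simp add: coeff_map_poly rhom_simps[OF assms] coeff_mult)
qed

lemma rhom_poly: "rhom (\<lambda>p. poly p v)"
  by (simp add: rhom_def)

lemma rhom_cst: "rhom cst"
  by (simp add: rhom_def one_pCons)

lemma rhom_ev2: "rhom h \<Longrightarrow> rhom (ev2 h u v)"
  unfolding ev2_def[abs_def]
  by (rule rhom_comp[OF rhom_poly rhom_map_poly])
    (rule rhom_comp[OF rhom_poly rhom_map_poly])

lemma ev2_generators [simp]:
  assumes "rhom h"
  shows "ev2 h u v (cst c) = h c" "ev2 h u v XX = u" "ev2 h u v YY = v"
  by (simp_all add: ev2_def map_poly_pCons rhom_simps[OF assms] one_pCons)

lemma bivariate_induct [case_names cst X Y add mult]:
  assumes "\<And>c. P (cst c)" "P XX" "P YY"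
    and "\<And>f g. P f \<Longrightarrow> P g \<Longrightarrow> P (f + g)"
    and "\<And>f g. P f \<Longrightarrow> P g \<Longrightarrow> P (f * g)"
  shows "P f"
proof (induction f)
  case 0
  show ?case
    using assms(1)[of 0] by simp
next
  case (pCons p f)
  have "P [:p:]"
  proof (induction p)
    case 0
    show ?case
      using assms(1)[of 0] by simp
  next
    case (pCons c p)
    have "[:pCons c p:] = cst c + YY * [:p:]"
      by simp
    then show ?case
      using assms pCons by metis
  qed
  moreover have "pCons p f = [:p:] + XX * f"
    by simp
  ultimately show ?case
    using assms pCons by metis
qed

lemma rhom_eqI:
  assumes "rhom \<Phi>" "rhom \<Psi>" "\<And>c. \<Phi> (cst c) = \<Psi> (cst c)" "\<Phi> XX = \<Psi> XX" "\<Phi> YY = \<Psi> YY"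
  shows "\<Phi> f = \<Psi> f"
  by (induction f rule: bivariate_induct) (simp_all only: assms rhom_simps[OF assms(1)] rhom_simps[OF assms(2)])

lemma bivariate_eqI: "(\<And>i j. cf f i j = cf g i j) \<Longrightarrow> f = g"
  by (intro poly_eqI) auto

lemma degree_map_poly_le:
  assumes "h 0 = 0"
  shows "degree (map_poly h p) \<le> degree p"
  by (intro degree_le) (simp add: coeff_map_poly assms coeff_eq_0)

lemma poly_altdef_le:
  fixes x :: "'r::comm_ring_1"
  assumes "degree p \<le> n"
  shows "poly p x = (\<Sum>i\<le>n. coeff p i * x ^ i)"
  unfolding poly_altdef by (rule sum.mono_neutral_left) (use assms in \<open>auto simp: coeff_eq_0 not_le\<close>)

lemma ev2_altdef:
  assumes "rhom h" "degree f \<le> a" "\<And>i. degree (coeff f i) \<le> b"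
  shows "ev2 h u v f = (\<Sum>i\<le>a. \<Sum>j\<le>b. h (cf f i j) * u ^ i * v ^ j)"
proof -
  have 1: "poly (map_poly h p) v = (\<Sum>j\<le>b. h (coeff p j) * v ^ j)" if "degree p \<le> b" for p
  proof -
    have "degree (map_poly h p) \<le> b"
      using that degree_map_poly_le[of h p, OF rhom_0[OF assms(1)]] by linarith
    then show ?thesis
      by (subst poly_altdef_le, assumption)
        (simp add: coeff_map_poly rhom_0[OF assms(1)])
  qed
  have z: "poly (map_poly h 0) v = 0"
    by simp
  have "degree (map_poly (\<lambda>p. poly (map_poly h p) v) f) \<le> a"
    using assms(2) degree_map_poly_le[of "\<lambda>p. poly (map_poly h p) v" f] by simp
  then show ?thesis
    unfolding ev2_def
    by (subst poly_altdef_le, assumption)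
      (simp add: coeff_map_poly 1 assms(3) sum_distrib_left mult_ac)
qed

definition swp :: "'k::comm_ring_1 poly poly \<Rightarrow> 'k poly poly" where
  "swp = ev2 cst YY XX"

lemma rhom_swp: "rhom swp"
  unfolding swp_def by (rule rhom_ev2[OF rhom_cst])

lemma cf_swp [simp]: "cf (swp f) i j = cf f j i"
proof -
  let ?b = "Max ((\<lambda>i. degree (coeff f i)) ` {..degree f})"
  have "degree (coeff f i) \<le> ?b" for i
  proof (cases "i \<le> degree f")
    case False
    then show ?thesis
      by (simp add: coeff_eq_0)
  qed (auto intro!: Max_ge)
  then obtain b where b: "\<And>i. degree (coeff f i) \<le> b"
    by blast
  have 1: "cst c * YY ^ m * XX ^ n = monom (monom c m) n" for c :: 'a and m n
  proof -
    have "YY ^ m = [:monom (1::'a) m:]"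
      by (induction m) (simp_all add: one_pCons monom_Suc monom_0)
    moreover have "XX ^ n = monom (1::'a poly) n"
      by (induction n) (simp_all add: monom_Suc monom_0)
    ultimately show ?thesis
      by (simp add: smult_monom)
  qed
  have "swp f = (\<Sum>m\<le>degree f. \<Sum>n\<le>b. monom (monom (cf f m n) m) n)"
    unfolding swp_def by (subst ev2_altdef[OF rhom_cst order_refl b]) (simp only: 1)
  then have "cf (swp f) i j = (\<Sum>m\<le>degree f. \<Sum>n\<le>b. if n = i then if m = j then cf f m n else 0 else 0)"
    by (simp add: coeff_sum if_distrib[of "\<lambda>p. coeff p _"] cong: if_cong)
  also have "\<dots> = (\<Sum>m\<le>degree f. if m = j then \<Sum>n\<le>b. if n = i then cf f m n else 0 else 0)"
    by (intro sum.cong refl) (auto intro!: sum.neutral)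
  also have "\<dots> = cf f j i"
  proof -
    have "i > b \<Longrightarrow> cf f j i = 0"
      by (meson b coeff_eq_0 le_less_trans)
    then show ?thesis
      by (auto simp: coeff_eq_0 not_le)
  qed
  finally show ?thesis .
qed

lemma swp_swp [simp]: "swp (swp f) = f"
  by (rule bivariate_eqI) simp

lemma swp_eq_0_iff [simp]: "swp f = 0 \<longleftrightarrow> f = 0"
  by (metis swp_swp rhom_0[OF rhom_swp])

definition degY :: "'k::comm_ring_1 poly poly \<Rightarrow> nat" where
  "degY f = degree (swp f)"

lemma degY_swp [simp]: "degY (swp f) = degree f" and degree_swp: "degree (swp f) = degY f"
  by (simp_all add: degY_def)

lemma degY_le_iff: "degY f \<le> b \<longleftrightarrow> (\<forall>i. degree (coeff f i) \<le> b)"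
proof
  assume "degY f \<le> b"
  then have "cf (swp f) j i = 0" if "j > b" for i j
    using that by (simp add: degY_def coeff_eq_0)
  then show "\<forall>i. degree (coeff f i) \<le> b"
    by (auto intro!: degree_le)
next
  assume "\<forall>i. degree (coeff f i) \<le> b"
  then have "cf f i j = 0" if "j > b" for i j
    using that by (metis coeff_eq_0 le_less_trans)
  then show "degY f \<le> b"
    unfolding degY_def by (intro degree_le allI impI) (rule poly_eqI, simp)
qed

lemma degY_leD: "degY f \<le> b \<Longrightarrow> degree (coeff f i) \<le> b"
  by (simp add: degY_le_iff)

lemma degY_leI: "(\<And>i j. j > b \<Longrightarrow> cf f i j = 0) \<Longrightarrow> degY f \<le> b"
  by (auto simp: degY_le_iff intro!: degree_le)

lemma degX_leI: "(\<And>i j. i > a \<Longrightarrow> cf f i j = 0) \<Longrightarrow> degree f \<le> a"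
  by (intro degree_le allI impI poly_eqI) simp

lemma degY_mult:
  fixes f g :: "'k::idom poly poly"
  assumes "f \<noteq> 0" "g \<noteq> 0"
  shows "degY (f * g) = degY f + degY g"
  using assms by (simp add: degY_def rhom_mult[OF rhom_swp] degree_mult_eq)

lemma degY_mult_le: "degY (f * g) \<le> degY f + degY g"
  by (simp add: degY_def rhom_mult[OF rhom_swp] degree_mult_le)

lemma bidegree_0_unit:
  fixes f :: "'k::field poly poly"
  assumes "f \<noteq> 0" "degree f = 0" "degY f = 0"
  shows "f = cst (cf f 0 0)" "cf f 0 0 \<noteq> 0" "is_unit f"
proof -
  have "degree (coeff f 0) = 0"
    using degY_leD[of f 0 0] assms by simp
  then show 1: "f = cst (cf f 0 0)"
    using assms(2) by (metis degree_0_id coeff_pCons_0 degree_eq_zeroE)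
  with assms(1) show 2: "cf f 0 0 \<noteq> 0"
    by (metis pCons_eq_0_iff)
  show "is_unit f"
    using 2 by (subst 1) (simp add: is_unit_const_poly_iff dvd_field_iff)
qed

lemma cf_eq_0_outside: "degree f \<le> a \<Longrightarrow> degY f \<le> b \<Longrightarrow> a < i \<or> b < j \<Longrightarrow> cf f i j = 0"
  using degY_leD[of f b i] by (auto simp: coeff_eq_0)

subsection \<open>Multiplicity at a point\<close>

text \<open>Multiplicities are read off on one chart of the blow-up of \<open>(x, y)\<close>, where the
  multiplicity is the order along the exceptional curve; this makes it additive.\<close>

definition blow :: "'k::comm_ring_1 \<Rightarrow> 'k \<Rightarrow> 'k poly poly \<Rightarrow> 'k poly poly" where
  "blow x y = ev2 cst [:[:x:], 1:] [:[:y:], [:0, 1:]:]"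

definition shift :: "'k::comm_ring_1 \<Rightarrow> 'k \<Rightarrow> 'k poly poly \<Rightarrow> 'k poly poly" where
  "shift x y = ev2 cst [:[:x:], 1:] [:[:y, 1:]:]"

abbreviation jet :: "'k::comm_ring_1 \<Rightarrow> 'k \<Rightarrow> nat \<Rightarrow> nat \<Rightarrow> 'k poly poly \<Rightarrow> 'k" where
  "jet x y p q f \<equiv> cf (shift x y f) p q"

text \<open>Stated by divisibility and not by \<open>ord\<close>, so that it covers the zero
  polynomial and is stable under sums.\<close>

definition vanishes :: "'k::comm_ring_1 \<Rightarrow> 'k \<Rightarrow> nat \<Rightarrow> 'k poly poly \<Rightarrow> bool" where
  "vanishes x y c f \<longleftrightarrow> monom 1 c dvd blow x y f"

definition ord :: "'k::idom \<Rightarrow> 'k \<Rightarrow> 'k poly poly \<Rightarrow> nat" where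
  "ord x y f = order 0 (blow x y f)"

lemma rhom_blow: "rhom (blow x y)" and rhom_shift: "rhom (shift x y)"
  by (simp_all add: blow_def shift_def rhom_ev2 rhom_cst)

lemma blow_generators [simp]:
  "blow x y (cst c) = cst c" "blow x y XX = [:[:x:], 1:]" "blow x y YY = [:[:y:], [:0, 1:]:]"
  by (simp_all add: blow_def rhom_cst)

lemma shift_generators [simp]:
  "shift x y (cst c) = cst c" "shift x y XX = [:[:x:], 1:]" "shift x y YY = [:[:y, 1:]:]"
  by (simp_all add: shift_def rhom_cst)

lemma XX_power: "XX ^ n = monom (1 :: 'k::comm_ring_1 poly) n"
  by (induction n) (simp_all add: monom_Suc monom_0)

lemma YY_power: "YY ^ n = [:monom (1 :: 'k::comm_ring_1) n:]"
  by (induction n) (simp_all add: one_pCons monom_Suc monom_0)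

text \<open>\<open>X^i Y^j\<close> goes to \<open>X^(i + j) Y^j\<close>: no two monomials collide,
  and the total degree becomes the degree in X.\<close>

lemma cf_ev2_blow: "cf (ev2 cst XX (XX * YY) f) n j = (if j \<le> n then cf f (n - j) j else 0)"
proof -
  have 1: "cst c * XX ^ l * (XX * YY) ^ m = monom (monom c m) (l + m)" for c :: 'a and l m
  proof -
    have "cst c * XX ^ l * (XX * YY) ^ m = [:[:c:]:] * (XX ^ (l + m) * YY ^ m)"
      by (simp only: power_mult_distrib power_add mult_ac)
    then show ?thesis
      by (simp add: XX_power YY_power smult_monom)
  qed
  have "ev2 cst XX (XX * YY) f =
      (\<Sum>l\<le>degree f. \<Sum>m\<le>degY f. monom (monom (cf f l m) m) (l + m))"
    by (subst ev2_altdef[OF rhom_cst order_refl degY_leD[OF order_refl]]) (simp only: 1)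
  then have "cf (ev2 cst XX (XX * YY) f) n j =
      (\<Sum>l\<le>degree f. \<Sum>m\<le>degY f. if m = j then if l + j = n then cf f l j else 0 else 0)"
    by (simp only: coeff_sum coeff_monom if_distrib[of "\<lambda>p. coeff p _"] coeff_0)
       (intro sum.cong refl, auto)
  also have "\<dots> = (\<Sum>l\<le>degree f. if l + j = n then cf f l j else 0)"
    by (intro sum.cong refl) (auto simp: cf_eq_0_outside[OF order_refl order_refl] not_le)
  also have "\<dots> = (if j \<le> n then cf f (n - j) j else 0)"
  proof (cases "j \<le> n")
    case True
    then have "l + j = n \<longleftrightarrow> l = n - j" for l
      by auto
    then show ?thesis
      using True by (auto simp: coeff_eq_0 not_le)
  qed (auto intro!: sum.neutral)
  finally show ?thesis .
qed

lemma blow_shift: "blow x y f = ev2 cst XX (XX * YY) (shift x y f)"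
proof (rule rhom_eqI[where \<Psi> = "\<lambda>f. ev2 cst XX (XX * YY) (shift x y f)"])
  have [simp]: "[:[:x:], 1:] = cst x + XX" "[:[:y, 1:]:] = cst y + YY"
    by simp_all
  show "blow x y XX = ev2 cst XX (XX * YY) (shift x y XX)"
    "blow x y YY = ev2 cst XX (XX * YY) (shift x y YY)"
    by (simp_all only: blow_generators shift_generators \<open>[:[:x:], 1:] = _\<close> \<open>[:[:y, 1:]:] = _\<close>
        rhom_add[OF rhom_ev2[OF rhom_cst]] ev2_generators[OF rhom_cst]) simp_all
qed (simp_all add: rhom_blow rhom_comp[OF rhom_ev2[OF rhom_cst] rhom_shift] rhom_cst)

lemma cf_blow: "cf (blow x y f) n j = (if j \<le> n then jet x y (n - j) j f else 0)"
  unfolding blow_shift by (rule cf_ev2_blow)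

lemma vanishes_iff_jets: "vanishes x y c f \<longleftrightarrow> (\<forall>p q. p + q < c \<longrightarrow> jet x y p q f = 0)"
proof
  assume "vanishes x y c f"
  then have *: "coeff (blow x y f) n = 0" if "n < c" for n
    using that by (simp add: vanishes_def monom_1_dvd_iff')
  show "\<forall>p q. p + q < c \<longrightarrow> jet x y p q f = 0"
  proof (intro allI impI)
    fix p q assume "p + q < c"
    then have "cf (blow x y f) (p + q) q = 0"
      using *[of "p + q"] by simp
    then show "jet x y p q f = 0"
      by (simp add: cf_blow)
  qed
next
  assume *: "\<forall>p q. p + q < c \<longrightarrow> jet x y p q f = 0"
  show "vanishes x y c f"
    unfolding vanishes_def monom_1_dvd_iff'
    by (intro allI impI poly_eqI) (use * in \<open>auto simp: cf_blow\<close>)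
qed

lemma shift_inverse: "shift (- x) (- y) (shift x y f) = f"
proof (rule rhom_eqI[where \<Psi> = "\<lambda>f. f"])
  have e: "[:[:x:], 1:] = cst x + XX" "[:[:y, 1:]:] = cst y + YY"
    by simp_all
  show "shift (- x) (- y) (shift x y XX) = XX" "shift (- x) (- y) (shift x y YY) = YY"
    by (simp_all only: shift_generators e rhom_add[OF rhom_shift]) simp_all
qed (simp_all add: rhom_comp[OF rhom_shift rhom_shift] rhom_def)

lemma shift_eq_0_iff [simp]: "shift x y f = 0 \<longleftrightarrow> f = 0"
  by (metis shift_inverse rhom_0[OF rhom_shift])

lemma blow_eq_0_iff [simp]: "blow x y f = 0 \<longleftrightarrow> f = 0"
proof
  assume "blow x y f = 0"
  then have "jet x y p q f = 0" for p q
    using cf_blow[of x y f "p + q" q] by simp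
  then have "shift x y f = 0"
    by (intro bivariate_eqI) simp
  then show "f = 0"
    by simp
qed (simp add: rhom_0[OF rhom_blow])

lemma vanishes_iff_ord: "f \<noteq> 0 \<Longrightarrow> vanishes x y c f \<longleftrightarrow> c \<le> ord x y f"
  by (simp add: vanishes_def ord_def monom_1_dvd_iff)

lemma vanishes_ord: "vanishes x y (ord x y f) f"
  by (cases "f = 0") (simp_all add: vanishes_iff_ord, simp add: vanishes_def rhom_0[OF rhom_blow])

lemma vanishes_mono: "vanishes x y c f \<Longrightarrow> c' \<le> c \<Longrightarrow> vanishes x y c' f"
  by (auto simp: vanishes_iff_jets)

lemma ord_mult: "f \<noteq> 0 \<Longrightarrow> g \<noteq> 0 \<Longrightarrow> ord x y (f * g) = ord x y f + ord x y g"
  by (simp add: ord_def rhom_mult[OF rhom_blow] order_mult)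

lemma ord_cst [simp]: "c \<noteq> 0 \<Longrightarrow> ord x y (cst c) = 0"
  by (simp add: ord_def order_0I)

lemma vanishes_add: "vanishes x y c f \<Longrightarrow> vanishes x y c g \<Longrightarrow> vanishes x y c (f + g)"
  by (simp add: vanishes_iff_jets rhom_add[OF rhom_shift])

lemma vanishes_mult:
  "vanishes x y c f \<Longrightarrow> vanishes x y c' g \<Longrightarrow> vanishes x y (c + c') (f * g)"
proof -
  assume "vanishes x y c f" "vanishes x y c' g"
  then have "monom 1 c * monom 1 c' dvd blow x y (f * g)"
    by (simp add: vanishes_def rhom_mult[OF rhom_blow] mult_dvd_mono)
  then show ?thesis
    by (simp add: vanishes_def mult_monom)
qed

lemma vanishes_0 [simp]: "vanishes x y 0 f" "vanishes x y c 0"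
  by (auto simp: vanishes_iff_jets rhom_0[OF rhom_shift])

text \<open>Jets are divided derivatives, hence linear in the coefficients, with factors that are
  integer polynomials in the point. This is the source of \<open>jet_matrix\<close> and the reason
  why jets commute with field homomorphisms in \<open>jet_dmap\<close>.\<close>

lemma jet_altdef:
  assumes "degree f \<le> a" "degY f \<le> b"
  shows "jet x y p q f = (\<Sum>i\<le>a. \<Sum>j\<le>b. cf f i j *
    (of_nat (i choose p) * x ^ (i - p)) * (of_nat (j choose q) * y ^ (j - q)))"
proof -
  have U: "coeff ([:c, 1:] ^ i) p = of_nat (i choose p) * c ^ (i - p)"
    for c :: "'b::comm_ring_1" and i p
  proof (cases "p \<le> i")
    case True
    then show ?thesis
      by (simp add: coeff_linear_poly_power)
  next
    case False
    then have "degree ([:c, 1:] ^ i) < p"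
      using degree_power_le[of "[:c, 1:]" i] by simp
    with False show ?thesis
      by (simp add: coeff_eq_0 binomial_eq_0)
  qed
  have V: "[:w:] ^ j = [:w ^ j:]" for w :: "'a poly" and j
    by (induction j) (simp_all add: one_pCons)
  have C: "[:c:] ^ n = [:c ^ n:]" for c :: 'a and n
    by (induction n) (simp_all add: one_pCons)
  have N: "of_nat n = [:of_nat n :: 'a:]" for n
    by (simp add: of_nat_poly)
  have "shift x y f = (\<Sum>i\<le>a. \<Sum>j\<le>b. cst (cf f i j) * [:[:x:], 1:] ^ i * [:[:y, 1:]:] ^ j)"
    unfolding shift_def by (rule ev2_altdef[OF rhom_cst assms(1) degY_leD[OF assms(2)]])
  then have "jet x y p q f =
      (\<Sum>i\<le>a. \<Sum>j\<le>b. cf (cst (cf f i j) * [:[:x:], 1:] ^ i * [:[:y, 1:]:] ^ j) p q)"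
    by (simp add: coeff_sum)
  moreover have "cf (cst c * [:[:x:], 1:] ^ i * [:[:y, 1:]:] ^ j) p q =
      c * (of_nat (i choose p) * x ^ (i - p)) * (of_nat (j choose q) * y ^ (j - q))" for c i j
  proof -
    have "cst c * [:[:x:], 1:] ^ i * [:[:y, 1:]:] ^ j = smult ([:c:] * [:y, 1:] ^ j) ([:[:x:], 1:] ^ i)"
      by (simp add: V mult_ac)
    then have "coeff (cst c * [:[:x:], 1:] ^ i * [:[:y, 1:]:] ^ j) p =
        [:c:] * [:y, 1:] ^ j * (of_nat (i choose p) * [:x:] ^ (i - p))"
      by (simp add: U)
    also have "\<dots> = smult (c * (of_nat (i choose p) * x ^ (i - p))) ([:y, 1:] ^ j)"
      by (simp add: C N mult_ac)
    finally show ?thesis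
      by (simp add: U)
  qed
  ultimately show ?thesis
    by simp
qed

lemma degY_shift_le: "degY (shift x y f) \<le> degY f"
  by (rule degY_leI)
     (subst jet_altdef[OF order_refl order_refl], auto intro!: sum.neutral simp: binomial_eq_0)

text \<open>Restriction to the line X = x: a curve that does not contain it meets it in at most
  \<open>degY f\<close> points, counted with multiplicity.\<close>

lemma ord_le_degY:
  assumes "f \<noteq> 0" "\<not> [:[:- x:], 1:] dvd f"
  shows "ord x y f \<le> degY f"
proof (rule ccontr)
  assume *: "\<not> ?thesis"
  have "jet x y 0 q f = 0" for q
  proof (cases "q \<le> degY f")
    case True
    then show ?thesis
      using vanishes_ord[of x y f] * by (simp add: vanishes_iff_jets)
  next
    case False
    then show ?thesis
      by (intro cf_eq_0_outside[OF order_refl degY_shift_le]) simp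
  qed
  then have "coeff (shift x y f) 0 = 0"
    by (intro poly_eqI) simp
  then have "XX dvd shift x y f"
    using monom_1_dvd_iff'[of 1 "shift x y f"] by (simp add: monom_altdef)
  then have "shift (- x) (- y) XX dvd shift (- x) (- y) (shift x y f)"
    by (rule rhom_dvd[OF rhom_shift])
  with assms(2) show False
    by (simp add: shift_inverse)
qed

subsection \<open>The inequality of Bezout on a product of two lines\<close>

definition tri :: "nat \<Rightarrow> (nat \<times> nat) set" where
  "tri n = {(p, q). p + q < n}"

lemma tri_Suc: "tri (Suc n) = tri n \<union> (\<lambda>p. (p, n - p)) ` {..n}"
  by (auto simp: tri_def image_iff less_Suc_eq)

lemma finite_tri [simp]: "finite (tri n)"
  by (rule finite_subset[of _ "{..<n} \<times> {..<n}"]) (auto simp: tri_def)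

lemma card_tri: "2 * card (tri n) = n * (n + 1)"
proof (induction n)
  case 0
  show ?case
    by (simp add: tri_def)
next
  case (Suc n)
  have "card (tri (Suc n)) = card (tri n) + card ((\<lambda>p. (p, n - p)) ` {..n})"
    unfolding tri_Suc by (rule card_Un_disjoint) (simp_all, auto simp: tri_def)
  also have "card ((\<lambda>p. (p, n - p)) ` {..n}) = Suc n"
    by (subst card_image) (auto simp: inj_on_def)
  finally show ?case
    using Suc by simp
qed

definition mon :: "nat \<Rightarrow> nat \<Rightarrow> 'k::comm_ring_1 poly poly" where
  "mon i j = monom (monom 1 j) i"

lemma cf_mon: "cf (mon i j) m n = (if m = i \<and> n = j then 1 else 0)"
  by (simp add: mon_def)

lemma degree_mon_le: "degree (mon i j) \<le> i" and degY_mon_le: "degY (mon i j) \<le> j"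
  by (auto intro!: degX_leI degY_leI simp: cf_mon)

lemma cf_cst_mult [simp]: "cf (cst c * f) i j = c * cf f i j"
  by simp

lemma jet_cst_mult: "jet x y p q (cst c * f) = c * jet x y p q f"
  by (simp only: rhom_mult[OF rhom_shift] shift_generators cf_cst_mult)

lemma degY_power_le: "degY (f ^ n) \<le> n * degY f"
  unfolding degY_def rhom_power[OF rhom_swp] using degree_power_le[of "swp f" n] by (simp add: mult.commute)

lemma degY_prod_le: "degY (\<Prod>i\<in>A. f i) \<le> (\<Sum>i\<in>A. degY (f i))"
proof (induction A rule: infinite_finite_induct)
  case (insert i A)
  then show ?case
    using degY_mult_le[of "f i" "\<Prod>i\<in>A. f i"] by simp
qed (simp_all add: degY_def rhom_1[OF rhom_swp])

lemma degree_prod_le: "degree (\<Prod>i\<in>A. f i) \<le> (\<Sum>i\<in>A. degree (f i :: 'a::comm_ring_1 poly))"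
proof (induction A rule: infinite_finite_induct)
  case (insert i A)
  then show ?case
    using degree_mult_le[of "f i" "\<Prod>i\<in>A. f i"] by simp
qed simp_all

lemma degY_X_minus [simp]: "degY [:[:- x:], 1:] = 0"
  using degY_leI[of 0 "[:[:- x:], 1:]"] by (simp add: coeff_pCons split: nat.splits)

lemma degY_Y_minus: "degY [:[:- y, 1:]:] \<le> 1"
  by (rule degY_leI) (simp add: coeff_pCons split: nat.splits)

lemma shift_X_minus: "shift x y [:[:- a:], 1:] = [:[:x - a:], 1:]"
  and shift_Y_minus: "shift x y [:[:- b, 1:]:] = [:[:y - b, 1:]:]"
proof -
  have e: "[:[:- a:], 1:] = XX + cst (- a)" "[:[:- b, 1:]:] = YY + cst (- b)"
    by simp_all
  show "shift x y [:[:- a:], 1:] = [:[:x - a:], 1:]" "shift x y [:[:- b, 1:]:] = [:[:y - b, 1:]:]"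
    unfolding e rhom_add[OF rhom_shift] shift_generators by simp_all
qed

lemma blow_X_minus: "blow x y [:[:- a:], 1:] = [:[:x - a:], 1:]"
proof -
  have e: "[:[:- a:], 1:] = XX + cst (- a)"
    by simp
  show ?thesis
    unfolding e rhom_add[OF rhom_blow] blow_generators by simp
qed

lemma ord_prod_X_minus:
  fixes x y :: "'k::field"
  assumes "finite L" "x \<notin> a ` L"
  shows "ord x y (\<Prod>l\<in>L. [:[:- a l:], 1:] ^ n) = 0"
proof -
  have "poly (blow x y (\<Prod>l\<in>L. [:[:- a l:], 1:] ^ n)) 0 = (\<Prod>l\<in>L. [:x - a l:] ^ n)"
    by (simp add: rhom_prod[OF rhom_blow] rhom_power[OF rhom_blow] blow_X_minus poly_prod)
  moreover have "\<dots> \<noteq> 0"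
    using assms by (auto simp: prod_zero_iff)
  ultimately show ?thesis
    unfolding ord_def by (intro order_0I) simp
qed

lemma vanishes_prod_X_minus:
  assumes "finite L" "l \<in> L"
  shows "vanishes (a l) y n (\<Prod>l\<in>L. [:[:- a l:], 1:] ^ n)"
proof -
  have 1: "vanishes (a l) y n ([:[:- a l:], 1:] ^ n)"
    using rhom_power[OF rhom_blow, of "a l" y "[:[:- a l:], 1:]" n]
    by (simp add: vanishes_def blow_X_minus XX_power)
  have "(\<Prod>l\<in>L. [:[:- a l:], 1:] ^ n) = [:[:- a l:], 1:] ^ n * (\<Prod>l\<in>L - {l}. [:[:- a l:], 1:] ^ n)"
    using assms by (simp add: prod.remove)
  then show ?thesis
    using vanishes_mult[OF 1 vanishes_0(1)] by simp
qed

lemma vanishes_sum: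
  "(\<And>i. i \<in> A \<Longrightarrow> vanishes x y c (f i)) \<Longrightarrow> vanishes x y c (\<Sum>i\<in>A. f i)"
  by (simp add: vanishes_iff_jets rhom_sum[OF rhom_shift] coeff_sum)

lemma vanishes_minus: "vanishes x y c f \<Longrightarrow> vanishes x y c (- f)"
  by (simp add: vanishes_iff_jets rhom_minus[OF rhom_shift])

lemma vanishes_mult_left: "vanishes x y c g \<Longrightarrow> vanishes x y c (f * g)"
  using vanishes_mult[OF vanishes_0(1), of x y c g f] by simp

lemma local_expansion_zero:
  assumes "vanishes x y n (\<Sum>(p, q)\<in>tri n. cst (c (p, q)) * [:[:- x:], 1:] ^ p * [:[:- y, 1:]:] ^ q)"
    and "(p, q) \<in> tri n"
  shows "c (p, q) = 0"
proof -
  let ?V = "\<Sum>(p, q)\<in>tri n. cst (c (p, q)) * [:[:- x:], 1:] ^ p * [:[:- y, 1:]:] ^ q"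
  have "shift x y ?V = (\<Sum>(p, q)\<in>tri n. cst (c (p, q)) * XX ^ p * YY ^ q)"
    unfolding rhom_sum[OF rhom_shift]
    by (intro sum.cong refl)
      (auto simp only: split_beta rhom_mult[OF rhom_shift] rhom_power[OF rhom_shift]
        shift_X_minus shift_Y_minus shift_generators diff_self split: prod.splits, simp)
  also have "\<dots> = (\<Sum>(p, q)\<in>tri n. cst (c (p, q)) * mon p q)"
    by (intro sum.cong refl) (auto simp: XX_power YY_power mon_def smult_monom)
  finally have "jet x y p q ?V = (\<Sum>u\<in>tri n. c u * cf (mon (fst u) (snd u)) p q)"
    by (simp add: coeff_sum split_beta)
  also have "\<dots> = (\<Sum>u\<in>tri n. if u = (p, q) then c u else 0)"
    by (intro sum.cong refl) (auto simp: cf_mon)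
  also have "\<dots> = c (p, q)"
    using assms(2) by simp
  finally show ?thesis
    using assms by (simp add: vanishes_iff_jets tri_def)
qed

text \<open>Count unknowns against equations in \<open>g A + h B + \<Lambda> = 0\<close>, where \<open>\<Lambda>\<close> runs through
  polynomials interpolating arbitrary jets of order \<open>c' l\<close> at the points and \<open>A\<close> is required to
  vanish to order \<open>c' l - c l\<close>: then \<open>\<Lambda>\<close> has zero jets, so \<open>\<Lambda> = 0\<close>, and \<open>g\<close> divides \<open>B\<close>,
  which has too small a degree.\<close>

lemma bezout_jets:
  fixes g h :: "'k::field_gcd poly poly" and x y :: "'i \<Rightarrow> 'k"
  assumes g: "irreducible g" and h: "\<not> g dvd h" and L: "finite L" "inj_on x L"
    and dg: "degree g \<le> a" "degY g = b" and dh: "degree h \<le> a'" "degY h \<le> b'"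
    and vg: "\<And>l. l \<in> L \<Longrightarrow> vanishes (x l) (y l) (c l) g"
    and vh: "\<And>l. l \<in> L \<Longrightarrow> vanishes (x l) (y l) (c' l) h"
    and c': "\<And>l. l \<in> L \<Longrightarrow> c' l \<le> b'"
  shows "(\<Sum>l\<in>L. card (tri (c' l))) \<le> a * b' + a' * b + (\<Sum>l\<in>L. card (tri (c' l - c l)))"
proof (rule ccontr)
  assume neg: "\<not> ?thesis"
  \<comment> \<open>Large enough for \<open>g * A\<close>, \<open>h * B\<close> and all the
    interpolating polynomials \<open>U\<close>; no subtraction from \<open>N\<close> is
    truncated.\<close>
  define N where "N = a + a' + b' + card L * b'"
  \<comment> \<open>A local monomial at the point \<open>l\<close>, times a product that is nonzero
    there, the \<open>x j\<close> being distinct, and vanishes to order \<open>b'\<close>, hence to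
    order \<open>c' j\<close>, at every other point \<open>j\<close>.\<close>
  define U where "U l p q = [:[:- x l:], 1:] ^ p * [:[:- y l, 1:]:] ^ q *
    (\<Prod>j\<in>L - {l}. [:[:- x j:], 1:] ^ b')" for l p q
  define JA where "JA = {..N - a} \<times> {..<b'}"
  \<comment> \<open>The bound \<open>b = degY g\<close> on the degree of \<open>B\<close> in Y
    excludes the trivial relations \<open>A = h * k\<close>, \<open>B = - g * k\<close>.\<close>
  define JB where "JB = {..N - a'} \<times> {..<b}"
  define JL where "JL = (SIGMA l:L. tri (c' l))"
  define J where "J = (JA <+> JB) <+> JL"
  define I where "I = ({..N} \<times> {..<b + b'}) <+> (SIGMA l:L. tri (c' l - c l))"
  define P where "P u = (case u of Inl (Inl (i, j)) \<Rightarrow> g * mon i j | Inl (Inr (i, j)) \<Rightarrow> h * mon i j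
    | Inr (l, p, q) \<Rightarrow> U l p q)" for u
  define R where "R u = (case u of Inl (Inl (i, j)) \<Rightarrow> mon i j :: 'k poly poly | _ \<Rightarrow> 0)"
    for u :: "(nat \<times> nat + nat \<times> nat) + 'i \<times> nat \<times> nat"
  define M where "M e u = (case e of Inl (i, j) \<Rightarrow> cf (P u) i j
    | Inr (l, p, q) \<Rightarrow> jet (x l) (y l) p q (R u))" for e u
  have fin: "finite JA" "finite JB" "finite JL" "finite J" "finite I"
    using L by (auto simp: JA_def JB_def JL_def J_def I_def)
  have "card I = (N + 1) * (b + b') + (\<Sum>l\<in>L. card (tri (c' l - c l)))"
    using L by (simp add: I_def card_Plus card_cartesian_product)
  moreover have "card J = (N - a + 1) * b' + (N - a' + 1) * b + (\<Sum>l\<in>L. card (tri (c' l)))"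
    using L fin by (simp add: J_def JA_def JB_def JL_def card_Plus card_cartesian_product)
  moreover have "(N - a + 1) * b' + a * b' = (N + 1) * b'" "(N - a' + 1) * b + a' * b = (N + 1) * b"
    by (simp_all add: N_def flip: add_mult_distrib)
  ultimately have "card I < card J"
    using neg by (simp add: distrib_left)
  then obtain s where s: "\<exists>u\<in>J. s u \<noteq> 0" "\<And>e. e \<in> I \<Longrightarrow> (\<Sum>u\<in>J. M e u * s u) = 0"
    using underdetermined_system[OF fin(5,4), of M] by blast
  define A where "A = (\<Sum>u\<in>JA. cst (s (Inl (Inl u))) * mon (fst u) (snd u))"
  define B where "B = (\<Sum>u\<in>JB. cst (s (Inl (Inr u))) * mon (fst u) (snd u))"
  define \<Lambda> where "\<Lambda> = (\<Sum>u\<in>JL. cst (s (Inr u)) * U (fst u) (fst (snd u)) (snd (snd u)))"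
  define S where "S = (\<Sum>u\<in>J. cst (s u) * P u)"
  have S: "S = g * A + h * B + \<Lambda>"
    unfolding S_def J_def A_def B_def \<Lambda>_def
    using fin by (simp add: sum.Plus P_def sum_distrib_left split_beta mult_ac)
  have A': "A = (\<Sum>u\<in>J. cst (s u) * R u)"
    unfolding J_def A_def using fin by (simp add: sum.Plus R_def split_beta)
  have U: "degree (U l p q) \<le> N \<and> degY (U l p q) < b + b'" if "l \<in> L" "(p, q) \<in> tri (c' l)" for l p q
  proof -
    have 1: "degree ([:[:- x j:], 1:] ^ n :: 'k poly poly) \<le> n" for j n
      using degree_power_le[of "[:[:- x j:], 1:] :: 'k poly poly" n] by simp
    have 2: "degY ([:[:- x j:], 1:] ^ n :: 'k poly poly) \<le> 0" for j n
      using degY_power_le[of "[:[:- x j:], 1:] :: 'k poly poly" n] by simp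
    have 3: "degree ([:[:- y l, 1:]:] ^ q :: 'k poly poly) \<le> 0"
      using degree_power_le[of "[:[:- y l, 1:]:] :: 'k poly poly" q] by simp
    have 4: "degY ([:[:- y l, 1:]:] ^ q :: 'k poly poly) \<le> q"
      using degY_power_le[of "[:[:- y l, 1:]:] :: 'k poly poly" q] degY_Y_minus[of "y l"]
        mult_le_mono2[of "degY [:[:- y l, 1:]:]" 1 q] by linarith
    have "degree (\<Prod>j\<in>L - {l}. [:[:- x j:], 1:] ^ b' :: 'k poly poly) \<le> (\<Sum>j\<in>L - {l}. b')"
      by (rule order_trans[OF degree_prod_le sum_mono[OF 1]])
    also have "\<dots> \<le> card L * b'"
      using L by (simp add: card_Diff_singleton_if)
    finally have 5: "degree (\<Prod>j\<in>L - {l}. [:[:- x j:], 1:] ^ b' :: 'k poly poly) \<le> card L * b'" .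
    have 6: "degY (\<Prod>j\<in>L - {l}. [:[:- x j:], 1:] ^ b' :: 'k poly poly) \<le> 0"
      using order_trans[OF degY_prod_le sum_mono[OF 2]] by simp
    have pq: "p \<le> b'" "q < b'"
      using that c'[of l] by (auto simp: tri_def)
    have "degree (U l p q) \<le> p + 0 + card L * b'"
      unfolding U_def
      by (intro order_trans[OF degree_mult_le] add_mono 1 3 5)
    moreover have "degY (U l p q) \<le> 0 + q + 0"
      unfolding U_def by (intro order_trans[OF degY_mult_le] add_mono 2 4 6)
    ultimately show ?thesis
      using pq by (simp add: N_def)
  qed
  have P: "degree (P u) \<le> N \<and> degY (P u) < b + b'" if u: "u \<in> J" for u
  proof -
    consider i j where "u = Inl (Inl (i, j))" "i \<le> N - a" "j < b'"
      | i j where "u = Inl (Inr (i, j))" "i \<le> N - a'" "j < b"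
      | l p q where "u = Inr (l, p, q)" "l \<in> L" "(p, q) \<in> tri (c' l)"
      using u by (auto simp: J_def JA_def JB_def JL_def)
    then show ?thesis
    proof cases
      case 1
      have "degree (g * mon i j) \<le> a + i" "degY (g * mon i j) \<le> b + j"
        using dg by (meson order_trans[OF degree_mult_le] order_trans[OF degY_mult_le] add_mono
            degree_mon_le degY_mon_le order_refl order_eq_refl)+
      with 1 show ?thesis
        by (simp add: P_def N_def)
    next
      case 2
      have "degree (h * mon i j) \<le> a' + i" "degY (h * mon i j) \<le> b' + j"
        using dh by (meson order_trans[OF degree_mult_le] order_trans[OF degY_mult_le] add_mono
            degree_mon_le degY_mon_le)+
      with 2 show ?thesis
        by (simp add: P_def N_def)
    next
      case 3
      with U show ?thesis
        by (simp add: P_def)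
    qed
  qed
  have "cf S i j = 0" for i j
  proof (cases "i \<le> N \<and> j < b + b'")
    case True
    then have "(\<Sum>u\<in>J. M (Inl (i, j)) u * s u) = 0"
      by (intro s(2)) (auto simp: I_def)
    then show ?thesis
      by (simp add: S_def coeff_sum M_def mult.commute)
  next
    case False
    then have "cf (P u) i j = 0" if "u \<in> J" for u
      using P[OF that] by (intro cf_eq_0_outside[OF order_refl order_refl]) auto
    then show ?thesis
      by (simp add: S_def coeff_sum)
  qed
  then have S0: "S = 0"
    by (intro bivariate_eqI) simp
  have vA: "vanishes (x l) (y l) (c' l - c l) A" if "l \<in> L" for l
    unfolding vanishes_iff_jets
  proof (intro allI impI)
    fix p q assume "p + q < c' l - c l"
    with that have "(\<Sum>u\<in>J. M (Inr (l, p, q)) u * s u) = 0"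
      by (intro s(2)) (auto simp: I_def tri_def)
    then show "jet (x l) (y l) p q A = 0"
      by (simp only: A' rhom_sum[OF rhom_shift] coeff_sum jet_cst_mult) (simp add: M_def mult.commute)
  qed
  have v\<Lambda>: "vanishes (x l) (y l) (c' l) \<Lambda>" if "l \<in> L" for l
  proof -
    have "vanishes (x l) (y l) (c' l) (g * A)"
      using vanishes_mono[OF vanishes_mult[OF vg[OF that] vA[OF that]], of "c' l"] by simp
    moreover have "vanishes (x l) (y l) (c' l) (h * B)"
      using vanishes_mult[OF vh[OF that] vanishes_0(1), of B] by simp
    ultimately have "vanishes (x l) (y l) (c' l) (- (g * A + h * B))"
      by (intro vanishes_minus vanishes_add)
    moreover have "\<Lambda> = - (g * A + h * B)"
      using S S0 by (metis add.commute eq_neg_iff_add_eq_0)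
    ultimately show ?thesis
      by simp
  qed
  have s\<Lambda>: "s (Inr (l, p, q)) = 0" if l: "l \<in> L" and pq: "(p, q) \<in> tri (c' l)" for l p q
  proof -
    define V where "V = (\<Sum>(p, q)\<in>tri (c' l).
      cst (s (Inr (l, p, q))) * [:[:- x l:], 1:] ^ p * [:[:- y l, 1:]:] ^ q)"
    define W where "W = (\<Prod>j\<in>L - {l}. [:[:- x j:], 1:] ^ b')"
    have "\<Lambda> = (\<Sum>k\<in>L. \<Sum>(p, q)\<in>tri (c' k). cst (s (Inr (k, p, q))) * U k p q)"
      unfolding \<Lambda>_def JL_def using L by (subst sum.Sigma) (simp_all add: split_beta)
    also have "\<dots> = (\<Sum>(p, q)\<in>tri (c' l). cst (s (Inr (l, p, q))) * U l p q) +
        (\<Sum>k\<in>L - {l}. \<Sum>(p, q)\<in>tri (c' k). cst (s (Inr (k, p, q))) * U k p q)"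
      using L l by (simp add: sum.remove)
    also have "(\<Sum>(p, q)\<in>tri (c' l). cst (s (Inr (l, p, q))) * U l p q) = V * W"
      unfolding V_def W_def U_def sum_distrib_right
      by (intro sum.cong refl) (simp add: split_beta mult_ac)
    finally have VW_eq: "V * W = \<Lambda> + - (\<Sum>k\<in>L - {l}. \<Sum>(p, q)\<in>tri (c' k). cst (s (Inr (k, p, q))) * U k p q)"
      by simp
    have "vanishes (x l) (y l) (c' l) (U k p q)" if "k \<in> L - {l}" for k p q
    proof -
      have "vanishes (x l) (y l) b' (\<Prod>j\<in>L - {k}. [:[:- x j:], 1:] ^ b')"
        using L l that by (intro vanishes_prod_X_minus) auto
      then have "vanishes (x l) (y l) (c' l) (\<Prod>j\<in>L - {k}. [:[:- x j:], 1:] ^ b')"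
        using c'[OF l] by (rule vanishes_mono)
      then show ?thesis
        unfolding U_def by (rule vanishes_mult_left)
    qed
    then have "vanishes (x l) (y l) (c' l) (cst d * U k p q)" if "k \<in> L - {l}" for k p q d
      using that by (blast intro: vanishes_mult_left)
    then have VW: "vanishes (x l) (y l) (c' l) (V * W)"
      unfolding VW_eq using v\<Lambda>[OF l]
      by (intro vanishes_add vanishes_minus vanishes_sum) (simp_all only: split_beta)
    have W: "W \<noteq> 0"
      unfolding W_def using L by (simp add: prod_zero_iff)
    \<comment> \<open>The cofactor does not vanish at the point, so \<open>V\<close> inherits the
      vanishing to order \<open>c' l\<close>; as \<open>V\<close> consists of jets of smaller order,
      they are all zero.\<close>
    have "ord (x l) (y l) W = 0"
      unfolding W_def using L l by (intro ord_prod_X_minus) (auto dest: inj_onD)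
    then have "vanishes (x l) (y l) (c' l) V"
      using VW W by (cases "V = 0") (auto simp: vanishes_iff_ord ord_mult)
    then show ?thesis
      using local_expansion_zero[of "x l" "y l" "c' l" "\<lambda>u. s (Inr (l, u))" p q] pq
      by (simp add: V_def)
  qed
  then have "\<Lambda> = 0"
    unfolding \<Lambda>_def JL_def by (intro sum.neutral) auto
  with S S0 have AB: "g * A + h * B = 0"
    by simp
  then have "g dvd h * B"
    by (metis add.commute add_eq_0_iff dvd_minus_iff dvd_triv_left)
  with g h have "g dvd B"
    using irreducible_dvd_mult by blast
  moreover have cB: "cf B i j = (if (i, j) \<in> JB then s (Inl (Inr (i, j))) else 0)" for i j
  proof -
    have "cf B i j = (\<Sum>u\<in>JB. if u = (i, j) then s (Inl (Inr u)) else 0)"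
      unfolding B_def by (auto simp: coeff_sum cf_mon intro!: sum.cong)
    then show ?thesis
      using fin by simp
  qed
  have "B = 0"
  proof (rule ccontr)
    assume "B \<noteq> 0"
    then obtain i j where "cf B i j \<noteq> 0"
      by (metis bivariate_eqI coeff_0)
    then have "b > 0"
      by (auto simp: cB JB_def split: if_splits)
    moreover have "degY B \<le> b - 1"
      by (rule degY_leI) (auto simp: cB JB_def)
    moreover obtain k where "B = g * k"
      using \<open>g dvd B\<close> by blast
    moreover have "degY (g * k) \<ge> b"
      using \<open>B \<noteq> 0\<close> \<open>B = g * k\<close> dg by (subst degY_mult) auto
    ultimately show False
      by simp
  qed
  with AB g have "A = 0"
    by auto
  have cA: "cf A i j = (if (i, j) \<in> JA then s (Inl (Inl (i, j))) else 0)" for i j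
  proof -
    have "cf A i j = (\<Sum>u\<in>JA. if u = (i, j) then s (Inl (Inl u)) else 0)"
      unfolding A_def by (auto simp: coeff_sum cf_mon intro!: sum.cong)
    then show ?thesis
      using fin by simp
  qed
  have "s u = 0" if u: "u \<in> J" for u
  proof -
    consider i j where "u = Inl (Inl (i, j))" "(i, j) \<in> JA"
      | i j where "u = Inl (Inr (i, j))" "(i, j) \<in> JB"
      | l p q where "u = Inr (l, p, q)" "l \<in> L" "(p, q) \<in> tri (c' l)"
      using u by (auto simp: J_def JL_def)
    then show ?thesis
      using cA cB s\<Lambda> \<open>A = 0\<close> \<open>B = 0\<close> by cases (metis coeff_0)+
  qed
  with s(1) show False
    by blast
qed

text \<open>Twice the difference of the two triangular counts falls short of
  \<open>2 * c l * c' l\<close> by at most \<open>c l * c l\<close>. Replacing \<open>h\<close> by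
  \<open>h ^ k\<close> multiplies degrees and intersection numbers by \<open>k\<close> and leaves
  this loss unchanged, so a large \<open>k\<close> makes it harmless.\<close>

theorem bezout_inequality:
  fixes g h :: "'k::field_gcd poly poly" and x y :: "'i \<Rightarrow> 'k"
  assumes g: "irreducible g" and h: "\<not> g dvd h" and L: "finite L" "inj_on x L"
    and dh: "degree h \<le> a'" "degY h \<le> b'"
    and vg: "\<And>l. l \<in> L \<Longrightarrow> vanishes (x l) (y l) (c l) g"
    and vh: "\<And>l. l \<in> L \<Longrightarrow> vanishes (x l) (y l) (c' l) h"
    and c': "\<And>l. l \<in> L \<Longrightarrow> c' l \<le> b'"
  shows "(\<Sum>l\<in>L. c l * c' l) \<le> degree g * b' + a' * degY g"
proof (rule ccontr)
  let ?D = "degree g * b' + a' * degY g" and ?S = "\<Sum>l\<in>L. c l * c' l"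
  assume "\<not> ?thesis"
  then have less: "?D + 1 \<le> ?S"
    by simp
  define k where "k = (\<Sum>l\<in>L. c l * c l) + 1"
  have "\<not> g dvd h ^ k"
    using g h by (meson irreducible_imp_prime_elem prime_elem_dvd_power)
  moreover have "degree (h ^ k) \<le> k * a'"
    using order_trans[OF degree_power_le[of h k] mult_le_mono1[OF dh(1), of k]] by (simp only: mult.commute)
  moreover have "degY (h ^ k) \<le> k * b'"
    using order_trans[OF degY_power_le[of h k] mult_le_mono2[OF dh(2), of k]] .
  moreover have "vanishes (x l) (y l) (k * c' l) (h ^ k)" if "l \<in> L" for l
    by (induction k) (use vh[OF that] in \<open>auto intro: vanishes_mult\<close>)
  ultimately have "(\<Sum>l\<in>L. card (tri (k * c' l))) \<le>
      degree g * (k * b') + k * a' * degY g + (\<Sum>l\<in>L. card (tri (k * c' l - c l)))"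
    using c' by (intro bezout_jets[OF g _ L order_refl refl _ _ vg]) auto
  then have "(\<Sum>l\<in>L. 2 * card (tri (k * c' l))) \<le>
      2 * (k * ?D) + (\<Sum>l\<in>L. 2 * card (tri (k * c' l - c l)))"
    by (simp add: sum_distrib_left[symmetric] algebra_simps)
  moreover have "2 * card (tri (k * c' l - c l)) + 2 * (k * (c l * c' l)) \<le>
      2 * card (tri (k * c' l)) + c l * c l" for l
  proof -
    have *: "2 * card (tri (n - m)) + 2 * (m * n) \<le> 2 * card (tri n) + m * m" for m n
    proof (cases "m \<le> n")
      case True
      then obtain d where "n = m + d"
        using le_Suc_ex by blast
      then show ?thesis
        unfolding card_tri by (simp add: algebra_simps)
    next
      case False
      then obtain d where "m = n + d"
        by (metis le_Suc_ex nat_le_linear)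
      then show ?thesis
        unfolding card_tri by (simp add: algebra_simps)
    qed
    show ?thesis
      using *[of "k * c' l" "c l"] by (simp add: mult_ac)
  qed
  then have "(\<Sum>l\<in>L. 2 * card (tri (k * c' l - c l)) + 2 * (k * (c l * c' l))) \<le>
      (\<Sum>l\<in>L. 2 * card (tri (k * c' l)) + c l * c l)"
    by (rule sum_mono)
  moreover have "k * (?D + 1) \<le> k * ?S"
    using less by (rule mult_le_mono2)
  ultimately have "2 * k \<le> (\<Sum>l\<in>L. c l * c l)"
    by (simp add: sum.distrib sum_distrib_left[symmetric] distrib_left)
  then show False
    by (simp add: k_def)
qed

subsection \<open>Derivations of the ground field\<close>

definition is_deriv :: "('a::comm_ring_1 \<Rightarrow> 'a) \<Rightarrow> bool" where
  "is_deriv D \<longleftrightarrow> (\<forall>x y. D (x + y) = D x + D y) \<and> (\<forall>x y. D (x * y) = D x * y + x * D y)"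

lemma is_derivI:
  assumes "\<And>x y. D (x + y) = D x + D y" "\<And>x y. D (x * y) = D x * y + x * D y"
  shows "is_deriv D"
  using assms by (simp add: is_deriv_def)

lemma deriv_add: "is_deriv D \<Longrightarrow> D (x + y) = D x + D y"
  and deriv_mult: "is_deriv D \<Longrightarrow> D (x * y) = D x * y + x * D y"
  by (simp_all add: is_deriv_def)

lemma deriv_0: "is_deriv D \<Longrightarrow> D 0 = 0"
  using deriv_add[of D 0 0] by simp

lemma deriv_1: "is_deriv D \<Longrightarrow> D 1 = 0"
  using deriv_mult[of D 1 1] by simp

lemma deriv_sum: "is_deriv D \<Longrightarrow> D (\<Sum>i\<in>A. f i) = (\<Sum>i\<in>A. D (f i))"
  by (induction A rule: infinite_finite_induct) (simp_all add: deriv_0 deriv_add)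

lemma is_deriv_map_poly:
  assumes "is_deriv D"
  shows "is_deriv (map_poly D)"
  by (rule is_derivI; intro poly_eqI)
    (simp_all add: coeff_map_poly deriv_0[OF assms] deriv_add[OF assms] deriv_sum[OF assms]
      deriv_mult[OF assms] coeff_mult sum.distrib)

lemma is_deriv_pderiv: "is_deriv (pderiv :: 'a::idom poly \<Rightarrow> _)"
  by (rule is_derivI) (simp_all add: pderiv_add pderiv_mult mult.commute add.commute)

text \<open>Used with derivations and also with homomorphisms of the ground field, where it gives
  the conjugate curve.\<close>

definition dmap :: "('k::comm_ring_1 \<Rightarrow> 'k) \<Rightarrow> 'k poly poly \<Rightarrow> 'k poly poly" where
  "dmap D = map_poly (map_poly D)"

abbreviation "dX \<equiv> (pderiv :: 'k::idom poly poly \<Rightarrow> _)"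
abbreviation "dY \<equiv> (map_poly pderiv :: 'k::idom poly poly \<Rightarrow> _)"

lemma cf_dmap: "D 0 = 0 \<Longrightarrow> cf (dmap D f) i j = D (cf f i j)"
  by (simp add: dmap_def coeff_map_poly)

lemma is_deriv_dmap: "is_deriv D \<Longrightarrow> is_deriv (dmap D)"
  unfolding dmap_def by (intro is_deriv_map_poly)

lemma degree_dmap_le: "D 0 = 0 \<Longrightarrow> degree (dmap D f) \<le> degree f"
  by (rule degX_leI) (simp add: cf_dmap coeff_eq_0)

lemma degY_dmap_le: "D 0 = 0 \<Longrightarrow> degY (dmap D f) \<le> degY f"
  by (rule degY_leI) (simp add: cf_dmap cf_eq_0_outside[OF order_refl order_refl])

text \<open>The chain rule when coefficients and arguments vary at once; it is applied to
  differentiation in X, in Y and of the ground field.\<close>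

lemma deriv_ev2:
  fixes f :: "'k::idom poly poly"
  assumes \<delta>: "is_deriv \<delta>" and h: "rhom h" and D: "is_deriv D" "\<And>c. \<delta> (h c) = h (D c)"
  shows "\<delta> (ev2 h u v f) =
    ev2 h u v (dmap D f) + ev2 h u v (dX f) * \<delta> u + ev2 h u v (dY f) * \<delta> v"
proof -
  note E = rhom_ev2[OF h]
  have [simp]: "is_deriv (dmap D)" "is_deriv dX" "is_deriv dY"
    using D by (simp_all add: is_deriv_dmap is_deriv_map_poly is_deriv_pderiv)
  show ?thesis
  proof (induction f rule: bivariate_induct)
    case (cst c)
    have "dmap D (cst c) = cst (D c)" "dX (cst c) = 0" "dY (cst c) = 0"
      by (simp_all add: dmap_def map_poly_pCons deriv_0[OF D(1)] pderiv_pCons)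
    then show ?case
      by (simp add: h D rhom_0[OF E])
  next
    case X
    have "dmap D XX = 0" "dX XX = (cst 1 :: 'k poly poly)" "dY XX = (0 :: 'k poly poly)"
      by (simp_all add: dmap_def map_poly_pCons deriv_0[OF D(1)] deriv_1[OF D(1)] pderiv_pCons one_pCons)
    then show ?case
      by (simp only: ev2_generators[OF h] rhom_0[OF E] rhom_1[OF h]) simp
  next
    case Y
    have "dmap D YY = 0" "dX YY = (0 :: 'k poly poly)" "dY YY = (cst 1 :: 'k poly poly)"
      by (simp_all add: dmap_def map_poly_pCons deriv_0[OF D(1)] deriv_1[OF D(1)] pderiv_pCons one_pCons)
    then show ?case
      by (simp only: ev2_generators[OF h] rhom_0[OF E] rhom_1[OF h]) simp
  next
    case (add f g)
    then show ?case
      by (simp add: rhom_add[OF E] deriv_add \<delta> algebra_simps)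
  next
    case (mult f g)
    then show ?case
      by (simp add: rhom_add[OF E] rhom_mult[OF E] deriv_mult \<delta> algebra_simps)
  qed
qed

lemma dX_blow: "dX (blow x y f) = blow x y (dX f) + blow x y (dY f) * YY"
proof -
  have z: "is_deriv (\<lambda>_. 0 :: 'a)"
    by (simp add: is_deriv_def)
  have 1: "dmap (\<lambda>_. 0) f = 0"
    by (intro bivariate_eqI) (simp add: cf_dmap)
  show ?thesis
    unfolding blow_def
    by (subst deriv_ev2[OF is_deriv_pderiv rhom_cst z])
      (simp_all only: 1 rhom_0[OF rhom_ev2[OF rhom_cst]], simp_all add: pderiv_pCons)
qed

lemma dY_blow: "dY (blow x y f) = blow x y (dY f) * XX"
proof -
  have z: "is_deriv (\<lambda>_. 0 :: 'a)"
    by (simp add: is_deriv_def)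
  have 1: "dmap (\<lambda>_. 0) f = 0"
    by (intro bivariate_eqI) (simp add: cf_dmap)
  show ?thesis
    unfolding blow_def
    by (subst deriv_ev2[OF is_deriv_map_poly[OF is_deriv_pderiv] rhom_cst z])
      (simp_all only: 1 rhom_0[OF rhom_ev2[OF rhom_cst]], simp_all add: map_poly_pCons pderiv_pCons
        deriv_1[OF is_deriv_map_poly[OF is_deriv_pderiv]] flip: one_pCons)
qed

lemma dmap_blow:
  assumes "is_deriv D"
  shows "dmap D (blow x y f) =
    blow x y (dmap D f) + blow x y (dX f) * cst (D x) + blow x y (dY f) * cst (D y)"
  unfolding blow_def
  by (subst deriv_ev2[OF is_deriv_dmap[OF assms] rhom_cst assms])
    (simp_all add: dmap_def map_poly_pCons deriv_0[OF assms] deriv_1[OF assms]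
      deriv_1[OF is_deriv_map_poly[OF assms]])

text \<open>On the blow-up chart, the derivative in Y of the transformed equation carries an extra
  factor X, the exceptional curve; dividing by it costs one order.\<close>

lemma vanishes_dY: "vanishes x y c f \<Longrightarrow> vanishes x y (c - 1) (dY f)"
  unfolding vanishes_def monom_1_dvd_iff'
proof (intro allI impI)
  fix k assume *: "\<forall>k<c. coeff (blow x y f) k = 0" and "k < c - 1"
  then have "coeff (dY (blow x y f)) (Suc k) = 0"
    by (simp add: coeff_map_poly)
  then show "coeff (blow x y (dY f)) k = 0"
    by (simp add: dY_blow)
qed

lemma vanishes_dX: "vanishes x y c f \<Longrightarrow> vanishes x y (c - 1) (dX f)"
proof -
  assume *: "vanishes x y c f"
  have "blow x y (dX f) = dX (blow x y f) - blow x y (dY f) * YY"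
    by (simp add: dX_blow)
  moreover have "monom 1 (c - 1) dvd dX (blow x y f)"
    using * unfolding vanishes_def monom_1_dvd_iff' by (simp add: coeff_pderiv)
  moreover have "monom 1 (c - 1) dvd blow x y (dY f) * YY"
    using vanishes_dY[OF *] by (simp only: vanishes_def dvd_mult2)
  ultimately show ?thesis
    by (simp only: vanishes_def dvd_diff)
qed

lemma monom_dvd_dmap: "is_deriv D \<Longrightarrow> monom 1 c dvd f \<Longrightarrow> monom 1 c dvd dmap D f"
  by (simp add: monom_1_dvd_iff' dmap_def coeff_map_poly)

text \<open>The derivative of the coefficients differs from that of the blown-up equation by partial
  derivatives times the velocity of the point. These terms cost one order; for a fixed point they
  are absent, as in \<open>vanishes_dmap_const\<close>.\<close>

lemma vanishes_dmap:
  fixes f :: "'k::idom poly poly"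
  assumes "is_deriv D" "vanishes x y c f"
  shows "vanishes x y (c - 1) (dmap D f)"
proof -
  have "blow x y (dmap D f) = dmap D (blow x y f) - blow x y (dX f) * cst (D x) - blow x y (dY f) * cst (D y)"
    by (simp add: dmap_blow[OF assms(1)])
  moreover have "monom 1 (c - 1) dvd dmap D (blow x y f)"
    using vanishes_mono[OF assms(2), of "c - 1"] by (auto simp: vanishes_def intro: monom_dvd_dmap assms)
  ultimately show ?thesis
    using vanishes_dX[OF assms(2)] vanishes_dY[OF assms(2)]
    by (simp only: vanishes_def dvd_diff dvd_mult2)
qed

lemma vanishes_dmap_const:
  fixes f :: "'k::idom poly poly"
  assumes "is_deriv D" "vanishes x y c f" "D x = 0" "D y = 0"
  shows "vanishes x y c (dmap D f)"
  using monom_dvd_dmap[OF assms(1) assms(2)[unfolded vanishes_def]]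
  by (simp add: vanishes_def dmap_blow[OF assms(1)] assms(3,4))

text \<open>A curve with constant equation cannot pass through a moving point.\<close>

lemma rigid_curve_zero:
  fixes f :: "'k::field poly poly"
  assumes char_0: "\<And>n. n > 0 \<Longrightarrow> (of_nat n :: 'k) \<noteq> 0"
    and D: "is_deriv D" "D x = 1" "D y = 0" "dmap D f = 0"
    and E: "is_deriv E" "E x = 0" "E y = 1" "dmap E f = 0"
    and v: "vanishes x y 1 f"
  shows "f = 0"
proof (rule ccontr)
  assume f: "f \<noteq> 0"
  define c where "c = ord x y f"
  have c: "c > 0" "\<not> vanishes x y (Suc c) f"
    using v f by (auto simp: c_def vanishes_iff_ord)
  have d: "monom 1 c dvd blow x y f"
    using vanishes_ord[of x y f] by (simp add: vanishes_def c_def)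
  \<comment> \<open>Since the equation is constant, the velocity of the point passes to its partial
    derivatives, which therefore vanish to the full order \<open>c\<close> instead of
    \<open>c - 1\<close>. Characteristic zero makes this impossible.\<close>
  have "blow x y (dX f) = dmap D (blow x y f)" "blow x y (dY f) = dmap E (blow x y f)"
    using D E by (simp_all add: dmap_blow rhom_0[OF rhom_blow] flip: one_pCons)
  then have "monom 1 c dvd dX (blow x y f)"
    unfolding dX_blow using monom_dvd_dmap[OF D(1) d] monom_dvd_dmap[OF E(1) d]
    by (simp only: dvd_add dvd_mult2)
  then have "coeff (dX (blow x y f)) (c - 1) = 0"
    using c by (simp add: monom_1_dvd_iff')
  then have "of_nat c * coeff (blow x y f) c = 0"
    using c by (simp add: coeff_pderiv)
  moreover have "(of_nat c :: 'k poly) \<noteq> 0"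
    using char_0[OF c(1)] by (simp add: of_nat_poly)
  ultimately have "coeff (blow x y f) c = 0"
    by simp
  with d have "monom 1 (Suc c) dvd blow x y f"
    by (auto simp: monom_1_dvd_iff' less_Suc_eq)
  with c show False
    by (simp add: vanishes_def)
qed

lemma degY_cst [simp]: "degY (cst c) = 0"
  by (simp add: degY_def swp_def rhom_cst)

lemma dvd_same_bidegree:
  fixes f g :: "'k::field poly poly"
  assumes "f dvd g" "degree g \<le> degree f" "degY g \<le> degY f"
  obtains c where "g = cst c * f"
proof (cases "g = 0")
  case True
  then show ?thesis
    using that[of 0] by simp
next
  case False
  obtain e where e: "g = f * e"
    using assms by blast
  then have "f \<noteq> 0" "e \<noteq> 0"
    using False by auto
  then have "degree e = 0" "degY e = 0"
    using assms e degree_mult_eq[of f e] degY_mult[of f e] by auto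
  then show ?thesis
    using that[of "cf e 0 0"] bidegree_0_unit(1)[OF \<open>e \<noteq> 0\<close>] e by (metis mult.commute)
qed

text \<open>Moving the point \<open>i\<close> deforms the curve \<open>g\<close>, and the derivative of the deformation meets
  \<open>g\<close> properly.\<close>

lemma moving_point_inequality:
  fixes g :: "'k::field_gcd poly poly" and x y :: "'i \<Rightarrow> 'k"
  assumes char_0: "\<And>n. n > 0 \<Longrightarrow> (of_nat n :: 'k) \<noteq> 0"
    and g: "irreducible g" and L: "finite L" "inj_on x L" and i: "i \<in> L"
    and D: "is_deriv D" "\<And>l. l \<in> L \<Longrightarrow> D (x l) = of_bool (l = i)" "\<And>l. l \<in> L \<Longrightarrow> D (y l) = 0"
    and E: "is_deriv E" "\<And>l. l \<in> L \<Longrightarrow> E (x l) = 0" "\<And>l. l \<in> L \<Longrightarrow> E (y l) = of_bool (l = i)"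
    and b: "\<And>l. l \<in> L \<Longrightarrow> ord (x l) (y l) g \<le> degY g"
    and c: "ord (x i) (y i) g > 0"
  shows "(\<Sum>l\<in>L. ord (x l) (y l) g ^ 2) \<le> 2 * degree g * degY g + ord (x i) (y i) g"
proof -
  have "g \<noteq> 0"
    using g by auto
  then obtain m n where mn: "cf g m n \<noteq> 0"
    by (metis bivariate_eqI coeff_0)
  \<comment> \<open>With one coefficient normalised to 1, every derivation kills that coefficient. A
    derivative divisible by \<open>g\<close> has no larger bidegree, so it is a constant multiple of
    \<open>g'\<close>, and the constant is zero.\<close>
  define g' where "g' = cst (inverse (cf g m n)) * g"
  have "is_unit (cst (inverse (cf g m n)))"
    using mn by (simp add: is_unit_const_poly_iff dvd_field_iff)
  then have dvd: "g' dvd h \<longleftrightarrow> g dvd h" for h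
    unfolding g'_def using mult_unit_dvd_iff' by blast
  have g'0: "g' \<noteq> 0" and g'1: "cf g' m n = 1"
    using mn \<open>g \<noteq> 0\<close> by (auto simp: g'_def)
  have deg: "degree g' \<le> degree g" "degY g' \<le> degY g"
  proof -
    show "degree g' \<le> degree g"
      unfolding g'_def by (rule degX_leI) (simp add: coeff_eq_0)
    show "degY g' \<le> degY g"
      unfolding g'_def by (rule degY_leI) (simp add: cf_eq_0_outside[OF order_refl order_refl])
  qed
  have deg': "degree g' = degree g" "degY g' = degY g"
    unfolding g'_def using mn \<open>g \<noteq> 0\<close> by (simp, subst degY_mult) simp_all
  have v: "vanishes (x l) (y l) (ord (x l) (y l) g) g'" for l
    unfolding g'_def by (rule vanishes_mult_left[OF vanishes_ord])
  have rigid: "dmap F g' = 0" if F: "is_deriv F" "g dvd dmap F g'" for F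
  proof -
    note F0 = deriv_0[OF F(1)]
    have "degree (dmap F g') \<le> degree g'" "degY (dmap F g') \<le> degY g'"
      using degree_dmap_le[of F, OF F0] degY_dmap_le[of F, OF F0] by blast+
    then obtain d where d: "dmap F g' = cst d * g'"
      using dvd_same_bidegree[of g' "dmap F g'"] F(2) dvd by blast
    have "cf (dmap F g') m n = 0"
      using g'1 deriv_1[OF F(1)] by (simp add: cf_dmap F0)
    with g'1 have "d = 0"
      unfolding d cf_cst_mult by simp
    with d show ?thesis
      by simp
  qed
  \<comment> \<open>If both derivatives were multiples of \<open>g\<close>, they would be zero, and
    the rigid curve would pass through a moving point.\<close>
  obtain F where F: "is_deriv F" "\<not> g dvd dmap F g'"
    "\<And>l. l \<in> L \<Longrightarrow> l \<noteq> i \<Longrightarrow> F (x l) = 0 \<and> F (y l) = 0"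
  proof (cases "g dvd dmap D g' \<and> g dvd dmap E g'")
    case True
    then have "dmap D g' = 0" "dmap E g' = 0"
      using rigid D E by blast+
    then have "g' = 0"
      using D E i vanishes_mono[OF v, of 1 i] c
      by (intro rigid_curve_zero[OF char_0, of D "x i" "y i" g' E]) auto
    with g'0 show ?thesis
      by blast
  next
    case False
    then show ?thesis
      using that[of D] that[of E] D E by auto
  qed
  define c' where "c' l = (if l = i then ord (x l) (y l) g - 1 else ord (x l) (y l) g)" for l
  have "(\<Sum>l\<in>L. ord (x l) (y l) g * c' l) \<le> degree g * degY g + degree g * degY g"
  proof (rule bezout_inequality[OF g F(2) L])
    show "degree (dmap F g') \<le> degree g" "degY (dmap F g') \<le> degY g"
      using order_trans[OF degree_dmap_le[of F, OF deriv_0[OF F(1)]] deg(1)]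
        order_trans[OF degY_dmap_le[of F, OF deriv_0[OF F(1)]] deg(2)] .
    show "vanishes (x l) (y l) (ord (x l) (y l) g) g" for l
      by (rule vanishes_ord)
    show "c' l \<le> degY g" if "l \<in> L" for l
      using b[OF that] by (auto simp: c'_def)
    show "vanishes (x l) (y l) (c' l) (dmap F g')" if "l \<in> L" for l
      using vanishes_dmap[OF F(1) v, of l] vanishes_dmap_const[OF F(1) v, of l] F(3)[OF that]
      by (auto simp: c'_def)
  qed
  moreover have "(\<Sum>l\<in>L. ord (x l) (y l) g ^ 2) =
      (\<Sum>l\<in>L. ord (x l) (y l) g * c' l) + ord (x i) (y i) g"
  proof -
    have *: "n * n = n * (n - Suc 0) + n" if "n > 0" for n :: nat
      using that by (cases n) simp_all
    have "(\<Sum>l\<in>L. ord (x l) (y l) g ^ 2) =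
        (\<Sum>l\<in>L. ord (x l) (y l) g * c' l + (if l = i then ord (x l) (y l) g else 0))"
      using c by (intro sum.cong refl)
        (auto simp: c'_def power2_eq_square *)
    then show ?thesis
      using L i by (simp add: sum.distrib)
  qed
  ultimately show ?thesis
    by simp
qed

subsection \<open>Symmetries\<close>

lemma jet_swp: "jet x y p q (swp f) = jet y x q p f"
  by (subst (1 2) jet_altdef[OF order_refl order_refl], subst sum.swap)
    (simp add: degree_swp mult_ac)

lemma vanishes_swp: "vanishes x y c (swp f) \<longleftrightarrow> vanishes y x c f"
  by (auto simp: vanishes_iff_jets jet_swp add.commute)

lemma ord_swp: "ord x y (swp f) = ord y x f"
proof (cases "f = 0")
  case True
  then show ?thesis
    by (simp add: rhom_0[OF rhom_swp] ord_def rhom_0[OF rhom_blow])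
next
  case False
  then have "c \<le> ord x y (swp f) \<longleftrightarrow> c \<le> ord y x f" for c
    using vanishes_swp[of x y c f] by (simp add: vanishes_iff_ord)
  then show ?thesis
    by (meson eq_iff)
qed

lemma jet_dmap:
  assumes "rhom \<tau>"
  shows "jet (\<tau> x) (\<tau> y) p q (dmap \<tau> f) = \<tau> (jet x y p q f)"
  by (subst jet_altdef[OF degree_dmap_le degY_dmap_le], simp_all add: rhom_0[OF assms],
      subst jet_altdef[OF order_refl order_refl])
    (simp add: rhom_simps[OF assms] cf_dmap)

lemma vanishes_dmap_hom: "rhom \<tau> \<Longrightarrow> vanishes x y c f \<Longrightarrow> vanishes (\<tau> x) (\<tau> y) c (dmap \<tau> f)"
  by (simp add: vanishes_iff_jets jet_dmap rhom_0)

lemma rhom_field_eq_0_iff: "rhom \<tau> \<Longrightarrow> \<tau> (c :: 'k::field) = (0 :: 'l::field) \<longleftrightarrow> c = 0"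
  by (metis rhom_0 rhom_1 rhom_mult right_inverse mult_zero_left zero_neq_one)

lemma dmap_hom_eq_0_iff: "rhom \<tau> \<Longrightarrow> dmap \<tau> f = 0 \<longleftrightarrow> f = (0 :: 'k::field poly poly)"
  by (auto simp: poly_eq_iff dmap_def coeff_map_poly rhom_0 rhom_field_eq_0_iff)

subsection \<open>The generic configuration of nine points\<close>

lemma cauchy_schwarz_nat: "(\<Sum>i\<in>A. f i) ^ 2 \<le> card A * (\<Sum>i\<in>A. (f i :: nat) ^ 2)"
proof -
  have "(\<Sum>i\<in>A. real (f i)) ^ 2 \<le> (\<Sum>i\<in>A. real (f i) ^ 2) * card A"
    by (rule sum_squared_le_sum_of_squares)
  then have "real ((\<Sum>i\<in>A. f i) ^ 2) \<le> real (card A * (\<Sum>i\<in>A. (f i) ^ 2))"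
    by (simp add: mult.commute)
  then show ?thesis
    by (simp only: of_nat_le_iff)
qed

lemma four_mult_le_square: "4 * (a * b) \<le> (a + b :: nat) ^ 2"
proof -
  have "int (4 * (a * b)) \<le> int ((a + b) ^ 2)"
    using zero_le_power2[of "int a - int b"] by (simp add: power2_eq_square algebra_simps)
  then show ?thesis
    by (simp only: of_nat_le_iff)
qed

text \<open>Positive slope bounds \<open>a + b\<close> from above by the quotient by 81; the other
  side bounds \<open>(a + b) ^ 2\<close> from below. Its last term is a lower bound for the sum of
  the squares of eight natural numbers with sum \<open>r\<close>.\<close>

lemma small_classes:
  "\<forall>q\<in>{1,2,3,4,5,6,7,8,9,10,11}. \<forall>r\<in>{0,1,2,3,4,5,6,7,8,9,10,11,12,13}.
     (q, r) \<in> set [(1, 0), (5, 0), (5, 2), (7, 1)] \<or>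
     ((38 * (9 * q + r) - 1) div 81) ^ 2 < 2 * (9 * q ^ 2 + 2 * q * r - q + max r ((r ^ 2 + 7) div 8 :: nat))"
  by (simp add: max_def)

text \<open>At most eight multiplicities are positive. Summing the inequalities \<open>m\<close>
  over them, Cauchy-Schwarz gives \<open>s ^ 2 \<le> 16 * (a * b) + s\<close>. As
  \<open>(81 / 38) ^ 2 > 4\<close>, positive slope leaves only small \<open>s\<close>, which are
  checked.\<close>

lemma class_with_zero:
  fixes a b :: nat and c :: "nat \<Rightarrow> nat"
  assumes n: "81 * (a + b) < 38 * (\<Sum>l<9. c l)"
    and le: "\<And>l. l < 9 \<Longrightarrow> c l \<le> b"
    and m: "\<And>i. i < 9 \<Longrightarrow> c i > 0 \<Longrightarrow> (\<Sum>l<9. c l ^ 2) \<le> 2 * a * b + c i"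
    and z: "z < 9" "c z = 0"
  shows False
proof -
  define Z where "Z = {l\<in>{..<9}. c l > 0}"
  define s where "s = (\<Sum>l<9. c l)"
  define Q where "Q = (\<Sum>l<9. c l ^ 2)"
  have sZ: "s = (\<Sum>l\<in>Z. c l)" "Q = (\<Sum>l\<in>Z. c l ^ 2)"
    unfolding s_def Q_def Z_def by (intro sum.mono_neutral_right; force)+
  have "card Z \<le> card ({..<9} - {z})"
    by (intro card_mono) (use z in \<open>auto simp: Z_def\<close>)
  then have Z: "card Z \<le> 8"
    using z by simp
  have "card Z * Q = (\<Sum>l\<in>Z. Q)"
    by simp
  also have "\<dots> \<le> (\<Sum>l\<in>Z. 2 * a * b + c l)"
    by (intro sum_mono) (use m in \<open>auto simp: Z_def Q_def\<close>)
  also have "\<dots> = card Z * (2 * a * b) + s"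
    by (simp add: sum.distrib sZ(1))
  also have "\<dots> \<le> 8 * (2 * a * b) + s"
    using Z by (intro add_right_mono mult_le_mono1)
  finally have "card Z * Q \<le> 8 * (2 * a * b) + s" .
  then have "s ^ 2 \<le> 16 * (a * b) + s"
    using cauchy_schwarz_nat[of c Z] sZ by simp
  moreover have "4 * (a * b) \<le> (a + b) ^ 2"
    by (rule four_mult_le_square)
  ultimately have s2: "s ^ 2 \<le> 4 * (a + b) ^ 2 + s"
    by linarith
  have n': "81 * (a + b) < 38 * s"
    using n by (simp add: s_def)
  then have "(81 * (a + b)) ^ 2 \<le> (38 * s) ^ 2"
    by (intro power_mono) auto
  then have "6561 * (a + b) ^ 2 \<le> 1444 * s ^ 2"
    by (simp only: power_mult_distrib) simp
  with s2 have "785 * s ^ 2 \<le> 6561 * s"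
    by linarith
  then have s8: "s \<le> 8"
    by (cases "s = 0") (auto simp: power2_eq_square)
  with n' have "a + b \<in> {0, 1, 2, 3}"
    by auto
  moreover have "s = 0" if "a + b = 0"
    using that le by (auto simp: s_def)
  moreover have "s \<in> {0, 1, 2, 3, 4, 5, 6, 7, 8}"
    using s8 by auto
  ultimately show False
    using s2 n' by auto
qed

text \<open>Apart from the class \<open>(2, 2; 1, \<dots>, 1)\<close>, the inequality \<open>m\<close> leaves \<open>(10, 11; 5, \<dots>, 5)\<close>,
  \<open>(11, 11; 6, 6, 5, \<dots>, 5)\<close> and \<open>(15, 15; 8, 7, \<dots>, 7)\<close>, which the symmetries exclude.\<close>

lemma exceptional_class:
  fixes a b :: nat and c :: "nat \<Rightarrow> nat"
  assumes n: "81 * (a + b) < 38 * (\<Sum>l<9. c l)"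
    and le: "\<And>l. l < 9 \<Longrightarrow> c l \<le> b"
    and m: "\<And>i. i < 9 \<Longrightarrow> c i > 0 \<Longrightarrow> (\<Sum>l<9. c l ^ 2) \<le> 2 * a * b + c i"
    and t: "\<And>i j. i < 9 \<Longrightarrow> j < 9 \<Longrightarrow> c i < c j \<Longrightarrow>
      (\<Sum>l<9. c l ^ 2) \<le> 2 * a * b + (c j - c i) ^ 2"
    and w: "a \<noteq> b \<Longrightarrow> (\<Sum>l<9. c l ^ 2) \<le> a ^ 2 + b ^ 2"
  shows "a = 2 \<and> b = 2 \<and> (\<forall>l<9. c l = 1)"
proof -
  have pos: "c l > 0" if "l < 9" for l
    using class_with_zero[OF n le m] that by blast
  have "Min (c ` {..<9}) \<in> c ` {..<9}"
    by (intro Min_in) (auto simp: lessThan_empty_iff)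
  then obtain i where i: "i < 9" "\<And>l. l < 9 \<Longrightarrow> c i \<le> c l"
    by (auto dest: sym)
  \<comment> \<open>Each multiplicity is the minimum \<open>q\<close> plus an excess
    \<open>d\<close>. The excess is zero at \<open>i\<close>, so the total \<open>r\<close> is
    spread over eight indices only; the inequality \<open>m\<close> is sharpest at
    \<open>i\<close>.\<close>
  define q where "q = c i"
  define d where "d l = c l - q" for l
  define r where "r = (\<Sum>l<9. d l)"
  define S where "S = (\<Sum>l<9. d l ^ 2)"
  have c: "c l = q + d l" if "l < 9" for l
    using i(2)[OF that] by (simp add: d_def q_def)
  have sum: "(\<Sum>l<9. c l) = 9 * q + r"
  proof -
    have "(\<Sum>l<9. c l) = (\<Sum>l<9. q + d l)"
      by (intro sum.cong) (auto simp: c)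
    then show ?thesis
      by (simp only: sum.distrib r_def) simp
  qed
  have Q: "(\<Sum>l<9. c l ^ 2) = 9 * q ^ 2 + 2 * q * r + S"
  proof -
    have "(\<Sum>l<9. c l ^ 2) = (\<Sum>l<9. q ^ 2 + 2 * q * d l + d l ^ 2)"
      by (intro sum.cong) (auto simp: c power2_eq_square algebra_simps)
    then show ?thesis
      by (simp only: sum.distrib r_def S_def sum_distrib_left) simp
  qed
  have Sr: "r \<le> S"
    unfolding r_def S_def by (intro sum_mono) (simp add: power2_eq_square)
  have di: "d i = 0"
    by (simp add: d_def q_def)
  have "r = (\<Sum>l\<in>{..<9} - {i}. d l)" "S = (\<Sum>l\<in>{..<9} - {i}. d l ^ 2)"
    unfolding r_def S_def using i di by (auto simp: sum.remove[of "{..<9}" i])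
  then have rS: "r ^ 2 \<le> 8 * S"
    using cauchy_schwarz_nat[of d "{..<9} - {i}"] i by simp
  have q: "q > 0"
    using pos i by (simp add: q_def)
  have Xu: "9 * q ^ 2 + 2 * q * r + S \<le> 2 * a * b + q"
    using m[OF i(1)] q by (simp add: Q q_def)
  have ab: "4 * (a * b) \<le> (a + b) ^ 2"
    by (rule four_mult_le_square)
  have n': "81 * (a + b) < 38 * (9 * q + r)"
    using n by (simp add: sum)
  have key: "2 * (9 * q ^ 2 + 2 * q * r + S) \<le> (a + b) ^ 2 + 2 * q"
    using mult_le_mono2[OF Xu, of 2] ab by simp
  have bound: "q < 12 \<and> r < 14"
  proof -
    have "(81 * (a + b)) ^ 2 \<le> (38 * (9 * q + r)) ^ 2"
      using n' by (intro power_mono) auto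
    then have "6561 * (a + b) ^ 2 \<le> 1444 * (9 * q + r) ^ 2"
      by (simp only: power_mult_distrib) simp
    then have "6561 * (a + b) ^ 2 \<le> 116964 * q ^ 2 + 25992 * (q * r) + 1444 * r ^ 2"
      by (simp add: power2_eq_square algebra_simps)
    \<comment> \<open>What remains after \<open>6561 * key\<close>, the squared slope condition and
      \<open>S \<ge> r ^ 2 / 8\<close>; all three coefficients are positive because
      \<open>(81 / 38) ^ 2 > 9 / 2\<close>.\<close>
    with key rS have *: "1134 * q ^ 2 + 252 * (q * r) + 196 * r ^ 2 \<le> 13122 * q"
      by simp
    then have "1134 * q ^ 2 \<le> 13122 * q"
      by simp
    then have q12: "q < 12"
      using q by (simp add: power2_eq_square)
    moreover have "r < 14"
    proof (rule ccontr)
      assume "\<not> r < 14"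
      then have "14 * 14 \<le> r * r" "q * 14 \<le> q * r"
        by (intro mult_le_mono; simp)+
      with * have "1134 * (q * q) + 3528 * q + 38416 \<le> 13122 * q"
        unfolding power2_eq_square by linarith
      moreover have "q \<in> {1,2,3,4,5,6,7,8,9,10,11}"
        using q q12 unfolding insert_iff empty_iff by presburger
      ultimately show False
        by auto
    qed
    ultimately show ?thesis
      by simp
  qed
  have "a + b \<le> (38 * (9 * q + r) - 1) div 81"
    using n' by (subst less_eq_div_iff_mult_less_eq) auto
  then have sq: "(a + b) ^ 2 \<le> ((38 * (9 * q + r) - 1) div 81) ^ 2"
    by (rule power_mono) simp
  have "(r ^ 2 + 7) div 8 \<le> S"
    using rS by linarith
  then have "max r ((r ^ 2 + 7) div 8) \<le> S"
    using Sr by simp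
  moreover have *: "2 * (X - q + M) \<le> N" if "2 * (X + S) \<le> N + 2 * q" "M \<le> S" "q \<le> X" for X M N
    using that by arith
  have "q \<le> 9 * q ^ 2 + 2 * q * r"
    by (simp add: power2_eq_square trans_le_add1)
  ultimately have "2 * (9 * q ^ 2 + 2 * q * r - q + max r ((r ^ 2 + 7) div 8)) \<le> (a + b) ^ 2"
    using *[OF key] by blast
  moreover have "q \<in> {1,2,3,4,5,6,7,8,9,10,11}" "r \<in> {0,1,2,3,4,5,6,7,8,9,10,11,12,13}"
    using bound q unfolding insert_iff empty_iff by presburger+
  ultimately have "(q, r) \<in> set [(1, 0), (5, 0), (5, 2), (7, 1)]"
    using small_classes sq by (meson less_le_trans less_irrefl)
  have tj: "9 * q ^ 2 + 2 * q * r + S \<le> 2 * a * b + d j ^ 2" if "j < 9" "d j > 0" for j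
  proof -
    have "c i < c j"
      using that by (simp add: d_def q_def)
    from t[OF i(1) that(1) this] show ?thesis
      unfolding Q by (simp only: d_def q_def)
  qed
  have ex: "\<exists>j<9. d j > 0" if "r > 0"
    using that sum.neutral[of "{..<9}" d] unfolding r_def by (metis gr0I lessThan_iff less_irrefl)
  from \<open>(q, r) \<in> _\<close> consider "q = 1" "r = 0" | "q = 5" "r = 0" | "q = 5" "r = 2" | "q = 7" "r = 1"
    by auto
  then show ?thesis
  proof cases
    case 1
    with n' key have "a + b < 5" "16 \<le> (a + b) ^ 2"
      by simp_all
    then have "a + b \<in> {0, 1, 2, 3, 4}"
      by auto
    with \<open>16 \<le> (a + b) ^ 2\<close> have n4: "a + b = 4"
      by auto
    then have "a \<in> {0, 1, 2, 3, 4}" "b = 4 - a"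
      by auto
    moreover have "4 \<le> a * b"
      using Xu 1 by simp
    ultimately have "a = 2" "b = 2"
      by auto
    moreover have "d l = 0" if "l < 9" for l
      using 1 that by (simp add: r_def)
    ultimately show ?thesis
      using c 1 by simp
  next
    case 2
    with n' key have "a + b < 22" "440 \<le> (a + b) ^ 2"
      by simp_all
    then have "a + b = 21"
      using power_mono[of "a + b" 20 2] by force
    \<comment> \<open>An odd \<open>a + b\<close> forces \<open>a \<noteq> b\<close>. The inequality
      \<open>w\<close> added to \<open>Xu\<close> gives
      \<open>450 + 2 * S \<le> 441 + 5\<close>.\<close>
    then have "a \<noteq> b" "(a + b) ^ 2 = 441"
      by (presburger, simp)
    with w Q 2 Xu show ?thesis
      by (simp add: power2_eq_square algebra_simps)
  next
    case 3
    obtain j where j: "j < 9" "d j > 0"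
      using ex 3 by auto
    have "a + b \<le> 22"
      using n' 3 by simp
    then have "(a + b) ^ 2 \<le> 484"
      using power_mono[of "a + b" 22 2] by simp
    then have "S \<le> 2" "2 * a * b \<le> 242"
      using key ab 3 by simp_all
    moreover have "d j ^ 2 \<le> S"
      unfolding S_def using j by (intro member_le_sum) auto
    ultimately have "d j ^ 2 \<le> 2"
      by simp
    \<comment> \<open>Exchanging two points replaces the error term \<open>q = 5\<close> by
      \<open>d j ^ 2\<close>, which is at most 2 and too small.\<close>
    moreover have "9 * q ^ 2 + 2 * q * r + S \<le> 2 * a * b + d j ^ 2"
      using tj[OF j] .
    ultimately have "245 + S \<le> 244"
      using 3 \<open>2 * a * b \<le> 242\<close> by simp
    then show ?thesis
      by simp
  next
    case 4
    obtain j where j: "j < 9" "d j > 0"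
      using ex 4 by auto
    have "a + b \<le> 30"
      using n' 4 by simp
    then have "(a + b) ^ 2 \<le> 900"
      using power_mono[of "a + b" 30 2] by simp
    then have "S \<le> 2" "2 * a * b \<le> 450"
      using key ab 4 by simp_all
    moreover have "d j ^ 2 \<le> S"
      unfolding S_def using j by (intro member_le_sum) auto
    ultimately have "d j ^ 2 \<le> 2"
      by simp
    moreover have "9 * q ^ 2 + 2 * q * r + S \<le> 2 * a * b + d j ^ 2"
      \<comment> \<open>Again the error term \<open>q = 7\<close> shrinks to at most 2.\<close>
      using tj[OF j] .
    ultimately have "455 + S \<le> 452"
      using 4 \<open>2 * a * b \<le> 450\<close> by simp
    then show ?thesis
      by simp
  qed
qed

text \<open>Genericity is only used through derivations \<open>Dx i\<close>, \<open>Dy i\<close>, which move the point \<open>i\<close> and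
  fix the others, and automorphisms \<open>\<tau> i j\<close>, \<open>\<sigma>\<close>, which exchange two points or the two factors.\<close>

lemma ord_X_minus: "ord x y [:[:- a:], 1:] = of_bool (x = (a :: 'k::field))"
proof (cases "x = a")
  case True
  then show ?thesis
    using order_0_monom[of "1 :: 'k poly" 1] by (simp add: ord_def blow_X_minus monom_altdef)
next
  case False
  then show ?thesis
    by (auto simp: ord_def blow_X_minus intro!: order_0I)
qed

locale generic_points =
  fixes x y :: "nat \<Rightarrow> 'k::field_gcd" and Dx Dy :: "nat \<Rightarrow> 'k \<Rightarrow> 'k"
    and \<tau> :: "nat \<Rightarrow> nat \<Rightarrow> 'k \<Rightarrow> 'k" and \<sigma> :: "'k \<Rightarrow> 'k"
  assumes char_0: "\<And>n. n > 0 \<Longrightarrow> (of_nat n :: 'k) \<noteq> 0"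
    and Dx: "\<And>i. is_deriv (Dx i)" "\<And>i l. Dx i (x l) = of_bool (l = i)" "\<And>i l. Dx i (y l) = 0"
    and Dy: "\<And>i. is_deriv (Dy i)" "\<And>i l. Dy i (x l) = 0" "\<And>i l. Dy i (y l) = of_bool (l = i)"
    and \<tau>: "\<And>i j. rhom (\<tau> i j)" "\<And>i j l. \<tau> i j (x l) = x (Transposition.transpose i j l)"
      "\<And>i j l. \<tau> i j (y l) = y (Transposition.transpose i j l)"
    and \<sigma>: "rhom \<sigma>" "\<And>l. \<sigma> (x l) = y l" "\<And>l. \<sigma> (y l) = x l"
begin

lemma inj_x: "inj x" and inj_y: "inj y"
proof -
  show "inj x"
    by (rule injI) (metis Dx(2) of_bool_eq_iff)
  show "inj y"
    by (rule injI) (metis Dy(3) of_bool_eq_iff)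
qed

abbreviation mult :: "'k poly poly \<Rightarrow> nat \<Rightarrow> nat" where
  "mult f l \<equiv> ord (x l) (y l) f"

text \<open>The slope of the class \<open>(d, d; m, \<dots>, m)\<close> is \<open>18 (19 m - 9 d)\<close>. A class of positive
  slope has negative self-intersection, because \<open>(81 / 38)\<^sup>2 > 9 / 2\<close>.\<close>

definition slope :: "'k poly poly \<Rightarrow> int" where
  "slope f = 38 * int (\<Sum>l<9. mult f l) - 81 * int (degree f + degY f)"

lemma slope_mult: "f \<noteq> 0 \<Longrightarrow> g \<noteq> 0 \<Longrightarrow> slope (f * g) = slope f + slope g"
  by (simp add: slope_def ord_mult sum.distrib degree_mult_eq degY_mult algebra_simps)

text \<open>A ruling has slope at most 38 - 81, so it cannot divide a curve of positive slope and
  minimal degree; this makes \<open>ord_le_degY\<close> applicable.\<close>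

lemma slope_line:
  assumes "\<And>l. mult k l = of_bool (l = i)" "degree k + degY k = 1"
  shows "slope k < 0"
proof -
  have "(\<Sum>l<9. mult k l) \<le> 1"
    by (simp only: assms(1)) (simp add: of_bool_def)
  then have "int (\<Sum>l<9. mult k l) \<le> 1"
    by (simp only: of_nat_le_1_iff)
  with assms(2) show ?thesis
    unfolding slope_def by simp
qed

lemma slope_X_minus: "slope [:[:- x i:], 1:] < 0"
  by (rule slope_line[of _ i]) (simp_all add: ord_X_minus inj_eq[OF inj_x])

lemma slope_Y_minus: "slope (swp [:[:- y i:], 1:]) < 0"
  by (rule slope_line[of _ i]) (simp_all add: ord_swp ord_X_minus inj_eq[OF inj_y] degree_swp)

text \<open>Nine coefficients against nine points, added one at a time. If the next coefficient is
  nonzero, it is normalised to 1; derivatives with respect to the new point lose it and are zero by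
  induction. So the equation does not depend on the new point and cannot vanish there.\<close>

lemma no_conic_type_curve:
  assumes "degree f \<le> 2" "degY f \<le> 2" "\<And>l. l < 9 \<Longrightarrow> vanishes (x l) (y l) 1 f"
  shows "f = 0"
proof -
  have "f = 0" if "n \<le> 9" "degree f \<le> 2" "degY f \<le> 2" "\<And>l. l < n \<Longrightarrow> vanishes (x l) (y l) 1 f"
    "\<And>k. k < 9 - n \<Longrightarrow> cf f (k div 3) (k mod 3) = 0" for n f
    using that
  proof (induction n arbitrary: f)
    case 0
    have "cf f i j = 0" for i j
    proof (cases "i \<le> 2 \<and> j \<le> 2")
      case True
      then have "3 * i + j < 9" "(3 * i + j) div 3 = i" "(3 * i + j) mod 3 = j"
        by auto
      then show ?thesis
        using 0(5)[of "3 * i + j"] by simp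
    next
      case False
      then show ?thesis
        using 0(2,3) by (intro cf_eq_0_outside[of f 2 2]) auto
    qed
    then show ?case
      by (intro bivariate_eqI) simp
  next
    case (Suc n)
    \<comment> \<open>Coefficients are numbered by \<open>3 * i + j\<close>; number
      \<open>8 - n\<close> is the one released when the point \<open>n\<close> is added.\<close>
    define i j where "i = (8 - n) div 3" and "j = (8 - n) mod 3"
    show ?case
    proof (cases "cf f i j = 0")
      case True
      have "cf f (k div 3) (k mod 3) = 0" if "k < 9 - n" for k
      proof (cases "k = 8 - n")
        case True
        then show ?thesis
          using \<open>cf f i j = 0\<close> by (simp add: i_def j_def)
      next
        case False
        then show ?thesis
          using that by (intro Suc.prems(5)) auto
      qed
      then show ?thesis
        using Suc.prems by (intro Suc.IH) auto
    next
      case False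
      define g where "g = cst (inverse (cf f i j)) * f"
      have g: "degree g \<le> 2" "degY g \<le> 2"
        using Suc.prems(2,3) unfolding g_def
        by (auto intro!: degX_leI degY_leI cf_eq_0_outside[of f 2 2])
      have v: "vanishes (x l) (y l) 1 g" if "l < Suc n" for l
        unfolding g_def using that Suc.prems(4) by (intro vanishes_mult_left) auto
      have const: "dmap D g = 0" if D: "is_deriv D" "\<And>l. l < n \<Longrightarrow> D (x l) = 0" "\<And>l. l < n \<Longrightarrow> D (y l) = 0" for D
      proof (rule Suc.IH)
        note D0 = deriv_0[OF D(1)]
        show "degree (dmap D g) \<le> 2" "degY (dmap D g) \<le> 2"
          using degree_dmap_le[of D, OF D0] degY_dmap_le[of D, OF D0] g by (meson order_trans)+
        show "vanishes (x l) (y l) 1 (dmap D g)" if "l < n" for l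
          using that D v by (intro vanishes_dmap_const) auto
        show "cf (dmap D g) (k div 3) (k mod 3) = 0" if "k < 9 - n" for k
        proof (cases "k = 8 - n")
          case True
          then have "cf g (k div 3) (k mod 3) = 1"
            using False by (simp add: g_def i_def j_def)
          then show ?thesis
            by (simp add: cf_dmap D0 deriv_1[OF D(1)])
        next
          case False
          then have "cf f (k div 3) (k mod 3) = 0"
            using that by (intro Suc.prems(5)) auto
          then show ?thesis
            by (simp add: cf_dmap D0 g_def)
        qed
      qed (use Suc.prems in auto)
      have "g = 0"
        using v[of n] const[of "Dx n"] const[of "Dy n"] Dx Dy
        by (intro rigid_curve_zero[OF char_0, of "Dx n" "x n" "y n" g "Dy n"]) auto
      with False show ?thesis
        by (simp add: g_def)
    qed
  qed
  from this[of 9 f] show ?thesis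
    using assms by simp
qed

theorem no_curve:
  assumes dm: "9 * d < 19 * m"
    and f: "degree f \<le> d" "degY f \<le> d" "\<And>l. l < 9 \<Longrightarrow> vanishes (x l) (y l) m f"
  shows "f = 0"
proof (rule ccontr)
  assume "f \<noteq> 0"
  define P where "P h \<longleftrightarrow> h \<noteq> 0 \<and> slope h > 0" for h
  have "(\<Sum>l<9::nat. m) \<le> (\<Sum>l<9. mult f l)"
    using f(3) \<open>f \<noteq> 0\<close> by (intro sum_mono) (simp add: vanishes_iff_ord)
  then have "81 * (degree f + degY f) < 38 * (\<Sum>l<9. mult f l)"
    using f(1,2) dm by simp
  then have "P f"
    using \<open>f \<noteq> 0\<close> unfolding P_def slope_def by linarith
  \<comment> \<open>In any factorisation some factor has positive slope, and minimality of the total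
    degree then leaves only a unit for the other factor.\<close>
  then obtain g where g: "P g" "\<And>h. P h \<Longrightarrow> degree g + degY g \<le> degree h + degY h"
    using ex_has_least_nat[of P f "\<lambda>h. degree h + degY h"] by blast
  have g0: "g \<noteq> 0" and sg: "slope g > 0"
    using g(1) by (auto simp: P_def)
  have unit: "is_unit v" if "g = u * v" "slope u > 0" for u v
  proof -
    have uv: "u \<noteq> 0" "v \<noteq> 0"
      using that g0 by auto
    with that have "degree g + degY g \<le> degree u + degY u"
      by (intro g(2)) (simp add: P_def)
    with that uv show ?thesis
      by (intro bidegree_0_unit) (simp_all add: degree_mult_eq degY_mult)
  qed
  have irr: "irreducible g"
  proof (rule irreducibleI)
    show "\<not> is_unit g"
    proof
      assume "is_unit g"
      then obtain u where "1 = g * u"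
        by blast
      then have "degree g = 0" "degY g = 0"
        using degree_mult_eq[of g u] degY_mult[of g u] degY_cst[of 1] one_pCons
        by (metis add_is_0 degree_1 mult_zero_left mult_zero_right zero_neq_one)+
      then have "g = cst (cf g 0 0)" "cf g 0 0 \<noteq> 0"
        using bidegree_0_unit g0 by blast+
      then have "mult g l = 0" for l
        by (metis ord_cst)
      with sg \<open>degree g = 0\<close> \<open>degY g = 0\<close> show False
        by (simp add: slope_def)
    qed
    show "is_unit u \<or> is_unit v" if "g = u * v" for u v
    proof -
      have "slope u > 0 \<or> slope v > 0"
        using that sg g0 slope_mult[of u v] by force
      then show ?thesis
        using unit[of u v] unit[of v u] that by (auto simp: mult.commute)
    qed
  qed (rule g0)
  have no_factor: "\<not> k dvd g" if "slope k < 0" "\<not> is_unit k" for k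
  proof
    assume "k dvd g"
    then obtain v where v: "g = v * k"
      by (metis dvdE mult.commute)
    then have "slope v > 0"
      using that(1) sg g0 slope_mult[of v k] by force
    with unit[OF v] that(2) show False
      by blast
  qed
  have nu: "\<not> is_unit [:[:- c:], 1:]" for c :: 'k
    by (simp add: is_unit_poly_iff)
  then have nu': "\<not> is_unit (swp [:[:- c:], 1:])" for c :: 'k
    using rhom_dvd[OF rhom_swp, of "swp [:[:- c:], 1:]" 1] by (auto simp only: rhom_1[OF rhom_swp] swp_swp)
  have le_b: "mult g l \<le> degY g" for l
    using no_factor[OF slope_X_minus nu] g0 by (intro ord_le_degY)
  \<comment> \<open>The bound from the other ruling serves the curve with exchanged factors, whose
    degree in Y is at most \<open>degree g\<close>.\<close>
  have le_a: "mult g l \<le> degree g" for l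
  proof -
    have "\<not> [:[:- y l:], 1:] dvd swp g"
      using no_factor[OF slope_Y_minus nu'] rhom_dvd[OF rhom_swp, of "[:[:- y l:], 1:]" "swp g"]
      by (auto simp only: swp_swp)
    then have "ord (y l) (x l) (swp g) \<le> degY (swp g)"
      using g0 by (intro ord_le_degY) auto
    then show ?thesis
      by (simp add: ord_swp)
  qed
  have inj: "inj_on x {..<9}"
    using inj_x by (rule inj_on_subset) simp
  define S where "S = (\<Sum>l<9. mult g l ^ 2)"
  have mov: "S \<le> 2 * degree g * degY g + mult g i" if "i < 9" "mult g i > 0" for i
    unfolding S_def using that le_b Dx Dy
    by (intro moving_point_inequality[OF char_0 irr _ inj, of i "Dx i" y "Dy i"]) auto
  have tra: "S \<le> 2 * degree g * degY g + (mult g j - mult g i) ^ 2"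
    if ij: "i < 9" "j < 9" "mult g i < mult g j" for i j
  proof -
    \<comment> \<open>The conjugate curve has the multiplicities at \<open>i\<close> and
      \<open>j\<close> exchanged. If \<open>g\<close> divided it, the two would be proportional,
      although their multiplicities at \<open>i\<close> differ.\<close>
    define h where "h = dmap (\<tau> i j) g"
    note \<tau>0 = rhom_0[OF \<tau>(1)]
    have deg: "degree h \<le> degree g" "degY h \<le> degY g"
      unfolding h_def by (simp_all add: degree_dmap_le degY_dmap_le \<tau>0)
    have vh: "vanishes (x l) (y l) (mult g (Transposition.transpose i j l)) h" for l
      using vanishes_dmap_hom[OF \<tau>(1) vanishes_ord, of i j "x (Transposition.transpose i j l)" "y (Transposition.transpose i j l)" g]
      by (simp add: \<tau> h_def)
    have "h \<noteq> 0"
      using g0 by (simp add: h_def dmap_hom_eq_0_iff \<tau>)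
    have "\<not> g dvd h"
    proof
      assume "g dvd h"
      then obtain c where c: "h = cst c * g"
        using dvd_same_bidegree deg by blast
      with \<open>h \<noteq> 0\<close> have "c \<noteq> 0"
        by auto
      then have "mult h i = mult g i"
        using c g0 ord_mult[of "cst c" g "x i" "y i"] by simp
      moreover have "mult g j \<le> mult h i"
        using vh[of i] \<open>h \<noteq> 0\<close> by (simp add: vanishes_iff_ord)
      ultimately show False
        using ij by simp
    qed
    then have "(\<Sum>l<9. mult g l * mult g (Transposition.transpose i j l)) \<le> degree g * degY g + degree g * degY g"
      using le_b by (intro bezout_inequality[OF irr _ _ inj deg vanishes_ord vh]) auto
    moreover have "S = (\<Sum>l<9. mult g l * mult g (Transposition.transpose i j l)) + (mult g j - mult g i) ^ 2"
    proof -
      let ?c = "mult g"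
      have T: "{..<9} = insert i (insert j ({..<9} - {i, j}))" "i \<noteq> j"
        using ij by auto
      have "(\<Sum>l\<in>{..<9} - {i, j}. ?c l ^ 2) = (\<Sum>l\<in>{..<9} - {i, j}. ?c l * ?c (Transposition.transpose i j l))"
        by (intro sum.cong) (auto simp: Transposition.transpose_def power2_eq_square)
      moreover have "?c i ^ 2 + ?c j ^ 2 = ?c i * ?c j + ?c j * ?c i + (?c j - ?c i) ^ 2"
        using ij(3) le_Suc_ex[of "?c i" "?c j"] by (auto simp: power2_eq_square algebra_simps)
      ultimately show ?thesis
        unfolding S_def using T(2) by (subst (1 2) T(1)) simp
    qed
    ultimately show ?thesis
      by simp
  qed
  have swa: "S \<le> degree g ^ 2 + degY g ^ 2" if "degree g \<noteq> degY g"
  proof -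
    \<comment> \<open>\<open>\<sigma>\<close> exchanges the coordinates of each point and
      \<open>swp\<close> exchanges them back: the multiplicities stay, the bidegree is reversed, and
      unequal degrees exclude divisibility.\<close>
    define h where "h = swp (dmap \<sigma> g)"
    note \<sigma>0 = rhom_0[OF \<sigma>(1)]
    have deg: "degree h \<le> degY g" "degY h \<le> degree g"
      unfolding h_def by (simp_all add: degree_swp degree_dmap_le degY_dmap_le \<sigma>0)
    have vh: "vanishes (x l) (y l) (mult g l) h" for l
      using vanishes_dmap_hom[OF \<sigma>(1) vanishes_ord, of "x l" "y l" g]
      by (simp add: \<sigma> h_def vanishes_swp)
    have "h \<noteq> 0"
      using g0 by (simp add: h_def dmap_hom_eq_0_iff \<sigma>)
    have "\<not> g dvd h"
    proof
      assume "g dvd h"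
      then obtain k where "h = g * k"
        by blast
      with \<open>h \<noteq> 0\<close> g0 have "degree g \<le> degree h" "degY g \<le> degY h"
        by (auto simp: degree_mult_eq degY_mult)
      with deg that show False
        by simp
    qed
    then have "(\<Sum>l<9. mult g l * mult g l) \<le> degree g * degree g + degY g * degY g"
      using le_a by (intro bezout_inequality[OF irr _ _ inj deg vanishes_ord vh]) auto
    then show ?thesis
      by (simp add: S_def power2_eq_square)
  qed
  have "degree g = 2 \<and> degY g = 2 \<and> (\<forall>l<9. mult g l = 1)"
  proof (rule exceptional_class)
    show "81 * (degree g + degY g) < 38 * (\<Sum>l<9. mult g l)"
      using sg unfolding slope_def by linarith
  qed (use le_b mov tra swa in \<open>auto simp: S_def\<close>)
  then have "g = 0"
    using vanishes_ord[of _ _ g] by (intro no_conic_type_curve) (auto, metis One_nat_def)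
  with g0 show False ..
qed

end

subsection \<open>Polynomial functions\<close>

text \<open>Functions instead of formal polynomials make evaluation, differentiation and renaming of
  variables immediate; \<open>homogenisation\<close> leads back to formal polynomials.\<close>

inductive polyfun :: "(('v \<Rightarrow> complex) \<Rightarrow> complex) \<Rightarrow> bool" where
  const: "polyfun (\<lambda>_. c)"
| var: "polyfun (\<lambda>a. a v)"
| add: "polyfun f \<Longrightarrow> polyfun g \<Longrightarrow> polyfun (\<lambda>a. f a + g a)"
| mult: "polyfun f \<Longrightarrow> polyfun g \<Longrightarrow> polyfun (\<lambda>a. f a * g a)"

lemma polyfun_uminus: "polyfun f \<Longrightarrow> polyfun (\<lambda>a. - f a)"
  using polyfun.mult[OF polyfun.const[of "-1"], of f] by simp

lemma polyfun_diff: "polyfun f \<Longrightarrow> polyfun g \<Longrightarrow> polyfun (\<lambda>a. f a - g a)"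
  using polyfun.add[OF _ polyfun_uminus, of f g] by simp

lemma polyfun_sum: "(\<And>i. i \<in> I \<Longrightarrow> polyfun (f i)) \<Longrightarrow> polyfun (\<lambda>a. \<Sum>i\<in>I. f i a)"
  by (induction I rule: infinite_finite_induct) (auto intro: polyfun.intros)

lemma polyfun_power: "polyfun f \<Longrightarrow> polyfun (\<lambda>a. f a ^ n)"
  by (induction n) (auto intro: polyfun.intros)

lemma polyfun_compose:
  assumes "polyfun f" "\<And>v. polyfun (\<lambda>a. g a v)"
  shows "polyfun (\<lambda>a. f (g a))"
  using assms(1) by induction (auto intro: polyfun.intros assms(2))

lemma polyfun_line:
  assumes "polyfun f"
  shows "\<exists>p. \<forall>t. f (\<lambda>v. a v + t * b v) = poly p t"
  using assms
proof induction
  case (const c)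
  show ?case
    by (rule exI[of _ "[:c:]"]) simp
next
  case (var v)
  show ?case
    by (rule exI[of _ "[:a v, b v:]"]) simp
next
  case (add f g)
  then obtain p q where "\<forall>t. f (\<lambda>v. a v + t * b v) = poly p t" "\<forall>t. g (\<lambda>v. a v + t * b v) = poly q t"
    by blast
  then show ?case
    by (intro exI[of _ "p + q"]) simp
next
  case (mult f g)
  then obtain p q where "\<forall>t. f (\<lambda>v. a v + t * b v) = poly p t" "\<forall>t. g (\<lambda>v. a v + t * b v) = poly q t"
    by blast
  then show ?case
    by (intro exI[of _ "p * q"]) simp
qed

text \<open>On the line joining \<open>a\<close> and \<open>b\<close>, both functions become nonzero
  polynomials in one variable.\<close>

lemma polyfun_no_zero_divisors:
  assumes "polyfun f" "polyfun g" "f a \<noteq> 0" "g b \<noteq> 0"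
  shows "\<exists>c. f c * g c \<noteq> 0"
proof -
  obtain p where p: "\<And>t. f (\<lambda>v. a v + t * (b v - a v)) = poly p t"
    using polyfun_line[OF assms(1)] by metis
  obtain q where q: "\<And>t. g (\<lambda>v. a v + t * (b v - a v)) = poly q t"
    using polyfun_line[OF assms(2)] by metis
  have "p \<noteq> 0" "q \<noteq> 0"
    using p[of 0] q[of 1] assms(3,4) by auto
  then have "p * q \<noteq> 0"
    by simp
  then obtain t where "poly (p * q) t \<noteq> 0"
    using poly_all_0_iff_0 by blast
  then show ?thesis
    using p[of t] q[of t] by (intro exI[of _ "\<lambda>v. a v + t * (b v - a v)"]) simp
qed

section \<open>Partial derivatives of polynomial functions\<close>

definition pd :: "'v \<Rightarrow> (('v \<Rightarrow> complex) \<Rightarrow> complex) \<Rightarrow> ('v \<Rightarrow> complex) \<Rightarrow> complex" where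
  "pd v f a = deriv (\<lambda>z. f (a(v := z))) (a v)"

lemma pd_eqI: "((\<lambda>z. f (a(v := z))) has_field_derivative D) (at (a v)) \<Longrightarrow> pd v f a = D"
  unfolding pd_def by (rule DERIV_imp_deriv)

lemma polyfun_differentiable:
  assumes "polyfun f"
  shows "\<exists>f'. polyfun f' \<and> (\<forall>a. ((\<lambda>z. f (a(v := z))) has_field_derivative f' a) (at (a v)))"
  using assms
proof induction
  case (const c)
  show ?case
    by (intro exI[of _ "\<lambda>_. 0"]) (auto intro: polyfun.intros)
next
  case (var w)
  show ?case
    by (intro exI[of _ "\<lambda>_. of_bool (v = w)"]) (auto intro: polyfun.intros)
next
  case (add f g)
  then obtain f' g' where
    *: "polyfun f'" "\<And>a. ((\<lambda>z. f (a(v := z))) has_field_derivative f' a) (at (a v))"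
    "polyfun g'" "\<And>a. ((\<lambda>z. g (a(v := z))) has_field_derivative g' a) (at (a v))"
    by blast
  then show ?case
    by (intro exI[of _ "\<lambda>a. f' a + g' a"] conjI allI polyfun.add DERIV_add *)
next
  case (mult f g)
  then obtain f' g' where
    *: "polyfun f'" "\<And>a. ((\<lambda>z. f (a(v := z))) has_field_derivative f' a) (at (a v))"
    "polyfun g'" "\<And>a. ((\<lambda>z. g (a(v := z))) has_field_derivative g' a) (at (a v))"
    by blast
  have "((\<lambda>z. f (a(v := z)) * g (a(v := z))) has_field_derivative f' a * g a + g' a * f a) (at (a v))" for a
    using DERIV_mult[OF *(2)[of a] *(4)[of a]] by simp
  then show ?case
    by (intro exI[of _ "\<lambda>a. f' a * g a + g' a * f a"] conjI allI polyfun.add polyfun.mult * mult.hyps)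
qed

lemma polyfun_has_pd:
  assumes "polyfun f"
  shows "((\<lambda>z. f (a(v := z))) has_field_derivative pd v f a) (at (a v))"
  using polyfun_differentiable[OF assms, of v] pd_eqI by metis

lemma polyfun_pd: "polyfun f \<Longrightarrow> polyfun (pd v f)"
proof -
  assume "polyfun f"
  from polyfun_differentiable[OF this, of v]
  obtain f' where "polyfun f'" "\<And>a. ((\<lambda>z. f (a(v := z))) has_field_derivative f' a) (at (a v))"
    by blast
  then have "pd v f = f'"
    by (intro ext pd_eqI)
  with \<open>polyfun f'\<close> show ?thesis
    by simp
qed

lemma pd_const [simp]: "pd v (\<lambda>_. c) = (\<lambda>_. 0)"
  by (rule ext, rule pd_eqI) simp

lemma pd_var: "pd v (\<lambda>a. a w) = (\<lambda>_. of_bool (v = w))"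
  by (rule ext, rule pd_eqI) auto

lemma pd_add: "polyfun f \<Longrightarrow> polyfun g \<Longrightarrow> pd v (\<lambda>a. f a + g a) = (\<lambda>a. pd v f a + pd v g a)"
  by (rule ext, rule pd_eqI) (intro DERIV_add polyfun_has_pd)

lemma pd_mult:
  assumes "polyfun f" "polyfun g"
  shows "pd v (\<lambda>a. f a * g a) = (\<lambda>a. pd v f a * g a + f a * pd v g a)"
proof (rule ext, rule pd_eqI)
  fix a
  show "((\<lambda>z. f (a(v := z)) * g (a(v := z))) has_field_derivative pd v f a * g a + f a * pd v g a) (at (a v))"
    using DERIV_mult[OF polyfun_has_pd[OF assms(1), where v = v and a = a]
        polyfun_has_pd[OF assms(2), where v = v and a = a]]
    by (simp add: mult.commute)
qed

section \<open>The integral domain of polynomial functions\<close>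

typedef 'v pf = "{f :: ('v \<Rightarrow> complex) \<Rightarrow> complex. polyfun f}"
  by (auto intro: polyfun.intros)

setup_lifting type_definition_pf

instantiation pf :: (type) idom
begin

lift_definition zero_pf :: "'a pf" is "\<lambda>_. 0" by (rule polyfun.intros)
lift_definition one_pf :: "'a pf" is "\<lambda>_. 1" by (rule polyfun.intros)
lift_definition plus_pf :: "'a pf \<Rightarrow> 'a pf \<Rightarrow> 'a pf" is "\<lambda>f g a. f a + g a" by (rule polyfun.intros)
lift_definition times_pf :: "'a pf \<Rightarrow> 'a pf \<Rightarrow> 'a pf" is "\<lambda>f g a. f a * g a" by (rule polyfun.intros)
lift_definition uminus_pf :: "'a pf \<Rightarrow> 'a pf" is "\<lambda>f a. - f a" by (rule polyfun_uminus)
lift_definition minus_pf :: "'a pf \<Rightarrow> 'a pf \<Rightarrow> 'a pf" is "\<lambda>f g a. f a - g a" by (rule polyfun_diff)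

instance
proof
  fix f g :: "'a pf"
  assume "f \<noteq> 0" "g \<noteq> 0"
  then show "f * g \<noteq> 0"
    by transfer (use polyfun_no_zero_divisors in \<open>simp add: fun_eq_iff, blast\<close>)
qed (transfer; simp add: fun_eq_iff algebra_simps)+

end

lift_definition pvar :: "'v \<Rightarrow> 'v pf" is "\<lambda>v a. a v" by (rule polyfun.intros)
lift_definition pdiff :: "'v \<Rightarrow> 'v pf \<Rightarrow> 'v pf" is pd by (rule polyfun_pd)
lift_definition prename :: "('v \<Rightarrow> 'v) \<Rightarrow> 'v pf \<Rightarrow> 'v pf" is "\<lambda>\<pi> f a. f (\<lambda>v. a (\<pi> v))"
  by (rule polyfun_compose) (auto intro: polyfun.intros)
lift_definition pval :: "('v \<Rightarrow> complex) \<Rightarrow> 'v pf \<Rightarrow> complex" is "\<lambda>a f. f a" .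

lemma rhom_pval: "rhom (pval a)"
  unfolding rhom_def by (transfer; simp)+

lemma pval_nonzero: "f \<noteq> 0 \<Longrightarrow> \<exists>a. pval a f \<noteq> 0"
  by transfer auto

lemma is_deriv_pdiff: "is_deriv (pdiff v)"
  unfolding is_deriv_def by (transfer; simp add: pd_add pd_mult)+

lemma pdiff_pvar: "pdiff v (pvar w) = of_bool (v = w)"
  unfolding of_bool_def by transfer (auto simp: pd_var)

lemma rhom_prename: "rhom (prename \<pi>)"
  unfolding rhom_def by (transfer; simp)+

lemma prename_pvar: "prename \<pi> (pvar v) = pvar (\<pi> v)"
  by transfer simp

lemma prename_eq_0_iff: "bij \<pi> \<Longrightarrow> prename \<pi> f = 0 \<longleftrightarrow> f = 0"
proof (transfer, rule iffI)
  fix \<pi> :: "'a \<Rightarrow> 'a" and f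
  assume \<pi>: "bij \<pi>" and f: "(\<lambda>a. f (\<lambda>v. a (\<pi> v))) = (\<lambda>_. 0)"
  show "f = (\<lambda>_. 0)"
  proof
    fix a
    show "f a = 0"
      using fun_cong[OF f, of "\<lambda>v. a (inv \<pi> v)"] \<pi> by (simp add: bij_is_inj)
  qed
qed auto

subsection \<open>Extension to fraction fields\<close>

lemma rhom_to_fract: "rhom to_fract"
  by (simp add: rhom_def)

lemma fract_extend_rhom:
  fixes h :: "'a::idom \<Rightarrow> 'k::field"
  assumes "rhom h" "\<And>a. h a = 0 \<Longrightarrow> a = 0"
  shows "\<exists>H. rhom H \<and> (\<forall>a. H (to_fract a) = h a)"
proof -
  note [simp] = rhom_simps[OF assms(1)]
  have h0: "h b \<noteq> 0" if "b \<noteq> 0" for b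
    using assms(2) that by blast
  obtain num den where nd: "\<And>z. z = Fract (num z) (den z) \<and> den z \<noteq> (0 :: 'a)"
    by (metis Fract_cases)
  define H where "H z = h (num z) / h (den z)" for z
  have H: "H (Fract a b) = h a / h b" if "b \<noteq> 0" for a b
  proof -
    have "Fract (num (Fract a b)) (den (Fract a b)) = Fract a b"
      using nd by metis
    then have "num (Fract a b) * b = a * den (Fract a b)"
      using nd that by (subst (asm) eq_fract) auto
    then have "h (num (Fract a b)) * h b = h a * h (den (Fract a b))"
      by (metis rhom_mult[OF assms(1)])
    then show ?thesis
      using h0 nd that by (simp add: H_def frac_eq_eq)
  qed
  have "rhom H"
  proof (rule rhomI)
    show "H 1 = 1"
      unfolding One_fract_def by (simp add: H)
    fix z w :: "'a fract"
    obtain a b c d where zw: "z = Fract a b" "b \<noteq> 0" "w = Fract c d" "d \<noteq> 0"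
      by (metis Fract_cases)
    show "H (z + w) = H z + H w" "H (z * w) = H z * H w"
      using zw h0 by (simp_all add: H add_frac_eq)
  qed
  moreover have "H (to_fract a) = h a" for a
    by (simp add: to_fract_def H)
  ultimately show ?thesis
    by blast
qed

lemma fract_extend_deriv:
  fixes D :: "'a::idom \<Rightarrow> 'a"
  assumes "is_deriv D"
  shows "\<exists>E. is_deriv E \<and> (\<forall>a. E (to_fract a) = to_fract (D a))"
proof -
  note [simp] = deriv_add[OF assms] deriv_mult[OF assms]
  obtain num den where nd: "\<And>z. z = Fract (num z) (den z) \<and> den z \<noteq> (0 :: 'a)"
    by (metis Fract_cases)
  define E where "E z = Fract (D (num z) * den z - num z * D (den z)) (den z * den z)" for z
  have E: "E (Fract a b) = Fract (D a * b - a * D b) (b * b)" if b: "b \<noteq> 0" for a b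
  proof -
    define p q where "p = num (Fract a b)" and "q = den (Fract a b)"
    have q: "q \<noteq> 0" "Fract p q = Fract a b"
      using nd unfolding p_def q_def by metis+
    then have pq: "p * b = a * q"
      using b by (subst (asm) eq_fract) auto
    then have "D p * b + p * D b = D a * q + a * D q"
      using deriv_mult[OF assms] by metis
    with pq have "(D p * q - p * D q) * (b * b) = (D a * b - a * D b) * (q * q)"
      by algebra
    then show ?thesis
      using q b by (simp add: E_def eq_fract flip: p_def q_def)
  qed
  have "is_deriv E"
  proof (rule is_derivI)
    fix z w :: "'a fract"
    obtain a b c d where zw: "z = Fract a b" "b \<noteq> 0" "w = Fract c d" "d \<noteq> 0"
      by (metis Fract_cases)
    show "E (z + w) = E z + E w" "E (z * w) = E z * w + z * E w"
      using zw by (simp_all add: E eq_fract algebra_simps)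
  qed
  moreover have "E (to_fract a) = to_fract (D a)" for a
    using deriv_1[OF assms] by (simp add: to_fract_def E)
  ultimately show ?thesis
    by blast
qed

text \<open>With independent variables as coordinates, partial derivatives move one point at a time,
  and renaming of variables exchanges points or factors.\<close>

lemma generic_points_exist:
  "\<exists>Dx Dy \<tau> \<sigma>. generic_points (\<lambda>l. to_fract (pvar (l, False))) (\<lambda>l. to_fract (pvar (l :: nat, True))) Dx Dy \<tau> \<sigma>"
proof -
  obtain E :: "nat \<times> bool \<Rightarrow> (nat \<times> bool) pf fract \<Rightarrow> (nat \<times> bool) pf fract" where E: "\<And>v. is_deriv (E v)"
    "\<And>v a. E v (to_fract a) = to_fract (pdiff v a)"
    using fract_extend_deriv[OF is_deriv_pdiff] by metis
  have ren: "\<exists>H. rhom H \<and> (\<forall>a. H (to_fract a) = to_fract (prename \<pi> a))" if "bij \<pi>"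
    for \<pi> :: "nat \<times> bool \<Rightarrow> nat \<times> bool"
    using that by (intro fract_extend_rhom rhom_comp[OF rhom_to_fract rhom_prename])
      (simp add: prename_eq_0_iff)
  define R where "R \<pi> = (SOME H. rhom H \<and> (\<forall>a. H (to_fract a) = to_fract (prename \<pi> a)))"
    for \<pi> :: "nat \<times> bool \<Rightarrow> nat \<times> bool"
  have R: "rhom (R \<pi>)" "\<And>a. R \<pi> (to_fract a) = to_fract (prename \<pi> a)" if "bij \<pi>" for \<pi>
    using someI_ex[OF ren[OF that]] unfolding R_def by blast+
  define \<tau> where "\<tau> i j = R (\<lambda>(l, s). (Transposition.transpose i j l, s))" for i j
  define \<sigma> where "\<sigma> = R (\<lambda>(l, s). (l, \<not> s))"
  have bij: "bij (\<lambda>(l, s :: bool). (Transposition.transpose i j l, s))" for i j :: nat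
    by (rule o_bij[of "\<lambda>(l, s). (Transposition.transpose i j l, s)"]) auto
  have bij': "bij (\<lambda>(l :: nat, s). (l, \<not> s))"
    by (rule o_bij[of "\<lambda>(l, s). (l, \<not> s)"]) auto
  have "(of_nat n :: (nat \<times> bool) pf fract) \<noteq> 0" if "n > 0" for n
  proof -
    have "pval (\<lambda>_. 0) (of_nat n :: (nat \<times> bool) pf) \<noteq> 0"
      using that by (simp add: rhom_of_nat[OF rhom_pval])
    then have "(of_nat n :: (nat \<times> bool) pf) \<noteq> 0"
      by (metis rhom_0[OF rhom_pval])
    then have "to_fract (of_nat n :: (nat \<times> bool) pf) \<noteq> 0"
      by simp
    then show ?thesis
      by (simp add: rhom_of_nat[OF rhom_to_fract])
  qed
  then have "generic_points (\<lambda>l. to_fract (pvar (l, False))) (\<lambda>l. to_fract (pvar (l :: nat, True)))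
      (\<lambda>l. E (l, False)) (\<lambda>l. E (l, True)) \<tau> \<sigma>"
    by unfold_locales (auto simp: E \<tau>_def \<sigma>_def R[OF bij] R[OF bij'] pdiff_pvar prename_pvar)
  then show ?thesis
    by blast
qed

text \<open>The matrix of the conditions that \<open>(x l, y l)\<close> is a point of multiplicity at least \<open>m\<close> of the
  curve with coefficients \<open>c (i, j)\<close>.\<close>

definition jet_matrix ::
  "(nat \<Rightarrow> 'r::comm_ring_1) \<Rightarrow> (nat \<Rightarrow> 'r) \<Rightarrow> nat \<times> nat \<times> nat \<Rightarrow> nat \<times> nat \<Rightarrow> 'r" where
  "jet_matrix x y = (\<lambda>(l, p, q) (i, j). (of_nat (i choose p) * x l ^ (i - p)) * (of_nat (j choose q) * y l ^ (j - q)))"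

definition jet_rows :: "nat \<Rightarrow> (nat \<times> nat \<times> nat) set" where
  "jet_rows m = {..<9} \<times> tri m"

lemma rhom_jet_matrix: "rhom h \<Longrightarrow> h (jet_matrix x y e u) = jet_matrix (\<lambda>l. h (x l)) (\<lambda>l. h (y l)) e u"
  by (auto simp: jet_matrix_def rhom_simps split: prod.splits)

lemma (in generic_points) jet_matrix_trivial_kernel:
  assumes "9 * d < 19 * m"
  shows "trivial_kernel (jet_rows m) ({..d} \<times> {..d}) (jet_matrix x y)"
  unfolding trivial_kernel_def
proof (intro allI impI)
  fix c assume c: "\<forall>e\<in>jet_rows m. (\<Sum>u\<in>{..d} \<times> {..d}. jet_matrix x y e u * c u) = 0"
  define f where "f = (\<Sum>i\<le>d. \<Sum>j\<le>d. cst (c (i, j)) * mon i j)"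
  have cf: "cf f i j = (if i \<le> d \<and> j \<le> d then c (i, j) else 0)" for i j
  proof -
    have "cf f i j = (\<Sum>i'\<le>d. \<Sum>j'\<le>d. if j' = j then if i' = i then c (i', j') else 0 else 0)"
      unfolding f_def coeff_sum cf_cst_mult by (intro sum.cong refl) (auto simp: cf_mon)
    then show ?thesis
      by (cases "j \<le> d") simp_all
  qed
  have deg: "degree f \<le> d" "degY f \<le> d"
    by (rule degX_leI, simp add: cf) (rule degY_leI, simp add: cf)
  have "vanishes (x l) (y l) m f" if "l < 9" for l
    unfolding vanishes_iff_jets
  proof (intro allI impI)
    fix p q assume "p + q < m"
    then have "(l, p, q) \<in> jet_rows m"
      using that by (simp add: jet_rows_def tri_def)
    then have "(\<Sum>(i, j)\<in>{..d} \<times> {..d}. jet_matrix x y (l, p, q) (i, j) * c (i, j)) = 0"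
      using c by (auto simp: split_beta)
    moreover have "jet (x l) (y l) p q f =
        (\<Sum>(i, j)\<in>{..d} \<times> {..d}. jet_matrix x y (l, p, q) (i, j) * c (i, j))"
      unfolding jet_altdef[OF deg] sum.cartesian_product
      by (intro sum.cong refl) (auto simp: jet_matrix_def cf mult_ac)
    ultimately show "jet (x l) (y l) p q f = 0"
      by simp
  qed
  then have "f = 0"
    using no_curve[OF assms deg] by blast
  then have "c (i, j) = 0" if "i \<le> d" "j \<le> d" for i j
    using cf[of i j] that by simp
  then show "\<forall>u\<in>{..d} \<times> {..d}. c u = 0"
    by auto
qed

text \<open>Both conditions are open and hold for independent variables, so one complex
  configuration satisfies both. The second is the case \<open>9 * 2 < 19 * 1\<close>: no curve of
  bidegree \<open>(2, 2)\<close> passes through the points, hence no second quadric.\<close>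

theorem special_points:
  assumes "9 * d < 19 * m"
  shows "\<exists>x y :: nat \<Rightarrow> complex.
    trivial_kernel (jet_rows m) ({..d} \<times> {..d}) (jet_matrix x y) \<and>
    trivial_kernel (jet_rows 1) ({..2} \<times> {..2}) (jet_matrix x y)"
proof -
  let ?x = "\<lambda>l. pvar (l :: nat, False)" and ?y = "\<lambda>l. pvar (l :: nat, True)"
  obtain Dx Dy \<tau> \<sigma> where "generic_points (\<lambda>l. to_fract (?x l)) (\<lambda>l. to_fract (?y l)) Dx Dy \<tau> \<sigma>"
    using generic_points_exist by blast
  then interpret generic_points "\<lambda>l. to_fract (?x l)" "\<lambda>l. to_fract (?y l)" Dx Dy \<tau> \<sigma> .
  have "\<exists>h. to_fract h \<noteq> 0 \<and> (\<forall>\<psi> :: (nat \<times> bool) pf \<Rightarrow> complex. rhom \<psi> \<longrightarrow> \<psi> h \<noteq> 0 \<longrightarrow>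
      trivial_kernel (jet_rows m) ({..d} \<times> {..d}) (\<lambda>e u. \<psi> (jet_matrix ?x ?y e u)))"
    if "9 * d < 19 * m" for d m
    using jet_matrix_trivial_kernel[OF that]
    by (intro trivial_kernel_generic rhom_to_fract) (simp_all add: rhom_jet_matrix[OF rhom_to_fract])
  note * = this[OF assms] this[of 2 1, simplified]
  obtain h where h: "h \<noteq> 0"
    "\<And>a. pval a h \<noteq> 0 \<Longrightarrow> trivial_kernel (jet_rows m) ({..d} \<times> {..d}) (\<lambda>e u. pval a (jet_matrix ?x ?y e u))"
    using *(1) rhom_pval by (metis to_fract_0)
  obtain h' where h': "h' \<noteq> 0"
    "\<And>a. pval a h' \<noteq> 0 \<Longrightarrow> trivial_kernel (jet_rows (Suc 0)) ({..2} \<times> {..2}) (\<lambda>e u. pval a (jet_matrix ?x ?y e u))"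
    using *(2) rhom_pval by (metis to_fract_0)
  then obtain a where "pval a (h * h') \<noteq> 0"
    using pval_nonzero[of "h * h'"] h by auto
  then have "pval a h \<noteq> 0" "pval a h' \<noteq> 0"
    by (auto simp: rhom_mult[OF rhom_pval])
  then show ?thesis
    using h(2) h'(2) by (intro exI[of _ "\<lambda>l. pval a (?x l)"] exI[of _ "\<lambda>l. pval a (?y l)"])
      (simp add: rhom_jet_matrix[OF rhom_pval])
qed

subsection \<open>Monomials in four homogeneous coordinates\<close>

definition Mon :: "nat \<Rightarrow> (4 \<Rightarrow>\<^sub>0 nat) set" where
  "Mon d = {e. mdegree e = d}"

abbreviation lk :: "('a \<Rightarrow>\<^sub>0 'b::zero) \<Rightarrow> 'a \<Rightarrow> 'b" where
  "lk \<equiv> Poly_Mapping.lookup"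

definition mk_exp :: "nat \<Rightarrow> nat \<Rightarrow> nat \<Rightarrow> nat \<Rightarrow> 4 \<Rightarrow>\<^sub>0 nat" where
  "mk_exp p q r s = Poly_Mapping.single 1 p + Poly_Mapping.single 2 q + Poly_Mapping.single 3 r +
     Poly_Mapping.single 4 s"

lemma distinct_4: "(1 :: 4) \<noteq> 2" "(1 :: 4) \<noteq> 3" "(1 :: 4) \<noteq> 4" "(2 :: 4) \<noteq> 3" "(2 :: 4) \<noteq> 4" "(3 :: 4) \<noteq> 4"
  by simp_all

lemma lk_mk_exp [simp]:
  "lk (mk_exp p q r s) 1 = p" "lk (mk_exp p q r s) 2 = q"
  "lk (mk_exp p q r s) 3 = r" "lk (mk_exp p q r s) 4 = s"
  by (simp_all add: mk_exp_def lookup_add lookup_single when_def)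

lemma exp_eqI:
  fixes e f :: "4 \<Rightarrow>\<^sub>0 nat"
  assumes "lk e 1 = lk f 1" "lk e 2 = lk f 2" "lk e 3 = lk f 3" "lk e 4 = lk f 4"
  shows "e = f"
proof (rule poly_mapping_eqI)
  fix j :: 4
  show "lk e j = lk f j"
    using assms exhaust_4[of j] by auto
qed

lemma mk_exp_lk: "mk_exp (lk e 1) (lk e 2) (lk e 3) (lk e 4) = e"
  by (rule exp_eqI) simp_all

lemma mdegree_altdef: "mdegree e = (\<Sum>j\<in>UNIV. lk e j)" for e :: "'v::finite \<Rightarrow>\<^sub>0 nat"
  unfolding mdegree_def by (rule sum.mono_neutral_left) (auto simp: in_keys_iff)

lemma mdegree_4: "mdegree e = lk e 1 + lk e 2 + lk e 3 + lk e (4 :: 4)"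
  by (simp add: mdegree_altdef sum_4)

lemma finite_Mon [simp]: "finite (Mon d)"
proof (rule finite_surj)
  show "finite (({..d} \<times> {..d}) \<times> {..d} \<times> {..d})"
    by simp
  show "Mon d \<subseteq> (\<lambda>((p, q), r, s). mk_exp p q r s) ` (({..d} \<times> {..d}) \<times> {..d} \<times> {..d})"
  proof
    fix e assume "e \<in> Mon d"
    then show "e \<in> (\<lambda>((p, q), r, s). mk_exp p q r s) ` (({..d} \<times> {..d}) \<times> {..d} \<times> {..d})"
      by (intro image_eqI[of _ _ "((lk e 1, lk e 2), lk e 3, lk e 4)"])
        (auto simp: Mon_def mdegree_4 mk_exp_lk)
  qed
qed

text \<open>Normal forms modulo a quadric with leading monomial \<open>X3 * X4\<close>.\<close>

definition Nor :: "nat \<Rightarrow> (4 \<Rightarrow>\<^sub>0 nat) set" where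
  "Nor d = {e \<in> Mon d. lk e 3 = 0 \<or> lk e 4 = 0}"

text \<open>The exponents of \<open>s\<close> and \<open>t\<close> after restriction to
  \<open>(s, t, s * t, 1)\<close>.\<close>

definition biexp :: "(4 \<Rightarrow>\<^sub>0 nat) \<Rightarrow> nat \<times> nat" where
  "biexp e = (lk e 1 + lk e 3, lk e 2 + lk e 3)"

text \<open>So normal forms restrict to distinct monomials on the quadric. In the inverse, the third
  variable occurs only if \<open>i + j > d\<close>, when the fourth is exhausted.\<close>

lemma bij_biexp: "bij_betw biexp (Nor d) ({..d} \<times> {..d})"
proof (rule bij_betwI)
  let ?g = "\<lambda>(i, j). if i + j \<le> d then mk_exp i j 0 (d - i - j) else mk_exp (d - j) (d - i) (i + j - d) 0"
  show "biexp \<in> Nor d \<rightarrow> {..d} \<times> {..d}"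
    by (auto simp: biexp_def Nor_def Mon_def mdegree_4)
  show "?g \<in> {..d} \<times> {..d} \<rightarrow> Nor d"
    by (auto simp: Nor_def Mon_def mdegree_4 split: if_splits)
  show "?g (biexp e) = e" if "e \<in> Nor d" for e
    using that by (intro exp_eqI) (auto simp: biexp_def Nor_def Mon_def mdegree_4)
  show "biexp (?g u) = u" if "u \<in> {..d} \<times> {..d}" for u
    using that by (auto simp: biexp_def)
qed

definition e34 :: "4 \<Rightarrow>\<^sub>0 nat" where
  "e34 = mk_exp 0 0 1 1"

definition e12 :: "4 \<Rightarrow>\<^sub>0 nat" where
  "e12 = mk_exp 1 1 0 0"

lemma Mon_2: "Mon 2 = insert e34 (Nor 2)" "e34 \<notin> Nor 2"
proof -
  have "e = e34" if "e \<in> Mon 2" "lk e 3 \<noteq> 0" "lk e 4 \<noteq> 0" for e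
    using that by (intro exp_eqI) (auto simp: e34_def Mon_def mdegree_4)
  moreover have "e34 \<in> Mon 2"
    by (simp add: e34_def Mon_def mdegree_4)
  ultimately show "Mon 2 = insert e34 (Nor 2)"
    by (auto simp: Nor_def)
  show "e34 \<notin> Nor 2"
    by (simp add: e34_def Nor_def)
qed

lemma bij_add_e34: "bij_betw (\<lambda>g. g + e34) (Mon d) (Mon (d + 2) - Nor (d + 2))"
proof (rule bij_betwI)
  let ?h = "\<lambda>e. mk_exp (lk e 1) (lk e 2) (lk e 3 - 1) (lk e 4 - 1)"
  show "(\<lambda>g. g + e34) \<in> Mon d \<rightarrow> Mon (d + 2) - Nor (d + 2)"
    by (auto simp: Mon_def Nor_def mdegree_4 e34_def lookup_add)
  show "?h \<in> Mon (d + 2) - Nor (d + 2) \<rightarrow> Mon d"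
    by (auto simp: Mon_def Nor_def mdegree_4)
  show "?h (g + e34) = g" for g
    by (rule exp_eqI) (simp_all add: lookup_add e34_def)
  show "?h e + e34 = e" if "e \<in> Mon (d + 2) - Nor (d + 2)" for e
    using that by (intro exp_eqI) (auto simp: lookup_add e34_def Mon_def Nor_def)
qed

lemma Mon_add: "f \<in> Mon c \<Longrightarrow> g \<in> Mon d \<Longrightarrow> f + g \<in> Mon (c + d)"
  by (simp add: Mon_def mdegree_4 lookup_add)

subsection \<open>Vector fields along a quadric\<close>

text \<open>An assignment gives the points of a configuration by the variables \<open>(l, j)\<close> with \<open>l > 0\<close> and
  a running point by the variables \<open>(0, j)\<close>; the fourth coordinate is normalised to \<open>1\<close>.\<close>

type_synonym cfun = "(nat \<times> 4 \<Rightarrow> complex) \<Rightarrow> complex"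

definition amono :: "(4 \<Rightarrow>\<^sub>0 nat) \<Rightarrow> (4 \<Rightarrow> complex) \<Rightarrow> complex" where
  "amono e z = z 1 ^ lk e 1 * z 2 ^ lk e 2 * z 3 ^ lk e 3"

definition run :: "(4 \<Rightarrow>\<^sub>0 nat) \<Rightarrow> cfun" where
  "run e a = amono e (\<lambda>j. a (0, j))"

definition at_point :: "nat \<Rightarrow> (nat \<times> 4 \<Rightarrow> complex) \<Rightarrow> nat \<times> 4 \<Rightarrow> complex" where
  "at_point l a = (\<lambda>(i, j). if i = 0 then a (l, j) else a (i, j))"

lemma polyfun_run: "polyfun (run e)"
  unfolding run_def[abs_def] amono_def by (intro polyfun.intros polyfun_power)

lemma polyfun_at_point: "polyfun f \<Longrightarrow> polyfun (\<lambda>a. f (at_point l a))"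
proof (rule polyfun_compose[of f "at_point l"])
  show "polyfun (\<lambda>a. at_point l a v)" for v
    by (cases v; cases "fst v = 0") (simp_all add: at_point_def polyfun.var)
qed

text \<open>This field annihilates \<open>Q\<close>, so it is tangent to the level sets of
  \<open>Q\<close> and commutes with multiplication by \<open>Q\<close>. Iterated values on the
  quadric are therefore blind to multiples of \<open>Q\<close>.\<close>

definition delta :: "cfun \<Rightarrow> 4 \<Rightarrow> cfun \<Rightarrow> cfun" where
  "delta Q j \<Phi> a = pd (0, 3) Q a * pd (0, j) \<Phi> a - pd (0, j) Q a * pd (0, 3) \<Phi> a"

definition word :: "cfun \<Rightarrow> nat \<Rightarrow> nat \<Rightarrow> cfun \<Rightarrow> cfun" where
  "word Q p q \<Phi> = (delta Q 1 ^^ p) ((delta Q 2 ^^ q) \<Phi>)"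

lemma polyfun_delta: "polyfun Q \<Longrightarrow> polyfun \<Phi> \<Longrightarrow> polyfun (delta Q j \<Phi>)"
  unfolding delta_def[abs_def] by (intro polyfun_diff polyfun.mult polyfun_pd)

lemma polyfun_delta_pow: "polyfun Q \<Longrightarrow> polyfun \<Phi> \<Longrightarrow> polyfun ((delta Q j ^^ n) \<Phi>)"
  by (induction n) (simp_all add: polyfun_delta)

lemma polyfun_word: "polyfun Q \<Longrightarrow> polyfun \<Phi> \<Longrightarrow> polyfun (word Q p q \<Phi>)"
  unfolding word_def by (intro polyfun_delta_pow)

lemma delta_add:
  "polyfun \<Phi> \<Longrightarrow> polyfun \<Psi> \<Longrightarrow> delta Q j (\<lambda>a. \<Phi> a + \<Psi> a) = (\<lambda>a. delta Q j \<Phi> a + delta Q j \<Psi> a)"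
  by (rule ext) (simp add: delta_def pd_add algebra_simps)

lemma delta_cmult: "polyfun \<Phi> \<Longrightarrow> delta Q j (\<lambda>a. c * \<Phi> a) = (\<lambda>a. c * delta Q j \<Phi> a)"
  by (rule ext) (simp add: delta_def pd_mult[OF polyfun.const] algebra_simps)

lemma delta_Q_mult:
  "polyfun Q \<Longrightarrow> polyfun \<Phi> \<Longrightarrow> delta Q j (\<lambda>a. Q a * \<Phi> a) = (\<lambda>a. Q a * delta Q j \<Phi> a)"
  by (rule ext) (simp add: delta_def pd_mult algebra_simps)

lemma word_linear:
  assumes Q: "polyfun Q"
  shows "polyfun \<Phi> \<Longrightarrow> polyfun \<Psi> \<Longrightarrow>
      word Q p q (\<lambda>a. \<Phi> a + \<Psi> a) = (\<lambda>a. word Q p q \<Phi> a + word Q p q \<Psi> a)"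
    and "polyfun \<Phi> \<Longrightarrow> word Q p q (\<lambda>a. c * \<Phi> a) = (\<lambda>a. c * word Q p q \<Phi> a)"
    and "polyfun \<Phi> \<Longrightarrow> word Q p q (\<lambda>a. Q a * \<Phi> a) = (\<lambda>a. Q a * word Q p q \<Phi> a)"
proof -
  have 1: "(delta Q j ^^ n) (\<lambda>a. \<Phi> a + \<Psi> a) = (\<lambda>a. (delta Q j ^^ n) \<Phi> a + (delta Q j ^^ n) \<Psi> a)"
    if "polyfun \<Phi>" "polyfun \<Psi>" for \<Phi> \<Psi> j n
    using that by (induction n) (simp_all add: delta_add polyfun_delta_pow Q)
  have 2: "(delta Q j ^^ n) (\<lambda>a. c * \<Phi> a) = (\<lambda>a. c * (delta Q j ^^ n) \<Phi> a)"
    if "polyfun \<Phi>" for \<Phi> c j n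
    using that by (induction n) (simp_all add: delta_cmult polyfun_delta_pow Q)
  have 3: "(delta Q j ^^ n) (\<lambda>a. Q a * \<Phi> a) = (\<lambda>a. Q a * (delta Q j ^^ n) \<Phi> a)"
    if "polyfun \<Phi>" for \<Phi> j n
    using that by (induction n) (simp_all add: delta_Q_mult polyfun_delta_pow Q)
  show "polyfun \<Phi> \<Longrightarrow> polyfun \<Psi> \<Longrightarrow>
      word Q p q (\<lambda>a. \<Phi> a + \<Psi> a) = (\<lambda>a. word Q p q \<Phi> a + word Q p q \<Psi> a)"
    "polyfun \<Phi> \<Longrightarrow> word Q p q (\<lambda>a. c * \<Phi> a) = (\<lambda>a. c * word Q p q \<Phi> a)"
    "polyfun \<Phi> \<Longrightarrow> word Q p q (\<lambda>a. Q a * \<Phi> a) = (\<lambda>a. Q a * word Q p q \<Phi> a)"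
    by (simp_all add: word_def 1 2 3 polyfun_delta_pow Q)
qed

lemma word_sum:
  assumes "polyfun Q" "\<And>e. e \<in> A \<Longrightarrow> polyfun (\<Phi> e)" "finite A"
  shows "word Q p q (\<lambda>a. \<Sum>e\<in>A. c e * \<Phi> e a) = (\<lambda>a. \<Sum>e\<in>A. c e * word Q p q (\<Phi> e) a)"
  using assms(3,2)
proof (induction A rule: finite_induct)
  case empty
  show ?case
    using word_linear(2)[OF assms(1) polyfun.const, of p q 0 0] by simp
next
  case (insert e A)
  have "polyfun (\<lambda>a. c e * \<Phi> e a)" "polyfun (\<lambda>a. \<Sum>e\<in>A. c e * \<Phi> e a)"
    using insert.prems by (auto intro!: polyfun.intros polyfun_sum)
  then show ?case
    using insert by (simp add: word_linear[OF assms(1)])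
qed

section \<open>Order of vanishing in the running point\<close>

fun vord :: "nat \<Rightarrow> cfun \<Rightarrow> (nat \<times> 4 \<Rightarrow> complex) \<Rightarrow> bool" where
  "vord 0 \<Phi> a \<longleftrightarrow> polyfun \<Phi>"
| "vord (Suc n) \<Phi> a \<longleftrightarrow> polyfun \<Phi> \<and> \<Phi> a = 0 \<and> (\<forall>j\<in>{1, 2, 3}. vord n (pd (0, j) \<Phi>) a)"

lemma vord_polyfun: "vord n \<Phi> a \<Longrightarrow> polyfun \<Phi>"
  by (cases n) auto

lemma vord_Suc: "vord (Suc n) \<Phi> a \<Longrightarrow> vord n \<Phi> a"
proof (induction n arbitrary: \<Phi>)
  case (Suc n)
  from iffD1[OF vord.simps(2) Suc.prems] Suc.IH show ?case
    by (subst vord.simps(2)) blast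
qed simp

lemma vord_mono: "vord n \<Phi> a \<Longrightarrow> m \<le> n \<Longrightarrow> vord m \<Phi> a"
proof (induction n)
  case (Suc n)
  show ?case
  proof (cases "m = Suc n")
    case True
    with Suc.prems show ?thesis
      by blast
  next
    case False
    with Suc.prems(2) have "m \<le> n"
      by simp
    with Suc.IH[OF vord_Suc[OF Suc.prems(1)]] show ?thesis
      by blast
  qed
qed simp

lemma vord_zero: "vord n (\<lambda>_. 0) a"
  by (induction n) (auto intro: polyfun.intros)

lemma vord_add: "vord n \<Phi> a \<Longrightarrow> vord n \<Psi> a \<Longrightarrow> vord n (\<lambda>a. \<Phi> a + \<Psi> a) a"
  by (induction n arbitrary: \<Phi> \<Psi>) (auto intro: polyfun.intros simp: pd_add)

lemma vord_mult_left: "polyfun \<Phi> \<Longrightarrow> vord n \<Psi> a \<Longrightarrow> vord n (\<lambda>a. \<Phi> a * \<Psi> a) a"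
proof (induction n arbitrary: \<Phi> \<Psi>)
  case 0
  then show ?case
    by (auto intro: polyfun.intros)
next
  case (Suc n)
  have "vord n (\<lambda>a. pd (0, j) \<Phi> a * \<Psi> a + \<Phi> a * pd (0, j) \<Psi> a) a" if "j \<in> {1, 2, 3}" for j
    using Suc.prems that vord_Suc[OF Suc.prems(2)] by (intro vord_add Suc.IH polyfun_pd) auto
  then show ?case
    using Suc.prems by (auto intro: polyfun.intros simp: pd_mult)
qed

lemma vord_mult: "vord m \<Phi> a \<Longrightarrow> vord n \<Psi> a \<Longrightarrow> vord (m + n) (\<lambda>a. \<Phi> a * \<Psi> a) a"
proof (induction "m + n" arbitrary: m n \<Phi> \<Psi>)
  case 0
  then show ?case
    by (auto intro: polyfun.intros)
next
  case (Suc k)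
  note pf = vord_polyfun[OF Suc.prems(1)] vord_polyfun[OF Suc.prems(2)]
  show ?case
  proof (cases "m = 0 \<or> n = 0")
    case True
    then show ?thesis
      using vord_mult_left[OF pf(1) Suc.prems(2)] vord_mult_left[OF pf(2) Suc.prems(1)]
      by (auto simp: mult.commute)
  next
    case False
    then obtain m' n' where mn: "m = Suc m'" "n = Suc n'"
      by (metis not0_implies_Suc)
    have "vord k (\<lambda>a. pd (0, j) \<Phi> a * \<Psi> a + \<Phi> a * pd (0, j) \<Psi> a) a" if j: "j \<in> {1, 2, 3}" for j
    proof (rule vord_add)
      have "vord m' (pd (0, j) \<Phi>) a" "vord n' (pd (0, j) \<Psi>) a"
        using Suc.prems j mn by auto
      with Suc.hyps Suc.prems mn show "vord k (\<lambda>a. pd (0, j) \<Phi> a * \<Psi> a) a"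
        "vord k (\<lambda>a. \<Phi> a * pd (0, j) \<Psi> a) a"
        by (metis Suc.hyps(1) add_Suc add_Suc_right nat.inject)+
    qed
    then have "vord (Suc k) (\<lambda>a. \<Phi> a * \<Psi> a) a"
      using pf Suc.prems mn by (auto intro: polyfun.intros simp: pd_mult)
    with Suc.hyps(2) show ?thesis
      by simp
  qed
qed

lemma vord_power: "vord 1 \<Phi> a \<Longrightarrow> vord n (\<lambda>a. \<Phi> a ^ n) a"
proof (induction n)
  case 0
  show ?case
    by (auto intro: polyfun.intros)
next
  case (Suc n)
  then show ?case
    using vord_mult[of 1 \<Phi> a n "\<lambda>a. \<Phi> a ^ n"] by simp
qed

lemma vord_delta: "polyfun Q \<Longrightarrow> vord (Suc n) \<Phi> a \<Longrightarrow> j \<in> {1, 2} \<Longrightarrow> vord n (delta Q j \<Phi>) a"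
proof -
  assume *: "polyfun Q" "vord (Suc n) \<Phi> a" "j \<in> {1, 2}"
  have "vord n (\<lambda>a. pd (0, 3) Q a * pd (0, j) \<Phi> a + - pd (0, j) Q a * pd (0, 3) \<Phi> a) a"
    using * by (intro vord_add vord_mult_left polyfun_uminus polyfun_pd) auto
  then show ?thesis
    by (simp add: delta_def[abs_def])
qed

lemma vord_delta_pow:
  "polyfun Q \<Longrightarrow> vord (n + k) \<Phi> a \<Longrightarrow> j \<in> {1, 2} \<Longrightarrow> vord n ((delta Q j ^^ k) \<Phi>) a"
proof (induction k arbitrary: n)
  case (Suc k)
  then have "vord (Suc n) ((delta Q j ^^ k) \<Phi>) a"
    by (intro Suc.IH) (simp_all del: vord.simps)
  then show ?case
    using vord_delta[OF Suc.prems(1) _ Suc.prems(3)] by (simp del: vord.simps)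
qed simp

text \<open>Each vector field costs at most one order of vanishing.\<close>

lemma vord_word: "polyfun Q \<Longrightarrow> vord m \<Phi> a \<Longrightarrow> p + q < m \<Longrightarrow> word Q p q \<Phi> a = 0"
proof -
  assume *: "polyfun Q" "vord m \<Phi> a" "p + q < m"
  have "vord (1 + p + q) \<Phi> a"
    by (rule vord_mono[OF *(2)]) (use *(3) in simp)
  then have "vord (1 + p) ((delta Q 2 ^^ q) \<Phi>) a"
    by (rule vord_delta_pow[OF *(1)]) simp
  then have "vord 1 (word Q p q \<Phi>) a"
    unfolding word_def by (rule vord_delta_pow[OF *(1)]) simp
  then show ?thesis
    by simp
qed

text \<open>On the quadric \<open>X\<^sub>3 X\<^sub>4 = X\<^sub>1 X\<^sub>2\<close>, parametrised by \<open>(s, t, s t, 1)\<close>, the two vector fields are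
  multiples of the partial derivatives with respect to \<open>s\<close> and \<open>t\<close>.\<close>

definition seg :: "complex \<Rightarrow> complex \<Rightarrow> 4 \<Rightarrow> complex" where
  "seg s t j = (if j = 1 then s else if j = 2 then t else if j = 3 then s * t else 1)"

definition on_seg :: "(nat \<times> 4 \<Rightarrow> complex) \<Rightarrow> complex \<Rightarrow> complex \<Rightarrow> nat \<times> 4 \<Rightarrow> complex" where
  "on_seg a s t = (\<lambda>(i, j). if i = 0 then seg s t j else a (i, j))"

lemma on_seg_simps [simp]:
  "on_seg a s t (0, 1) = s" "on_seg a s t (0, 2) = t" "on_seg a s t (0, 3) = s * t"
  by (simp_all add: on_seg_def seg_def)

lemma run_on_seg: "run e (on_seg a s t) = s ^ fst (biexp e) * t ^ snd (biexp e)"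
  by (simp add: run_def amono_def biexp_def power_add power_mult_distrib mult_ac)

lemma deriv_on_seg:
  assumes "polyfun \<Phi>"
  shows "((\<lambda>s. \<Phi> (on_seg a s t)) has_field_derivative
      pd (0, 1) \<Phi> (on_seg a s t) + t * pd (0, 3) \<Phi> (on_seg a s t)) (at s) \<and>
    ((\<lambda>t. \<Phi> (on_seg a s t)) has_field_derivative
      pd (0, 2) \<Phi> (on_seg a s t) + s * pd (0, 3) \<Phi> (on_seg a s t)) (at t)"
  using assms
proof induction
  case (const c)
  then show ?case
    by simp
next
  case (var v)
  obtain i j where v: "v = (i, j)"
    by fastforce
  show ?case
    using exhaust_4[of j]
    by (cases "i = 0") (auto simp: v pd_var on_seg_def seg_def intro!: derivative_eq_intros)
next
  case (add f g)
  then show ?case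
    by (auto simp: pd_add algebra_simps intro!: derivative_eq_intros)
next
  case (mult f g)
  then show ?case
    by (auto simp: pd_mult algebra_simps intro!: derivative_eq_intros)
qed

text \<open>\<open>fact p * of_nat (i choose p)\<close> is a falling factorial; it is zero for
  \<open>p > i\<close>, where the exponent \<open>i - p\<close> is truncated.\<close>

lemma deriv_falling_monomial:
  "((\<lambda>s. c * (fact p * of_nat (i choose p) * s ^ (i - p))) has_field_derivative
     c * (fact (Suc p) * of_nat (i choose Suc p) * s ^ (i - Suc p))) (at (s :: complex))"
proof -
  have "(Suc p) * (i choose Suc p) = (i - p) * (i choose p)"
    by (metis binomial_absorb_comp binomial_absorption mult.commute Suc_times_binomial_eq times_binomial_minus1_eq)
  then have "of_nat (Suc p) * of_nat (i choose Suc p) = (of_nat (i - p) * of_nat (i choose p) :: complex)"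
    by (metis of_nat_mult)
  then have "c * (fact (Suc p) * of_nat (i choose Suc p) * s ^ (i - Suc p)) =
      c * (fact p * of_nat (i choose p) * (of_nat (i - p) * s ^ (i - p - 1)))"
    by (simp add: fact_Suc mult_ac)
  then show ?thesis
    by (auto intro!: derivative_eq_intros)
qed

text \<open>By the chain rule the two fields become \<open>\<kappa>\<close> times the derivatives in
  \<open>s\<close> and \<open>t\<close>. The result is an entry of \<open>jet_matrix\<close> up to a
  factor that depends on the row only.\<close>

lemma word_run_on_seg:
  assumes Q: "polyfun Q" "\<And>b. (\<And>i j. i > 0 \<Longrightarrow> b (i, j) = a (i, j)) \<Longrightarrow>
      Q b = \<kappa> * (b (0, 3) - b (0, 1) * b (0, 2))"
  shows "word Q p q (run e) (on_seg a s t) = \<kappa> ^ (p + q) * (fact p * fact q) *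
    (of_nat (fst (biexp e) choose p) * s ^ (fst (biexp e) - p) *
     (of_nat (snd (biexp e) choose q) * t ^ (snd (biexp e) - q)))"
proof -
  have pdQ: "pd (0, 3) Q (on_seg a s t) = \<kappa>" "pd (0, 1) Q (on_seg a s t) = - \<kappa> * t"
    "pd (0, 2) Q (on_seg a s t) = - \<kappa> * s" for s t
  proof -
    have *: "Q ((on_seg a s t)((0, j) := z)) = \<kappa> * (((on_seg a s t)((0, j) := z)) (0, 3) -
        ((on_seg a s t)((0, j) := z)) (0, 1) * ((on_seg a s t)((0, j) := z)) (0, 2))" for j z
      by (rule Q(2)) (simp add: on_seg_def)
    show "pd (0, 3) Q (on_seg a s t) = \<kappa>" "pd (0, 1) Q (on_seg a s t) = - \<kappa> * t"
      "pd (0, 2) Q (on_seg a s t) = - \<kappa> * s"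
      by (rule pd_eqI; simp add: *; auto intro!: derivative_eq_intros)+
  qed
  have d1: "delta Q 1 \<Phi> (on_seg a s t) = \<kappa> * D"
    if "polyfun \<Phi>" "((\<lambda>s. \<Phi> (on_seg a s t)) has_field_derivative D) (at s)" for \<Phi> D s t
    using DERIV_unique[OF that(2) conjunct1[OF deriv_on_seg[OF that(1)]]] by (simp add: delta_def pdQ algebra_simps)
  have d2: "delta Q 2 \<Phi> (on_seg a s t) = \<kappa> * D"
    if "polyfun \<Phi>" "((\<lambda>t. \<Phi> (on_seg a s t)) has_field_derivative D) (at t)" for \<Phi> D s t
    using DERIV_unique[OF that(2) conjunct2[OF deriv_on_seg[OF that(1)]]] by (simp add: delta_def pdQ algebra_simps)
  define i j where "i = fst (biexp e)" and "j = snd (biexp e)"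
  have 2: "(delta Q 2 ^^ q) (run e) (on_seg a s t) =
      (\<kappa> ^ q * s ^ i) * (fact q * of_nat (j choose q) * t ^ (j - q))" for s t
  proof (induction q arbitrary: s t)
    case 0
    show ?case
      by (simp add: run_on_seg i_def j_def)
  next
    case (Suc q)
    have "delta Q 2 ((delta Q 2 ^^ q) (run e)) (on_seg a s t) =
        \<kappa> * ((\<kappa> ^ q * s ^ i) * (fact (Suc q) * of_nat (j choose Suc q) * t ^ (j - Suc q)))"
      by (rule d2[OF polyfun_delta_pow[OF Q(1) polyfun_run]]) (unfold Suc, rule deriv_falling_monomial)
    then show ?case
      by (simp add: mult_ac)
  qed
  have "(delta Q 1 ^^ p) ((delta Q 2 ^^ q) (run e)) (on_seg a s t) =
      (\<kappa> ^ p * (\<kappa> ^ q * (fact q * of_nat (j choose q) * t ^ (j - q)))) * (fact p * of_nat (i choose p) * s ^ (i - p))"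
    for s t
  proof (induction p arbitrary: s t)
    case 0
    show ?case
      by (simp add: 2)
  next
    case (Suc p)
    have "delta Q 1 ((delta Q 1 ^^ p) ((delta Q 2 ^^ q) (run e))) (on_seg a s t) =
        \<kappa> * ((\<kappa> ^ p * (\<kappa> ^ q * (fact q * of_nat (j choose q) * t ^ (j - q)))) *
          (fact (Suc p) * of_nat (i choose Suc p) * s ^ (i - Suc p)))"
      by (rule d1[OF polyfun_delta_pow[OF Q(1) polyfun_delta_pow[OF Q(1) polyfun_run]]])
        (unfold Suc, rule deriv_falling_monomial)
    then show ?case
      by (simp add: mult_ac)
  qed
  then show ?thesis
    by (simp add: word_def power_add mult_ac i_def j_def)
qed

subsection \<open>Configurations near a special one\<close>

lemma trivial_kernel_reindex:
  assumes "bij_betw b J' J" "trivial_kernel I J M"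
  shows "trivial_kernel I J' (\<lambda>i j. M i (b j))"
  unfolding trivial_kernel_def
proof (intro allI impI)
  fix c assume c: "\<forall>i\<in>I. (\<Sum>j\<in>J'. M i (b j) * c j) = 0"
  have inv: "inv_into J' b (b j) = j" if "j \<in> J'" for j
    using assms(1) that by (simp add: bij_betw_def)
  have "(\<Sum>j\<in>J. M i j * c (inv_into J' b j)) = (\<Sum>j\<in>J'. M i (b j) * c j)" for i
    by (subst sum.reindex_bij_betw[OF assms(1), symmetric]) (auto simp: inv intro!: sum.cong)
  then have "\<forall>j\<in>J. c (inv_into J' b j) = 0"
    using assms(2)[unfolded trivial_kernel_def, THEN spec, of "\<lambda>j. c (inv_into J' b j)"] c by simp
  then show "\<forall>j\<in>J'. c j = 0"
    using inv assms(1) by (metis bij_betwE)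
qed

lemma trivial_kernel_rows:
  fixes M :: "'i \<Rightarrow> 'j \<Rightarrow> 'k::field"
  assumes "trivial_kernel I J M"
    and "\<And>i. i \<in> I \<Longrightarrow> \<exists>i'\<in>I'. \<exists>s. s \<noteq> 0 \<and> (\<forall>j\<in>J. M' i' j = s * M i j)"
  shows "trivial_kernel I' J M'"
  unfolding trivial_kernel_def
proof (intro allI impI)
  fix c assume c: "\<forall>i\<in>I'. (\<Sum>j\<in>J. M' i j * c j) = 0"
  have "(\<Sum>j\<in>J. M i j * c j) = 0" if i: "i \<in> I" for i
  proof -
    obtain i' s where s: "i' \<in> I'" "s \<noteq> 0" "\<And>j. j \<in> J \<Longrightarrow> M' i' j = s * M i j"
      using assms(2)[OF i] by blast
    have "0 = (\<Sum>j\<in>J. M' i' j * c j)"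
      using c s(1) by simp
    also have "\<dots> = s * (\<Sum>j\<in>J. M i j * c j)"
      unfolding sum_distrib_left by (intro sum.cong refl) (simp add: s(3) mult_ac)
    finally show ?thesis
      using s(2) by simp
  qed
  then show "\<forall>j\<in>J. c j = 0"
    using assms(1) unfolding trivial_kernel_def by blast
qed

text \<open>The target is appended as an extra column; injectivity forces a nonzero coefficient
  there, by which the relation is divided.\<close>

lemma square_system_solvable:
  fixes M :: "'i \<Rightarrow> 'j \<Rightarrow> 'k::field"
  assumes "trivial_kernel I J M" "finite I" "finite J" "card I = card J"
  shows "\<exists>c. \<forall>i\<in>I. (\<Sum>j\<in>J. M i j * c j) = t i"
proof -
  define N where "N i u = (case u of None \<Rightarrow> - t i | Some j \<Rightarrow> M i j)" for i u
  have card: "card I < card (insert None (Some ` J))"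
    using assms(3,4) by (simp add: card_image)
  obtain c where c: "\<exists>u\<in>insert None (Some ` J). c u \<noteq> 0"
    "\<And>i. i \<in> I \<Longrightarrow> (\<Sum>u\<in>insert None (Some ` J). N i u * c u) = 0"
    using underdetermined_system[OF assms(2) _ card, of N] assms(3) by auto
  have eq: "(\<Sum>j\<in>J. M i j * c (Some j)) = t i * c None" if "i \<in> I" for i
    using c(2)[OF that] assms(3) by (simp add: N_def sum.reindex)
  have "c None \<noteq> 0"
  proof
    assume "c None = 0"
    then have "\<forall>j\<in>J. c (Some j) = 0"
      using assms(1)[unfolded trivial_kernel_def, THEN spec, of "\<lambda>j. c (Some j)"] eq by simp
    with c(1) \<open>c None = 0\<close> show False
      by auto
  qed
  then have "\<forall>i\<in>I. (\<Sum>j\<in>J. M i j * (c (Some j) / c None)) = t i"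
    using eq by (simp add: sum_divide_distrib[symmetric])
  then show ?thesis
    by (rule exI[of _ "\<lambda>j. c (Some j) / c None"])
qed

lemma pval_Abs_pf: "polyfun f \<Longrightarrow> pval a (Abs_pf f) = f a"
  by (simp add: pval.rep_eq Abs_pf_inverse)

lemma polyfun_pval: "polyfun (\<lambda>a. pval (g a) f)" if "\<And>v. polyfun (\<lambda>a. g a v)"
  unfolding pval.rep_eq by (rule polyfun_compose) (use Rep_pf that in auto)

text \<open>The vector fields differentiate in the running variables only, so an equality that holds
  just for the configuration \<open>a\<close> may be used inside a word.\<close>

lemma word_cong_slice:
  assumes "\<And>b. (\<And>i j. i > 0 \<Longrightarrow> b (i, j) = a (i, j)) \<Longrightarrow> \<Phi> b = \<Psi> b"
    and "\<And>i j. i > 0 \<Longrightarrow> b (i, j) = a (i, j)"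
  shows "word Q p q \<Phi> b = word Q p q \<Psi> b"
proof -
  have pd: "pd (0, j) \<Phi> b = pd (0, j) \<Psi> b"
    if "\<And>b. (\<And>i j. i > 0 \<Longrightarrow> b (i, j) = a (i, j)) \<Longrightarrow> \<Phi> b = \<Psi> b"
      "\<And>i j. i > 0 \<Longrightarrow> b (i, j) = a (i, j)" for \<Phi> \<Psi> j b
  proof -
    have "\<Phi> (b((0, j) := z)) = \<Psi> (b((0, j) := z))" for z
      using that by auto
    then show ?thesis
      by (simp add: pd_def)
  qed
  have delta: "(delta Q j ^^ n) \<Phi> b = (delta Q j ^^ n) \<Psi> b"
    if "\<And>b. (\<And>i j. i > 0 \<Longrightarrow> b (i, j) = a (i, j)) \<Longrightarrow> \<Phi> b = \<Psi> b"
      "\<And>i j. i > 0 \<Longrightarrow> b (i, j) = a (i, j)" for \<Phi> \<Psi> j n b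
    using that(2)
  proof (induction n arbitrary: b)
    case 0
    with that(1) show ?case
      by simp
  next
    case (Suc n)
    have step: "delta Q j X b = delta Q j Y b" if "\<And>i. pd (0, i) X b = pd (0, i) Y b" for X Y
      by (simp add: delta_def that)
    show ?case
      unfolding funpow.simps o_apply by (rule step, rule pd[OF Suc.IH Suc.prems])
  qed
  show ?thesis
    unfolding word_def by (rule delta[OF delta[OF assms(1)] assms(2)])
qed

text \<open>General in \<open>\<mu>\<close> because it is applied both to \<open>run\<close>, with
  fourth coordinate 1, and to homogeneous coordinates.\<close>

lemma product_expansion:
  fixes k G \<mu> :: "(4 \<Rightarrow>\<^sub>0 nat) \<Rightarrow> complex"
  assumes "\<And>f g. \<mu> (f + g) = \<mu> f * \<mu> g"
  shows "(\<Sum>e\<in>Mon (c + d). (\<Sum>g\<in>Mon d. \<Sum>f\<in>Mon c. if f + g = e then k f * G g else 0) * \<mu> e) =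
    (\<Sum>f\<in>Mon c. k f * \<mu> f) * (\<Sum>g\<in>Mon d. G g * \<mu> g)"
proof -
  have "(\<Sum>e\<in>Mon (c + d). (\<Sum>g\<in>Mon d. \<Sum>f\<in>Mon c. if f + g = e then k f * G g else 0) * \<mu> e) =
      (\<Sum>e\<in>Mon (c + d). \<Sum>g\<in>Mon d. \<Sum>f\<in>Mon c. if f + g = e then k f * G g * \<mu> e else 0)"
    unfolding sum_distrib_right by (intro sum.cong refl) simp
  also have "\<dots> = (\<Sum>g\<in>Mon d. \<Sum>e\<in>Mon (c + d). \<Sum>f\<in>Mon c. if f + g = e then k f * G g * \<mu> e else 0)"
    by (rule sum.swap)
  also have "\<dots> = (\<Sum>g\<in>Mon d. \<Sum>f\<in>Mon c. \<Sum>e\<in>Mon (c + d). if f + g = e then k f * G g * \<mu> e else 0)"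
    by (rule sum.cong[OF refl], rule sum.swap)
  also have "\<dots> = (\<Sum>g\<in>Mon d. \<Sum>f\<in>Mon c. k f * \<mu> f * (G g * \<mu> g))"
    by (intro sum.cong refl) (simp add: Mon_add assms mult_ac)
  also have "\<dots> = (\<Sum>f\<in>Mon c. k f * \<mu> f) * (\<Sum>g\<in>Mon d. G g * \<mu> g)"
    by (subst sum.swap) (simp add: sum_product)
  finally show ?thesis .
qed

lemma run_add: "run (f + g) b = run f b * run g b"
  by (simp add: run_def amono_def lookup_add power_add mult_ac)

lemma run_e: "run e34 b = b (0, 3)" "run e12 b = b (0, 1) * b (0, 2)"
  by (simp_all add: run_def amono_def e34_def e12_def)

text \<open>\<open>k\<close> is the coefficient family of the unique quadric through the nine points of \<open>a\<close>, and it
  divides every form of degree \<open>d\<close> with multiplicity \<open>m\<close> at these points.\<close>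

definition quadric_divides ::
  "nat \<Rightarrow> nat \<Rightarrow> (nat \<times> 4 \<Rightarrow> complex) \<Rightarrow> ((4 \<Rightarrow>\<^sub>0 nat) \<Rightarrow> complex) \<Rightarrow> bool" where
  "quadric_divides d m a k \<longleftrightarrow> k e34 \<noteq> 0 \<and>
    (\<forall>l\<in>{1..9}. (\<Sum>e\<in>Mon 2. k e * run e (at_point l a)) = 0) \<and>
    (\<forall>c. (\<forall>l\<in>{1..9}. (\<Sum>e\<in>Mon 2. c e * run e (at_point l a)) = 0) \<longrightarrow> c e34 = 0 \<longrightarrow> (\<forall>e\<in>Mon 2. c e = 0)) \<and>
    (\<forall>F. (\<forall>l\<in>{1..9}. vord m (\<lambda>b. \<Sum>e\<in>Mon d. F e * run e b) (at_point l a)) \<longrightarrow>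
      (\<exists>G. \<forall>e\<in>Mon d. F e = (\<Sum>g\<in>Mon (d - 2). \<Sum>f\<in>Mon 2. if f + g = e then k f * G g else 0)))"

text \<open>Three matrices are injective at the special configuration: point evaluation on
  \<open>Nor 2\<close>, words on \<open>Nor d\<close>, and multiplication by the quadric into the
  reducible monomials. Where they stay injective, the third gives division by the quadric with
  normal remainder, and the second kills the remainder.\<close>

lemma good_configurations:
  assumes d: "2 \<le> d" and dm: "9 * d < 19 * m"
  shows "\<exists>h a\<^sub>0. polyfun h \<and> h a\<^sub>0 \<noteq> 0 \<and> (\<forall>l>0. a\<^sub>0 (l, 4) = 1) \<and>
    (\<forall>a. h a \<noteq> 0 \<longrightarrow> (\<exists>k. quadric_divides d m a k))"
proof -
  have d2: "d - 2 + 2 = d" "2 + (d - 2) = d"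
    using d by simp_all
  obtain x y :: "nat \<Rightarrow> complex" where
    xy: "trivial_kernel (jet_rows m) ({..d} \<times> {..d}) (jet_matrix x y)"
      "trivial_kernel (jet_rows 1) ({..2} \<times> {..2}) (jet_matrix x y)"
    using special_points[OF dm] by blast
  \<comment> \<open>Points of the standard quadric; configurations are numbered from 1,
    \<open>x\<close> and \<open>y\<close> from 0.\<close>
  define a\<^sub>0 :: "nat \<times> 4 \<Rightarrow> complex" where
    "a\<^sub>0 = (\<lambda>(l, j). if l = 0 then 0 else seg (x (l - 1)) (y (l - 1)) j)"
  \<comment> \<open>The coefficients of the quadric, as ring elements, might involve the running
    variables; setting these to 0 makes the coefficients constants for the vector fields.\<close>
  define clear :: "(nat \<times> 4 \<Rightarrow> complex) \<Rightarrow> nat \<times> 4 \<Rightarrow> complex" where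
    "clear a = (\<lambda>(i, j). if i = 0 then 0 else a (i, j))" for a
  have clear_a\<^sub>0: "clear b = a\<^sub>0" if "\<And>i j. i > 0 \<Longrightarrow> b (i, j) = a\<^sub>0 (i, j)" for b
    using that by (auto simp: clear_def a\<^sub>0_def fun_eq_iff)
  have at_a\<^sub>0: "at_point l a\<^sub>0 = on_seg a\<^sub>0 (x (l - 1)) (y (l - 1))" if "l > 0" for l
    using that by (auto simp: at_point_def on_seg_def a\<^sub>0_def fun_eq_iff)
  define A where "A l e = Abs_pf (\<lambda>a. run e (at_point l a))" for l e
  have A: "pval a (A l e) = run e (at_point l a)" for a l e
    unfolding A_def by (intro pval_Abs_pf polyfun_at_point polyfun_run)
  have "trivial_kernel (jet_rows 1) (Nor 2) (\<lambda>i e. jet_matrix x y i (biexp e))"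
    by (rule trivial_kernel_reindex[OF bij_biexp xy(2)])
  then have TA: "trivial_kernel {1..9} (Nor 2) (\<lambda>l e. pval a\<^sub>0 (A l e))"
  proof (rule trivial_kernel_rows)
    fix i assume "i \<in> jet_rows 1"
    then obtain l where "i = (l, 0, 0)" "l < 9"
      by (auto simp: jet_rows_def tri_def)
    then show "\<exists>i'\<in>{1..9}. \<exists>s. s \<noteq> 0 \<and> (\<forall>e\<in>Nor 2. pval a\<^sub>0 (A i' e) = s * jet_matrix x y i (biexp e))"
      by (intro bexI[of _ "Suc l"] exI[of _ 1])
        (auto simp: A at_a\<^sub>0 run_on_seg jet_matrix_def split: prod.split)
  qed
  have fin [simp]: "finite (Nor n)" for n
    by (rule finite_subset[OF _ finite_Mon]) (auto simp: Nor_def)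
  have "card (Nor 2) = 9"
    using bij_betw_same_card[OF bij_biexp, of 2] by (simp add: card_cartesian_product)
  then obtain k where k: "pval a\<^sub>0 (k e34) \<noteq> 0" "\<And>l. l \<in> {1..9} \<Longrightarrow> (\<Sum>e\<in>Mon 2. A l e * k e) = 0"
    using generic_kernel_vector[OF _ Mon_2(2) rhom_pval _ _ TA] Mon_2(1) by auto
  define \<kappa> where "\<kappa> = pval a\<^sub>0 (k e34)"
  define K where "K e a = pval (clear a) (k e)" for e a
  define Q where "Q a = (\<Sum>e\<in>Mon 2. K e a * run e a)" for a
  have polyfun_K: "polyfun (K e)" for e
    unfolding K_def[abs_def]
  proof (rule polyfun_pval)
    show "polyfun (\<lambda>a. clear a v)" for v
      by (cases v; cases "fst v = 0") (simp_all add: clear_def polyfun.intros)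
  qed
  have polyfun_Q: "polyfun Q"
    unfolding Q_def[abs_def] by (intro polyfun_sum polyfun.mult polyfun_K polyfun_run)
  have K_cong: "K e b = K e a" if "\<And>i j. i > 0 \<Longrightarrow> b (i, j) = a (i, j)" for a b e
  proof -
    have "clear b = clear a"
      using that by (auto simp: clear_def fun_eq_iff)
    then show ?thesis
      by (simp add: K_def)
  qed
  have K_at: "K e (at_point l a) = K e a" for e l a
    by (rule K_cong) (simp add: at_point_def)
  have kernel: "(\<Sum>e\<in>Mon 2. K e a * run e (at_point l a)) = 0" if l: "l \<in> {1..9}" for a l
  proof -
    have "run e (at_point l (clear a)) = run e (at_point l a)" for e
      using l by (simp add: run_def at_point_def clear_def)
    then have "(\<Sum>e\<in>Mon 2. K e a * run e (at_point l a)) = pval (clear a) (\<Sum>e\<in>Mon 2. A l e * k e)"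
      by (simp add: K_def rhom_simps[OF rhom_pval] A mult.commute)
    then show ?thesis
      using k(2)[OF l] by (simp add: rhom_0[OF rhom_pval])
  qed
  have e12: "e12 \<in> Nor 2"
    by (simp add: e12_def Nor_def Mon_def mdegree_4)
  have K\<^sub>0: "K e a\<^sub>0 = pval a\<^sub>0 (k e)" for e
    by (simp add: K_def clear_a\<^sub>0)
  \<comment> \<open>\<open>X3 * X4\<close> and \<open>X1 * X2\<close> agree at the points, so moving
    \<open>\<kappa>\<close> from \<open>e34\<close> to \<open>e12\<close> gives a kernel vector on
    normal monomials, which is zero.\<close>
  have k\<^sub>0: "pval a\<^sub>0 (k e) = (if e = e34 then \<kappa> else if e = e12 then - \<kappa> else 0)" if "e \<in> Mon 2" for e
  proof (cases "e = e34")
    case True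
    then show ?thesis
      by (simp add: \<kappa>_def)
  next
    case False
    define c where "c e = pval a\<^sub>0 (k e) + (if e = e12 then \<kappa> else 0)" for e
    have "(\<Sum>e\<in>Nor 2. pval a\<^sub>0 (A l e) * c e) = 0" if l: "l \<in> {1..9}" for l
    proof -
      have "0 = (\<Sum>e\<in>Mon 2. pval a\<^sub>0 (k e) * run e (at_point l a\<^sub>0))"
        using kernel[OF l, of a\<^sub>0] by (simp add: K\<^sub>0)
      also have "\<dots> = \<kappa> * run e34 (at_point l a\<^sub>0) + (\<Sum>e\<in>Nor 2. pval a\<^sub>0 (k e) * run e (at_point l a\<^sub>0))"
        using Mon_2 by (simp add: \<kappa>_def)
      also have "run e34 (at_point l a\<^sub>0) = run e12 (at_point l a\<^sub>0)"
        using l by (simp add: at_a\<^sub>0 run_e)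
      finally have "0 = \<kappa> * run e12 (at_point l a\<^sub>0) + (\<Sum>e\<in>Nor 2. pval a\<^sub>0 (k e) * run e (at_point l a\<^sub>0))" .
      also have "\<kappa> * run e12 (at_point l a\<^sub>0) =
          (\<Sum>e\<in>Nor 2. (if e = e12 then \<kappa> else 0) * run e (at_point l a\<^sub>0))"
        using e12 by (simp add: if_distrib[of "\<lambda>c. c * _"] cong: if_cong)
      finally show ?thesis
        by (simp add: A c_def sum.distrib[symmetric] algebra_simps)
    qed
    then have "\<forall>e\<in>Nor 2. c e = 0"
      using TA unfolding trivial_kernel_def by blast
    moreover have "e \<in> Nor 2"
      using that False Mon_2(1) by blast
    ultimately have "c e = 0"
      by blast
    then show ?thesis
      using False by (auto simp: c_def add_eq_0_iff split: if_splits)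
  qed
  have Q\<^sub>0: "Q b = \<kappa> * (b (0, 3) - b (0, 1) * b (0, 2))" if "\<And>i j. i > 0 \<Longrightarrow> b (i, j) = a\<^sub>0 (i, j)" for b
  proof -
    have "Q b = (\<Sum>e\<in>Mon 2. (if e = e34 then \<kappa> else if e = e12 then - \<kappa> else 0) * run e b)"
      unfolding Q_def by (intro sum.cong refl) (simp add: K_def clear_a\<^sub>0[OF that] k\<^sub>0)
    also have "\<dots> = \<kappa> * run e34 b + (\<Sum>e\<in>Nor 2. (if e = e12 then - \<kappa> else 0) * run e b)"
      unfolding Mon_2(1) using Mon_2(2) by (simp, intro sum.cong refl) auto
    also have "\<dots> = \<kappa> * run e34 b - \<kappa> * run e12 b"
      using e12 by (simp add: if_distrib[of "\<lambda>c. c * _"] cong: if_cong)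
    finally show ?thesis
      by (simp add: run_e algebra_simps)
  qed
  define W where "W = (\<lambda>(l, p, q) e. Abs_pf (\<lambda>a. word Q p q (run e) (at_point l a)))"
  have W: "pval a (W (l, p, q) e) = word Q p q (run e) (at_point l a)" for a l p q e
    unfolding W_def prod.case by (intro pval_Abs_pf polyfun_at_point polyfun_word polyfun_Q polyfun_run)
  have "trivial_kernel (jet_rows m) (Nor d) (\<lambda>i e. jet_matrix x y i (biexp e))"
    by (rule trivial_kernel_reindex[OF bij_biexp xy(1)])
  then have TW: "trivial_kernel ({1..9} \<times> tri m) (Nor d) (\<lambda>i e. pval a\<^sub>0 (W i e))"
  proof (rule trivial_kernel_rows)
    fix i assume "i \<in> jet_rows m"
    then obtain l p q where i: "i = (l, p, q)" "l < 9" "(p, q) \<in> tri m"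
      by (auto simp: jet_rows_def)
    have "pval a\<^sub>0 (W (Suc l, p, q) e) = \<kappa> ^ (p + q) * (fact p * fact q) * jet_matrix x y i (biexp e)" for e
      using word_run_on_seg[OF polyfun_Q Q\<^sub>0, where p = p and q = q and e = e and s = "x l" and t = "y l"]
      by (simp add: W at_a\<^sub>0 i jet_matrix_def split_beta)
    then show "\<exists>i'\<in>{1..9} \<times> tri m. \<exists>s. s \<noteq> 0 \<and> (\<forall>e\<in>Nor d. pval a\<^sub>0 (W i' e) = s * jet_matrix x y i (biexp e))"
      using i k(1) by (intro bexI[of _ "(Suc l, p, q)"] exI[of _ "\<kappa> ^ (p + q) * (fact p * fact q)"])
        (auto simp: \<kappa>_def)
  qed
  define Z where "Z e g = (\<Sum>f\<in>Mon 2. if f + g = e then Abs_pf (K f) else 0)" for e g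
  have Z: "pval a (Z e g) = (\<Sum>f\<in>Mon 2. if f + g = e then K f a else 0)" for a e g
    unfolding Z_def rhom_sum[OF rhom_pval]
    by (intro sum.cong refl) (simp add: pval_Abs_pf[OF polyfun_K] rhom_0[OF rhom_pval])
  have TZ: "trivial_kernel (Mon d - Nor d) (Mon (d - 2)) (\<lambda>e g. pval a\<^sub>0 (Z e g))"
    unfolding trivial_kernel_def
  proof (intro allI impI)
    fix c assume c: "\<forall>e\<in>Mon d - Nor d. (\<Sum>g\<in>Mon (d - 2). pval a\<^sub>0 (Z e g) * c g) = 0"
    have Z\<^sub>0: "pval a\<^sub>0 (Z e g) = \<kappa> * of_bool (e34 + g = e) - \<kappa> * of_bool (e12 + g = e)" for e g
    proof -
      have "pval a\<^sub>0 (Z e g) = (\<Sum>f\<in>insert e34 (Nor 2). if f + g = e then if f = e34 then \<kappa> else if f = e12 then - \<kappa> else 0 else 0)"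
        unfolding Z Mon_2(1)[symmetric] by (intro sum.cong refl) (simp add: K\<^sub>0 k\<^sub>0)
      also have "\<dots> = \<kappa> * of_bool (e34 + g = e) +
          (\<Sum>f\<in>Nor 2. if f + g = e then if f = e34 then \<kappa> else if f = e12 then - \<kappa> else 0 else 0)"
        using Mon_2(2) by (subst sum.insert) simp_all
      also have "(\<Sum>f\<in>Nor 2. if f + g = e then if f = e34 then \<kappa> else if f = e12 then - \<kappa> else 0 else 0) =
          (\<Sum>f\<in>Nor 2. if f = e12 then - \<kappa> * of_bool (e12 + g = e) else 0)"
        by (intro sum.cong refl) (use Mon_2(2) in auto)
      finally show ?thesis
        using e12 by simp
    qed
    have "c g = 0" if "g \<in> Mon (d - 2)" for g
      using that
    \<comment> \<open>The matrix is triangular in the exponent of the first variable: if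
      \<open>X1 * X2 * g'\<close> equals \<open>X3 * X4 * g\<close>, then \<open>g'\<close> has the
      smaller one.\<close>
    proof (induction "lk g 1" arbitrary: g rule: less_induct)
      case less
      have "e34 + g \<in> Mon d - Nor d"
        using bij_betwE[OF bij_add_e34[of "d - 2"]] less.prems unfolding d2 add.commute[of e34 g] by simp
      then have "(\<Sum>g'\<in>Mon (d - 2). pval a\<^sub>0 (Z (e34 + g) g') * c g') = 0"
        using c by blast
      moreover have "pval a\<^sub>0 (Z (e34 + g) g') * c g' =
          (if g' = g then \<kappa> * c g' else 0) - \<kappa> * of_bool (e12 + g' = e34 + g) * c g'" for g'
        by (simp add: Z\<^sub>0 left_diff_distrib)
      ultimately have "(\<Sum>g'\<in>Mon (d - 2). if g' = g then \<kappa> * c g' else 0) =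
          (\<Sum>g'\<in>Mon (d - 2). \<kappa> * of_bool (e12 + g' = e34 + g) * c g')"
        by (simp only: sum_subtractf right_minus_eq)
      also have "\<dots> = 0"
      proof (intro sum.neutral ballI)
        fix g' assume g': "g' \<in> Mon (d - 2)"
        show "\<kappa> * of_bool (e12 + g' = e34 + g) * c g' = 0"
        proof (cases "e12 + g' = e34 + g")
          case True
          then have "lk (e12 + g') 1 = lk (e34 + g) 1"
            by simp
          then have "lk g' 1 < lk g 1"
            by (simp add: lookup_add e12_def e34_def)
          then show ?thesis
            using less.hyps g' by simp
        qed simp
      qed
      finally show ?case
        using less.prems k(1) by (simp add: \<kappa>_def)
    qed
    then show "\<forall>g\<in>Mon (d - 2). c g = 0"
      by blast
  qed
  obtain h1 where h1: "pval a\<^sub>0 h1 \<noteq> 0"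
    "\<And>a. pval a h1 \<noteq> 0 \<Longrightarrow> trivial_kernel {1..9} (Nor 2) (\<lambda>l e. pval a (A l e))"
    using trivial_kernel_generic[OF _ rhom_pval TA] rhom_pval by (metis fin)
  obtain h2 where h2: "pval a\<^sub>0 h2 \<noteq> 0"
    "\<And>a. pval a h2 \<noteq> 0 \<Longrightarrow> trivial_kernel ({1..9} \<times> tri m) (Nor d) (\<lambda>i e. pval a (W i e))"
    using trivial_kernel_generic[OF _ rhom_pval TW] rhom_pval by (metis fin)
  obtain h3 where h3: "pval a\<^sub>0 h3 \<noteq> 0"
    "\<And>a. pval a h3 \<noteq> 0 \<Longrightarrow> trivial_kernel (Mon d - Nor d) (Mon (d - 2)) (\<lambda>e g. pval a (Z e g))"
    using trivial_kernel_generic[OF _ rhom_pval TZ] rhom_pval by (metis finite_Mon)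
  \<comment> \<open>The last factor provides the nonzero leading coefficient of the quadric.\<close>
  define h where "h a = pval a (h1 * h2 * h3) * K e34 a" for a
  have "polyfun h"
    unfolding h_def[abs_def] by (intro polyfun.mult polyfun_K polyfun_pval polyfun.var)
  moreover have "h a\<^sub>0 \<noteq> 0"
    using h1 h2 h3 k(1) by (simp add: h_def rhom_mult[OF rhom_pval] K\<^sub>0)
  moreover have "\<forall>l>0. a\<^sub>0 (l, 4) = 1"
    by (simp add: a\<^sub>0_def seg_def)
  moreover have "\<exists>k. quadric_divides d m a k"
    if "h a \<noteq> 0" for a
  proof -
    have ha: "pval a h1 \<noteq> 0" "pval a h2 \<noteq> 0" "pval a h3 \<noteq> 0" "K e34 a \<noteq> 0"
      using that by (auto simp: h_def rhom_mult[OF rhom_pval])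
    have unique: "\<forall>e\<in>Mon 2. c e = 0"
      if c: "\<forall>l\<in>{1..9}. (\<Sum>e\<in>Mon 2. c e * run e (at_point l a)) = 0" "c e34 = 0" for c
    proof -
      have "(\<Sum>e\<in>Nor 2. pval a (A l e) * c e) = 0" if "l \<in> {1..9}" for l
        using c that Mon_2 by (simp add: A mult.commute)
      then have "\<forall>e\<in>Nor 2. c e = 0"
        using h1(2)[OF ha(1)] unfolding trivial_kernel_def by blast
      with c(2) show ?thesis
        using Mon_2(1) by auto
    qed
    have divisible: "\<exists>G. \<forall>e\<in>Mon d. F e = (\<Sum>g\<in>Mon (d - 2). \<Sum>f\<in>Mon 2. if f + g = e then K f a * G g else 0)"
      if F: "\<And>l. l \<in> {1..9} \<Longrightarrow> vord m (\<lambda>b. \<Sum>e\<in>Mon d. F e * run e b) (at_point l a)" for F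
    proof -
      \<comment> \<open>An injective square matrix is solvable: \<open>G\<close> is the quotient
        whose product with the quadric has the same reducible coefficients as
        \<open>F\<close>.\<close>
      have "card (Mon d - Nor d) = card (Mon (d - 2))"
        using bij_betw_same_card[OF bij_add_e34[of "d - 2"]] unfolding d2 by simp
      then obtain G where G: "\<And>e. e \<in> Mon d - Nor d \<Longrightarrow> (\<Sum>g\<in>Mon (d - 2). pval a (Z e g) * G g) = F e"
        using square_system_solvable[OF h3(2)[OF ha(3)], of F] by auto
      define H where "H e = (\<Sum>g\<in>Mon (d - 2). \<Sum>f\<in>Mon 2. if f + g = e then K f a * G g else 0)" for e
      have ZH: "(\<Sum>g\<in>Mon (d - 2). pval a (Z e g) * G g) = H e" for e
        unfolding H_def Z sum_distrib_right by (intro sum.cong refl) simp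
      have "F e - H e = 0" if "e \<in> Nor d" for e
      proof -
        have "(\<Sum>e\<in>Nor d. pval a (W (l, p, q) e) * (F e - H e)) = 0" if lpq: "l \<in> {1..9}" "(p, q) \<in> tri m" for l p q
        proof -
          have "word Q p q (\<lambda>b. \<Sum>e\<in>Mon d. F e * run e b) (at_point l a) = 0"
            using vord_word[OF polyfun_Q F] lpq by (simp add: tri_def)
          then have wF: "(\<Sum>e\<in>Mon d. F e * word Q p q (run e) (at_point l a)) = 0"
            by (simp add: word_sum[OF polyfun_Q polyfun_run])
          have "word Q p q (\<lambda>b. \<Sum>e\<in>Mon d. H e * run e b) (at_point l a) =
              word Q p q (\<lambda>b. Q b * (\<Sum>g\<in>Mon (d - 2). G g * run g b)) (at_point l a)"
          \<comment> \<open>\<open>H\<close> has the coefficients of the quadric frozen at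
            \<open>a\<close>, so the factorisation holds on this slice.\<close>
          proof (rule word_cong_slice[where a = a])
            show "(\<Sum>e\<in>Mon d. H e * run e b) = Q b * (\<Sum>g\<in>Mon (d - 2). G g * run g b)"
              if "\<And>i j. i > 0 \<Longrightarrow> b (i, j) = a (i, j)" for b
              using product_expansion[of "\<lambda>e. run e b", where c = 2 and d = "d - 2" and k = "\<lambda>f. K f a" and G = G] unfolding d2
              by (simp add: H_def Q_def run_add K_cong[where a = a and b = b, OF that])
          qed (simp add: at_point_def)
          also have "\<dots> = Q (at_point l a) * word Q p q (\<lambda>b. \<Sum>g\<in>Mon (d - 2). G g * run g b) (at_point l a)"
            by (subst word_linear(3)[OF polyfun_Q])
              (auto intro!: polyfun_sum polyfun.mult polyfun.const polyfun_run)
          also have "Q (at_point l a) = 0"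
            using kernel[OF lpq(1), of a] by (simp add: Q_def K_at)
          finally have wH: "(\<Sum>e\<in>Mon d. H e * word Q p q (run e) (at_point l a)) = 0"
            by (simp add: word_sum[OF polyfun_Q polyfun_run])
          have "(\<Sum>e\<in>Mon d. pval a (W (l, p, q) e) * (F e - H e)) = 0"
            using wF wH by (simp add: W algebra_simps sum_subtractf)
          moreover have "(\<Sum>e\<in>Mon d. pval a (W (l, p, q) e) * (F e - H e)) =
              (\<Sum>e\<in>Nor d. pval a (W (l, p, q) e) * (F e - H e))"
            by (rule sum.mono_neutral_right) (auto simp: Nor_def G[unfolded ZH Nor_def])
          ultimately show ?thesis
            by simp
        qed
        then have "\<forall>i\<in>{1..9} \<times> tri m. (\<Sum>e\<in>Nor d. pval a (W i e) * (F e - H e)) = 0"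
          by auto
        then show ?thesis
          using h2(2)[OF ha(2), unfolded trivial_kernel_def, THEN spec, of "\<lambda>e. F e - H e"] that by blast
      qed
      then have "F e = H e" if "e \<in> Mon d" for e
        using G[of e] ZH[of e] that by (cases "e \<in> Nor d") auto
      then show ?thesis
        unfolding H_def by blast
    qed
    show ?thesis
      unfolding quadric_divides_def
    proof (intro exI[of _ "\<lambda>e. K e a"] conjI)
      show "K e34 a \<noteq> 0"
        by (rule ha)
      show "\<forall>l\<in>{1..9}. (\<Sum>e\<in>Mon 2. K e a * run e (at_point l a)) = 0"
        using kernel by blast
    qed (intro allI impI; rule unique divisible; blast)+
  qed
  ultimately show ?thesis
    by blast
qed

subsection \<open>Evaluation of polynomials\<close>

definition monval :: "('v \<Rightarrow> complex) \<Rightarrow> ('v \<Rightarrow>\<^sub>0 nat) \<Rightarrow> complex" where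
  "monval z e = (\<Prod>v\<in>Poly_Mapping.keys e. z v ^ lk e v)"

lemma monval_altdef:
  assumes "finite V" "Poly_Mapping.keys e \<subseteq> V"
  shows "monval z e = (\<Prod>v\<in>V. z v ^ lk e v)"
  unfolding monval_def by (rule prod.mono_neutral_left) (use assms in \<open>auto simp: in_keys_iff\<close>)

lemma monval_add: "monval z (e + f) = monval z e * monval z f"
proof -
  let ?V = "Poly_Mapping.keys e \<union> Poly_Mapping.keys f"
  have "Poly_Mapping.keys (e + f) \<subseteq> ?V"
    by (rule Poly_Mapping.keys_add)
  then show ?thesis
    by (subst (1 2 3) monval_altdef[of ?V]) (auto simp: lookup_add power_add prod.distrib)
qed

lemma monval_0 [simp]: "monval z 0 = 1"
  by (simp add: monval_def)

lemma monval_single [simp]: "monval z (Poly_Mapping.single v n) = z v ^ n"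
  by (simp add: monval_def)

lemma eval_poly_altdef:
  assumes "finite A" "Poly_Mapping.keys F \<subseteq> A"
  shows "eval_poly z F = (\<Sum>e\<in>A. lk F e * monval z e)"
  unfolding eval_poly_def poly_hom_def monval_def
  by (rule sum.mono_neutral_left) (use assms in \<open>auto simp: in_keys_iff\<close>)

lemma eval_poly_add: "eval_poly z (F + G) = eval_poly z F + eval_poly z G"
proof -
  let ?V = "Poly_Mapping.keys F \<union> Poly_Mapping.keys G"
  have "Poly_Mapping.keys (F + G) \<subseteq> ?V"
    by (rule Poly_Mapping.keys_add)
  then show ?thesis
    by (subst (1 2 3) eval_poly_altdef[of ?V]) (auto simp: lookup_add algebra_simps sum.distrib)
qed

lemma eval_poly_single [simp]: "eval_poly z (Poly_Mapping.single e c) = c * monval z e"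
  by (subst eval_poly_altdef[of "{e}"]) auto

lemma eval_poly_sum: "eval_poly z (\<Sum>i\<in>A. F i) = (\<Sum>i\<in>A. eval_poly z (F i))"
proof (induction A rule: infinite_finite_induct)
  case (insert i A)
  then show ?case
    by (simp add: eval_poly_add)
qed (simp_all add: eval_poly_altdef[of "{}"])

lemma sum_of_monomials:
  "(\<Sum>e\<in>Poly_Mapping.keys F. Poly_Mapping.single e (lk F e)) = (F :: 'v cpoly)"
proof (rule poly_mapping_eqI)
  fix e
  show "lk (\<Sum>e\<in>Poly_Mapping.keys F. Poly_Mapping.single e (lk F e)) e =
      lk F e"
    by (simp add: lookup_sum lookup_single when_def in_keys_iff)
qed

lemma eval_poly_mult: "eval_poly z (F * G) = eval_poly z F * eval_poly z G"
proof -
  have "F * G = (\<Sum>e\<in>Poly_Mapping.keys F. \<Sum>f\<in>Poly_Mapping.keys G.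
      Poly_Mapping.single (e + f) (lk F e * lk G f))"
    by (subst (1) sum_of_monomials[of F, symmetric], subst (1) sum_of_monomials[of G, symmetric])
      (simp add: sum_product mult_single)
  then have "eval_poly z (F * G) = (\<Sum>e\<in>Poly_Mapping.keys F. \<Sum>f\<in>Poly_Mapping.keys G.
      (lk F e * monval z e) * (lk G f * monval z f))"
    by (simp add: eval_poly_sum monval_add mult_ac)
  then show ?thesis
    by (simp add: sum_product eval_poly_altdef[OF finite_keys order_refl])
qed

lemma rhom_eval_poly: "rhom (eval_poly z)"
  by (rule rhomI) (simp_all add: eval_poly_add eval_poly_mult flip: single_one)

lemma eval_subst_poly: "eval_poly z (subst_poly g F) = eval_poly (\<lambda>v. eval_poly z (g v)) F"
  by (simp add: subst_poly_def poly_hom_def rhom_simps[OF rhom_eval_poly] eval_poly_def[of "\<lambda>v. eval_poly z (g v)"])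

lemma eval_form:
  assumes "form d F"
  shows "eval_poly z F = (\<Sum>e\<in>Mon d. lk F e * monval z e)"
  by (rule eval_poly_altdef[OF finite_Mon]) (use assms in \<open>auto simp: form_def Mon_def\<close>)

lemma monval_4: "monval z e = z 1 ^ lk e 1 * z 2 ^ lk e 2 * z 3 ^ lk e 3 * z 4 ^ lk e (4 :: 4)"
proof -
  have "monval z e = (\<Prod>v\<in>UNIV. z v ^ lk e v)"
    by (rule monval_altdef) auto
  also have "\<dots> = (\<Prod>v\<in>{1, 2, 3, 4}. z v ^ lk e v)"
    by (simp only: UNIV_4)
  also have "\<dots> = z 1 ^ lk e 1 * (z 2 ^ lk e 2 * (z 3 ^ lk e 3 * z 4 ^ lk e 4))"
    using distinct_4 by (simp only: prod.insert finite.intros insert_iff empty_iff prod.empty mult_1_right simp_thms)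
  finally show ?thesis
    by (simp only: mult.assoc)
qed

lemma monval_scale: "monval (\<lambda>v. c * z v) e = c ^ mdegree e * monval z e"
  unfolding monval_def mdegree_def by (simp add: power_mult_distrib prod.distrib power_sum)

lemma form_scale: "form d F \<Longrightarrow> eval_poly (\<lambda>v. c * z v) F = c ^ d * eval_poly z F"
  unfolding eval_form sum_distrib_left
  by (intro sum.cong refl) (simp add: monval_scale Mon_def)

section \<open>From multiplicity on a chart to order of vanishing\<close>

lemma vord_prod:
  "finite A \<Longrightarrow> (\<And>i. i \<in> A \<Longrightarrow> vord (n i) (\<Phi> i) a) \<Longrightarrow>
    vord (\<Sum>i\<in>A. n i) (\<lambda>b. \<Prod>i\<in>A. \<Phi> i b) a"
  by (induction A rule: finite_induct) (auto intro: polyfun.intros vord_mult)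

lemma vord_sum:
  "finite A \<Longrightarrow> (\<And>i. i \<in> A \<Longrightarrow> vord n (\<Phi> i) a) \<Longrightarrow> vord n (\<lambda>b. \<Sum>i\<in>A. \<Phi> i b) a"
  by (induction A rule: finite_induct) (auto intro: vord_zero vord_add)

text \<open>The chart expansion writes the dehomogenised form in powers of the differences from
  \<open>v\<close>, each vanishing to order one at the running point.\<close>

lemma vord_of_multiplicity:
  assumes F: "form d F" and v: "v $ 4 = 1"
    and mult: "\<And>e. e \<in> Poly_Mapping.keys (chart_expansion 4 v F) \<Longrightarrow> m \<le> mdegree e"
    and a: "\<And>j. a (0, j) = v $ j"
  shows "vord m (\<lambda>b. \<Sum>e\<in>Mon d. lk F e * run e b) a"
proof -
  let ?G = "chart_expansion 4 v F"
  have "(\<Sum>e\<in>Mon d. lk F e * run e b) =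
      (\<Sum>e\<in>Poly_Mapping.keys ?G. lk ?G e *
        (\<Prod>j\<in>Poly_Mapping.keys e. (b (0, j) - v $ j) ^ lk e j))" for b
  proof -
    have "(\<Sum>e\<in>Mon d. lk F e * run e b) = eval_poly (\<lambda>i. if i = 4 then 1 else b (0, i)) F"
      unfolding eval_form[OF F] by (simp add: run_def amono_def monval_4)
    also have "(\<lambda>i. if i = 4 then 1 else b (0, i)) = (\<lambda>i. eval_poly (\<lambda>j. b (0, j) - v $ j)
        (if i = 4 then 1 else var_poly i + const_poly (v $ i)))"
      by (auto simp: fun_eq_iff eval_poly_add rhom_1[OF rhom_eval_poly])
    also have "eval_poly \<dots> F = eval_poly (\<lambda>j. b (0, j) - v $ j) ?G"
      by (simp add: chart_expansion_def eval_subst_poly)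
    finally show ?thesis
      by (simp add: eval_poly_def poly_hom_def)
  qed
  moreover have "vord m (\<lambda>b. \<Sum>e\<in>Poly_Mapping.keys ?G. lk ?G e *
        (\<Prod>j\<in>Poly_Mapping.keys e. (b (0, j) - v $ j) ^ lk e j)) a"
  proof (intro vord_sum vord_mult_left polyfun.const finite_keys)
    fix e assume e: "e \<in> Poly_Mapping.keys ?G"
    have 1: "vord 1 (\<lambda>b. b (0, j) - v $ j) a" for j
    proof -
      have pf: "polyfun (\<lambda>b :: nat \<times> 4 \<Rightarrow> complex. b (0, j) - v $ j)"
        by (intro polyfun_diff polyfun.intros)
      then show ?thesis
        by (simp add: a polyfun_pd)
    qed
    have "vord (\<Sum>j\<in>Poly_Mapping.keys e. lk e j)
        (\<lambda>b. \<Prod>j\<in>Poly_Mapping.keys e. (b (0, j) - v $ j) ^ lk e j) a"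
      by (intro vord_prod finite_keys vord_power 1)
    then show "vord m (\<lambda>b. \<Prod>j\<in>Poly_Mapping.keys e. (b (0, j) - v $ j) ^ lk e j) a"
      by (rule vord_mono) (use mult[OF e] in \<open>simp add: mdegree_def\<close>)
  qed
  ultimately show ?thesis
    by presburger
qed

subsection \<open>Nonempty Zariski open sets from polynomial functions\<close>

text \<open>One common degree for all nine points lets homogenisations be added.\<close>

definition nine_homogeneous :: "nat \<Rightarrow> (nat \<times> 4) cpoly \<Rightarrow> bool" where
  "nine_homogeneous N G \<longleftrightarrow> (\<forall>e\<in>Poly_Mapping.keys G. Poly_Mapping.keys e \<subseteq> {1..9} \<times> UNIV \<and>
     (\<forall>l\<in>{1..9}. (\<Sum>j\<in>UNIV. lk e (l, j)) = N))"

definition wmon :: "(nat \<Rightarrow> nat) \<Rightarrow> (nat \<times> 4) \<Rightarrow>\<^sub>0 nat" where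
  "wmon n = (\<Sum>l\<in>{1..9}. Poly_Mapping.single (l, 4) (n l))"

lemma lookup_wmon: "lk (wmon n) (l, j) = (if l \<in> {1..9} \<and> j = 4 then n l else 0)"
  by (auto simp: wmon_def lookup_sum lookup_single when_def intro!: sum.neutral)

lemma keys_wmon: "Poly_Mapping.keys (wmon n) \<subseteq> {1..9} \<times> UNIV"
  by (auto simp: in_keys_iff lookup_wmon split: if_splits)

lemma monval_sum: "monval z (\<Sum>i\<in>A. f i) = (\<Prod>i\<in>A. monval z (f i))"
  by (induction A rule: infinite_finite_induct) (simp_all add: monval_add)

lemma monval_wmon: "monval z (wmon n) = (\<Prod>l\<in>{1..9}. z (l, 4) ^ n l)"
  by (simp add: wmon_def monval_sum)

lemma nine_homogeneous_wmon: "nine_homogeneous N (Poly_Mapping.single (wmon (\<lambda>_. N)) c)"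
  using keys_wmon by (auto simp: nine_homogeneous_def lookup_wmon split: if_splits)

lemma nine_homogeneous_add:
  "nine_homogeneous N F \<Longrightarrow> nine_homogeneous N G \<Longrightarrow> nine_homogeneous N (F + G)"
  using Poly_Mapping.keys_add[of F G] unfolding nine_homogeneous_def by blast

lemma nine_homogeneous_mult:
  assumes "nine_homogeneous M F" "nine_homogeneous N G"
  shows "nine_homogeneous (M + N) (F * G)"
  unfolding nine_homogeneous_def
proof
  fix e assume "e \<in> Poly_Mapping.keys (F * G)"
  then obtain f g where e: "e = f + g" "f \<in> Poly_Mapping.keys F" "g \<in> Poly_Mapping.keys G"
    using keys_mult by blast
  have "Poly_Mapping.keys e \<subseteq> Poly_Mapping.keys f \<union> Poly_Mapping.keys g"
    unfolding e by (rule Poly_Mapping.keys_add)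
  with e assms show "Poly_Mapping.keys e \<subseteq> {1..9} \<times> UNIV \<and>
      (\<forall>l\<in>{1..9}. (\<Sum>j\<in>UNIV. lk e (l, j)) = M + N)"
    by (auto simp: nine_homogeneous_def lookup_add sum.distrib dest!: subsetD)
qed

lemma nine_homogeneous_imp_multihomogeneous:
  assumes "nine_homogeneous N G" "s \<ge> 9"
  shows "multihomogeneous s G"
  unfolding multihomogeneous_def
proof (intro exI[of _ "\<lambda>l. if l \<le> 9 then N else 0"] ballI conjI)
  fix e assume e: "e \<in> Poly_Mapping.keys G"
  then have k: "Poly_Mapping.keys e \<subseteq> {1..9} \<times> UNIV"
    using assms(1) by (auto simp: nine_homogeneous_def)
  then show "Poly_Mapping.keys e \<subseteq> {1..s} \<times> UNIV"
    using assms(2) by force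
  fix l assume l: "l \<in> {1..s}"
  show "(\<Sum>j\<in>UNIV. lk e (l, j)) = (if l \<le> 9 then N else 0)"
  proof (cases "l \<le> 9")
    case True
    then show ?thesis
      using e l assms(1) by (auto simp: nine_homogeneous_def)
  next
    case False
    then have "(l, j) \<notin> Poly_Mapping.keys e" for j
      using k by auto
    then show ?thesis
      using False by (simp add: in_keys_iff)
  qed
qed

text \<open>Dehomogenisation at the nine points; all other coordinates, also those of the running
  point, are frozen at \<open>a\<close>.\<close>

definition affine_part ::
  "(nat \<times> 4 \<Rightarrow> complex) \<Rightarrow> (nat \<times> 4 \<Rightarrow> complex) \<Rightarrow> nat \<times> 4 \<Rightarrow> complex" where
  "affine_part a w = (\<lambda>(l, j). if l \<in> {1..9} then w (l, j) / w (l, 4) else a (l, j))"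

definition homogenises ::
  "(nat \<times> 4 \<Rightarrow> complex) \<Rightarrow> nat \<Rightarrow> cfun \<Rightarrow> (nat \<times> 4) cpoly \<Rightarrow> bool" where
  "homogenises a N f G \<longleftrightarrow> nine_homogeneous N G \<and> (\<forall>w. (\<forall>l\<in>{1..9}. w (l, 4) \<noteq> 0) \<longrightarrow>
    eval_poly w G = (\<Prod>l\<in>{1..9}. w (l, 4)) ^ N * f (affine_part a w))"

lemma homogenises_const: "homogenises a N (\<lambda>_. c) (Poly_Mapping.single (wmon (\<lambda>_. N)) c)"
  by (simp add: homogenises_def nine_homogeneous_wmon monval_wmon prod_power_distrib)

lemma homogenises_var:
  assumes l: "l \<in> {1..9}" and N: "N \<ge> 1"
  shows "\<exists>G. homogenises a N (\<lambda>w. w (l, j)) G"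
proof -
  define n where "n i = (if i = l then N - 1 else N)" for i
  define e where "e = Poly_Mapping.single (l, j) 1 + wmon n"
  have le: "lk e (i, j') = of_bool (i = l \<and> j' = j) + (if i \<in> {1..9} \<and> j' = 4 then n i else 0)" for i j'
    by (auto simp: e_def lookup_add lookup_wmon lookup_single when_def)
  have "Poly_Mapping.keys e \<subseteq> {1..9} \<times> UNIV"
    using l by (auto simp: in_keys_iff le split: if_splits)
  moreover have "(\<Sum>j'\<in>UNIV. lk e (i, j')) = N" if "i \<in> {1..9}" for i
    using N that by (simp add: le sum.distrib n_def of_bool_def)
  ultimately have hom: "nine_homogeneous N (Poly_Mapping.single e 1)"
    by (auto simp: nine_homogeneous_def split: if_splits)
  have "eval_poly w (Poly_Mapping.single e 1) = (\<Prod>i\<in>{1..9}. w (i, 4)) ^ N * (w (l, j) / w (l, 4))"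
    if "\<forall>i\<in>{1..9}. w (i, 4) \<noteq> 0" for w
  proof -
    have "(\<Prod>i\<in>{1..9}. w (i, 4) ^ n i) = w (l, 4) ^ (N - 1) * (\<Prod>i\<in>{1..9} - {l}. w (i, 4) ^ N)"
      using l by (subst prod.remove[of _ l]) (auto simp: n_def intro!: prod.cong)
    moreover have "(\<Prod>i\<in>{1..9}. w (i, 4)) ^ N = w (l, 4) ^ N * (\<Prod>i\<in>{1..9} - {l}. w (i, 4) ^ N)"
      using l by (subst prod.remove[of _ l]) (auto simp: power_mult_distrib prod_power_distrib)
    moreover have "w (l, 4) ^ N = w (l, 4) ^ (N - 1) * w (l, 4)"
      using N by (metis power_minus_mult less_le_trans zero_less_one)
    moreover have "w (l, 4) \<noteq> 0"
      using that l by blast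
    ultimately show ?thesis
      by (simp add: e_def monval_add monval_wmon)
  qed
  with hom l show ?thesis
    by (intro exI[of _ "Poly_Mapping.single e 1"])
      (auto simp: homogenises_def affine_part_def simp del: eval_poly_single)
qed

lemma homogenises_add:
  "homogenises a N f F \<Longrightarrow> homogenises a N g G \<Longrightarrow> homogenises a N (\<lambda>w. f w + g w) (F + G)"
  by (simp add: homogenises_def nine_homogeneous_add eval_poly_add distrib_left)

lemma homogenises_mult:
  "homogenises a M f F \<Longrightarrow> homogenises a N g G \<Longrightarrow> homogenises a (M + N) (\<lambda>w. f w * g w) (F * G)"
  by (simp add: homogenises_def nine_homogeneous_mult eval_poly_mult power_add mult_ac)

text \<open>Asserted for all large \<open>N\<close>: sums need a common degree, and in a product one
  factor absorbs the excess.\<close>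

lemma homogenisation:
  assumes "polyfun f"
  shows "\<exists>M. \<forall>N\<ge>M. \<exists>G. homogenises a N f G"
  using assms
proof induction
  case (const c)
  show ?case
    using homogenises_const by blast
next
  case (var v)
  obtain l j where v: "v = (l, j)"
    by fastforce
  show ?case
  proof (cases "l \<in> {1..9}")
    case True
    then show ?thesis
      unfolding v using homogenises_var by blast
  next
    case False
    then have "affine_part a w v = a v" for w
      by (auto simp: v affine_part_def)
    then have "homogenises a N (\<lambda>w. w v) G \<longleftrightarrow> homogenises a N (\<lambda>_. a v) G" for N G
      by (simp add: homogenises_def)
    then show ?thesis
      using homogenises_const by blast
  qed
next
  case (add f g)
  then obtain M\<^sub>1 M\<^sub>2 where M: "\<And>N. N \<ge> M\<^sub>1 \<Longrightarrow> \<exists>G. homogenises a N f G"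
    "\<And>N. N \<ge> M\<^sub>2 \<Longrightarrow> \<exists>G. homogenises a N g G"
    by blast
  show ?case
  proof (rule exI[of _ "M\<^sub>1 + M\<^sub>2"], intro allI impI)
    fix N assume "M\<^sub>1 + M\<^sub>2 \<le> N"
    then have "M\<^sub>1 \<le> N" "M\<^sub>2 \<le> N"
      by simp_all
    then show "\<exists>G. homogenises a N (\<lambda>w. f w + g w) G"
      using M homogenises_add by blast
  qed
next
  case (mult f g)
  then obtain M\<^sub>1 M\<^sub>2 where M: "\<And>N. N \<ge> M\<^sub>1 \<Longrightarrow> \<exists>G. homogenises a N f G"
    "\<And>N. N \<ge> M\<^sub>2 \<Longrightarrow> \<exists>G. homogenises a N g G"
    by blast
  show ?case
  proof (rule exI[of _ "M\<^sub>1 + M\<^sub>2"], intro allI impI)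
    fix N assume N: "M\<^sub>1 + M\<^sub>2 \<le> N"
    then have "M\<^sub>2 \<le> N - M\<^sub>1"
      by simp
    from M(2)[OF this] M(1)[OF order_refl]
    have "\<exists>G. homogenises a (M\<^sub>1 + (N - M\<^sub>1)) (\<lambda>w. f w * g w) G"
      using homogenises_mult by blast
    with N show "\<exists>G. homogenises a N (\<lambda>w. f w * g w) G"
      by simp
  qed
qed

text \<open>Homogenising \<open>h\<close> turns its nonvanishing into an open condition on
  projective points, and \<open>a\<^sub>0\<close> shows that the open set is nonempty. Its points
  are finite in the chart of the fourth coordinate, so their vectors can be normalised
  there.\<close>

lemma for_general_pointsI:
  assumes s: "s \<ge> 9" and h: "polyfun h" "h a\<^sub>0 \<noteq> 0" and a\<^sub>0: "\<And>l. l > 0 \<Longrightarrow> a\<^sub>0 (l, 4) = 1"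
    and P: "\<And>p a v. (\<And>l. l \<in> {1..9} \<Longrightarrow> p l = vec.span {v l}) \<Longrightarrow> (\<And>l. l \<in> {1..9} \<Longrightarrow> v l $ 4 = 1) \<Longrightarrow>
      (\<And>l j. l \<in> {1..9} \<Longrightarrow> a (l, j) = v l $ j) \<Longrightarrow> h a \<noteq> 0 \<Longrightarrow> P p"
  shows "for_general_points s P"
proof -
  obtain N G where "homogenises a\<^sub>0 N h G"
    using homogenisation[OF h(1)] by blast
  then have G: "nine_homogeneous N G"
    "\<And>w. \<forall>l\<in>{1..9}. w (l, 4) \<noteq> 0 \<Longrightarrow>
      eval_poly w G = (\<Prod>l\<in>{1..9}. w (l, 4)) ^ N * h (affine_part a\<^sub>0 w)"
    by (simp_all add: homogenises_def)
  \<comment> \<open>the extra factor makes \<open>G'\<close> vanish when one of the points is at infinity\<close>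
  define G' where "G' = G * Poly_Mapping.single (wmon (\<lambda>_. 1)) 1"
  have mh: "multihomogeneous s G'"
    unfolding G'_def
    by (rule nine_homogeneous_imp_multihomogeneous[OF nine_homogeneous_mult[OF G(1) nine_homogeneous_wmon] s])
  have eval: "eval_poly w G' = eval_poly w G * (\<Prod>l\<in>{1..9}. w (l, 4))" for w
    by (simp add: G'_def eval_poly_mult monval_wmon)
  define U where "U = P3_power s - multi_zero_locus s G'"
  have "zariski_open s U"
    unfolding zariski_open_def zariski_closed_def U_def
    using mh by (intro conjI exI[of _ "{G'}"]) (auto simp: multi_zero_locus_def)
  moreover have "U \<noteq> {}"
  proof -
    define v where "v l = (\<chi> j. a\<^sub>0 (l, j))" for l
    have v0: "v l \<noteq> 0" if "l \<in> {1..s}" for l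
    proof
      assume "v l = 0"
      then have "a\<^sub>0 (l, 4) = 0"
        by (metis v_def vec_lambda_beta zero_index)
      with a\<^sub>0 that show False
        by simp
    qed
    define p where "p = (\<lambda>l\<in>{1..s}. vec.span {v l})"
    have "p \<in> P3_power s"
      using v0 by (auto simp: p_def P3_power_def P3_def)
    moreover have "\<forall>l\<in>{1..s}. v l \<in> p l - {0}"
      using v0 by (auto simp: p_def intro: vec.span_base)
    moreover have "eval_poly (\<lambda>(l, j). v l $ j) G' \<noteq> 0"
    proof -
      let ?w = "\<lambda>(l, j). v l $ j"
      have "affine_part a\<^sub>0 ?w = a\<^sub>0"
        by (auto simp: affine_part_def v_def a\<^sub>0 fun_eq_iff)
      moreover have "?w (l, 4) = 1" if "l \<in> {1..9}" for l
        using that a\<^sub>0 by (simp add: v_def)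
      ultimately show ?thesis
        using G(2)[of ?w] h(2) by (simp add: eval)
    qed
    ultimately have "p \<in> U"
      by (auto simp: U_def multi_zero_locus_def)
    then show ?thesis
      by blast
  qed
  moreover have "P p" if p: "p \<in> U" for p
  proof -
    obtain w where "\<forall>l\<in>{1..s}. w l \<in> p l - {0}" and w2: "eval_poly (\<lambda>(l, j). w l $ j) G' \<noteq> 0"
      using p unfolding U_def multi_zero_locus_def by blast
    then have w1: "w l \<in> p l - {0}" if "l \<in> {1..s}" for l
      using that by blast
    note w = w1 w2
    let ?w = "\<lambda>(l, j). w l $ j"
    have w4: "w l $ 4 \<noteq> 0" if "l \<in> {1..9}" for l
    proof
      assume "w l $ 4 = 0"
      then have "(\<Prod>l\<in>{1..9}. ?w (l, 4)) = 0"
        using that by (auto simp: prod_zero_iff)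
      with w(2) show False
        by (simp add: eval)
    qed
    define v where "v l = (1 / w l $ 4) *s w l" for l
    show ?thesis
    proof (rule P[of p v "affine_part a\<^sub>0 ?w"])
      fix l :: nat assume l: "l \<in> {1..9}"
      then have ls: "l \<in> {1..s}"
        using s by auto
      show "v l $ 4 = 1"
        using w4[OF l] by (simp add: v_def)
      show "affine_part a\<^sub>0 ?w (l, j) = v l $ j" for j
        using l by (simp add: affine_part_def v_def)
      obtain x where x: "p l = vec.span {x}" "x \<noteq> 0"
        using p ls by (auto simp: U_def P3_power_def P3_def PiE_def Pi_def)
      obtain c where c: "w l = c *s x"
        using w(1)[OF ls] x by (auto simp: vec.span_singleton)
      with w(1)[OF ls] have "c \<noteq> 0"
        by auto
      have "v l = (c / w l $ 4) *s x" "c / w l $ 4 \<noteq> 0"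
        using w4[OF l] \<open>c \<noteq> 0\<close> by (simp_all add: v_def c vector_smult_assoc)
      then show "p l = vec.span {v l}"
        unfolding x(1) using vec.span_image_scale[of "{x}" "\<lambda>_. c / w l $ 4"] by simp
    next
      show "h (affine_part a\<^sub>0 ?w) \<noteq> 0"
        using w(2) G(2)[of ?w] w4 by (auto simp: eval)
    qed
  qed
  ultimately show ?thesis
    unfolding for_general_points_def by blast
qed

lemma form_value_at_point:
  assumes "form d F" "v $ 4 = 1" "\<And>j. a (l, j) = v $ j"
  shows "eval_poly (($) v) F = (\<Sum>e\<in>Mon d. lk F e * run e (at_point l a))"
  unfolding eval_form[OF assms(1)]
  by (intro sum.cong refl) (simp add: monval_4 run_def amono_def at_point_def assms(2,3))

lemma lookup_const_mult: "lk (const_poly c * F) e = c * lk F e"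
  by (simp flip: mult_map_scale_conv_mult add: Poly_Mapping.map.rep_eq when_def)

lemma form_zero_on_line:
  assumes "form d F" "eval_poly (($) v) F = 0" "u \<in> vec.span {v}" "d > 0"
  shows "eval_poly (($) u) F = 0"
proof -
  obtain c where "u = c *s v"
    using assms(3) by (auto simp: vec.span_singleton)
  then have "eval_poly (($) u) F = eval_poly (\<lambda>j. c * v $ j) F"
    by (intro arg_cong[of _ _ "\<lambda>z. eval_poly z F"]) auto
  then show ?thesis
    using form_scale[OF assms(1), of c "($) v"] assms(2) by simp
qed

theorem theorem4p1:
  fixes \<alpha> m s :: nat and ms :: "nat \<Rightarrow> nat"
  assumes "\<alpha> > 0" and "m > 0" and "s \<ge> 9" and "m > 9 * \<alpha>"
  shows "for_general_points s (\<lambda>p.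
           \<exists>q. is_unique_quadric_through {1..9} p q \<and>
             (let L = linear_system (2 * m + \<alpha>) s (\<lambda>i. if i \<le> 9 then m else ms i) p
              in L \<noteq> {} \<longrightarrow> zero_locus q \<subseteq> base_locus L))"
proof -
  define d where "d = 2 * m + \<alpha>"
  \<comment> \<open>The second inequality is \<open>9 * \<alpha> < m\<close>, expressed through
    \<open>d\<close>.\<close>
  have d: "2 \<le> d" "9 * d < 19 * m" "2 + (d - 2) = d"
    using assms by (simp_all add: d_def)
  obtain h a\<^sub>0 where h: "polyfun h" "h a\<^sub>0 \<noteq> 0" "\<And>l. l > 0 \<Longrightarrow> a\<^sub>0 (l, 4) = 1" and
    good: "\<And>a. h a \<noteq> 0 \<Longrightarrow> \<exists>k. quadric_divides d m a k"
    using good_configurations[OF d(1,2)] by blast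
  show ?thesis
  proof (rule for_general_pointsI[where h = h and a\<^sub>0 = a\<^sub>0])
    fix p :: "nat \<Rightarrow> point" and a v
    assume p: "\<And>l. l \<in> {1..9} \<Longrightarrow> p l = vec.span {v l}" and v: "\<And>l. l \<in> {1..9} \<Longrightarrow> v l $ 4 = 1"
      and a: "\<And>l j. l \<in> {1..9} \<Longrightarrow> a (l, j) = v l $ j" and "h a \<noteq> 0"
    from good[OF this(4)] obtain k where *: "quadric_divides d m a k"
      by blast
    note * = *[unfolded quadric_divides_def]
    have k: "k e34 \<noteq> 0"
      using * by (elim conjE)
    have through: "(\<Sum>e\<in>Mon 2. k e * run e (at_point l a)) = 0" if "l \<in> {1..9}" for l
      using *[THEN conjunct2, THEN conjunct1] that by (rule bspec)
    note unique = *[THEN conjunct2, THEN conjunct2, THEN conjunct1, rule_format]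
    note divisible = *[THEN conjunct2, THEN conjunct2, THEN conjunct2, rule_format (no_asm)]
    have v0: "v l \<noteq> 0" if "l \<in> {1..9}" for l
      using v[OF that] by auto
    have vp: "v l \<in> p l" if "l \<in> {1..9}" for l
      using p[OF that] by (simp add: vec.span_base)
    define q :: "4 cpoly" where "q = (\<Sum>e\<in>Mon 2. Poly_Mapping.single e (k e))"
    have lq: "lk q e = (if e \<in> Mon 2 then k e else 0)" for e
      by (simp add: q_def lookup_sum lookup_single when_def)
    have fq: "form 2 q"
      by (auto simp: form_def in_keys_iff lq Mon_def split: if_splits)
    have e34: "e34 \<in> Mon 2"
      using Mon_2(1) by blast
    have "is_unique_quadric_through {1..9} p q"
      unfolding is_unique_quadric_through_def quadrics_through_def
    proof (intro conjI CollectI ballI)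
      show "q \<noteq> 0"
        using lq[of e34] k e34 by auto
      show "form 2 q"
        by (rule fq)
      show "p l \<in> zero_locus q" if l: "l \<in> {1..9}" for l
      proof -
        have "eval_poly (($) (v l)) q = 0"
          unfolding form_value_at_point[OF fq v[OF l] a[OF l]] using through[OF l]
          by (simp add: lq cong: sum.cong)
        then have "eval_poly (($) u) q = 0" if "u \<in> p l" for u
          using form_zero_on_line[OF fq] that p[OF l] by auto
        moreover have "p l \<in> P3"
          using p[OF l] v0[OF l] by (auto simp: P3_def)
        ultimately show ?thesis
          by (simp add: zero_locus_def)
      qed
      fix q' assume "q' \<in> {q. q \<noteq> 0 \<and> form 2 q \<and> (\<forall>i\<in>{1..9}. p i \<in> zero_locus q)}"
      then have q': "form 2 q'" "\<And>l. l \<in> {1..9} \<Longrightarrow> p l \<in> zero_locus q'"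
        by auto
      \<comment> \<open>This combination has no \<open>X3 * X4\<close> term, and the only such form
        through the nine points is zero.\<close>
      define c where "c e = k e34 * lk q' e - lk q' e34 * k e" for e
      have "c e = 0" if "e \<in> Mon 2" for e
      proof (rule unique[OF _ _ that])
        fix l :: nat assume l: "l \<in> {1..9}"
        have "eval_poly (($) (v l)) q' = 0"
          using q'(2)[OF l] vp[OF l] v0[OF l] by (auto simp: zero_locus_def)
        then have "(\<Sum>e\<in>Mon 2. lk q' e * run e (at_point l a)) = 0"
          by (simp add: form_value_at_point[OF q'(1) v[OF l] a[OF l]])
        moreover have "(\<Sum>e\<in>Mon 2. c e * run e (at_point l a)) =
            k e34 * (\<Sum>e\<in>Mon 2. lk q' e * run e (at_point l a)) -
            lk q' e34 * (\<Sum>e\<in>Mon 2. k e * run e (at_point l a))"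
          by (simp add: c_def sum_distrib_left left_diff_distrib sum_subtractf mult.assoc)
        ultimately show "(\<Sum>e\<in>Mon 2. c e * run e (at_point l a)) = 0"
          using through[OF l] by simp
      qed (simp add: c_def mult.commute)
      moreover have "lk q' e = 0" if "e \<notin> Mon 2" for e
        using q'(1) that by (auto simp: form_def Mon_def in_keys_iff)
      ultimately have *: "lk q' e = lk q' e34 / k e34 * lk q e" for e
        using k by (auto simp: lq c_def field_simps)
      have "q' = const_poly (lk q' e34 / k e34) * q"
        by (rule poly_mapping_eqI) (unfold lookup_const_mult, rule *)
      then show "\<exists>c. q' = const_poly c * q"
        by blast
    qed
    moreover have "zero_locus q \<subseteq> base_locus (linear_system d s (\<lambda>i. if i \<le> 9 then m else ms i) p)"
    proof
      fix X assume X: "X \<in> zero_locus q"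
      have "eval_poly (($) u) F = 0"
        if F: "F \<in> linear_system d s (\<lambda>i. if i \<le> 9 then m else ms i) p" and u: "u \<in> X - {0}" for F u
      proof -
        have fF: "form d F"
          using F by (simp add: linear_system_def)
        have "vord m (\<lambda>b. \<Sum>e\<in>Mon d. lk F e * run e b) (at_point l a)"
          if l: "l \<in> {1..9}" for l
        proof (rule vord_of_multiplicity[OF fF v[OF l]])
          have "l \<in> {1..s}"
            using l assms(3) by auto
          then have "mult_at_least (if l \<le> 9 then m else ms l) (p l) F"
            using F unfolding linear_system_def by blast
          then have "mult_at_least m (p l) F"
            using l by simp
          then show "m \<le> mdegree e" if "e \<in> Poly_Mapping.keys (chart_expansion 4 (v l) F)" for e
            using vp[OF l] v[OF l] that unfolding mult_at_least_def by blast
          show "at_point l a (0, j) = v l $ j" for j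
            using a[OF l] by (simp add: at_point_def)
        qed
        then obtain G where G: "\<forall>e\<in>Mon d. lk F e =
            (\<Sum>g\<in>Mon (d - 2). \<Sum>f\<in>Mon 2. if f + g = e then k f * G g else 0)"
          using divisible[of "lk F"] by blast
        \<comment> \<open>\<open>F\<close> is \<open>q\<close> times the form with coefficients
          \<open>G\<close>, so it vanishes wherever \<open>q\<close> does.\<close>
        have "eval_poly (($) u) F = (\<Sum>e\<in>Mon d.
            (\<Sum>g\<in>Mon (d - 2). \<Sum>f\<in>Mon 2. if f + g = e then k f * G g else 0) * monval (($) u) e)"
          unfolding eval_form[OF fF] using G by (intro sum.cong refl) simp
        also have "\<dots> = (\<Sum>f\<in>Mon 2. k f * monval (($) u) f) * (\<Sum>g\<in>Mon (d - 2). G g * monval (($) u) g)"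
          using product_expansion[where \<mu> = "monval (($) u)" and c = 2 and d = "d - 2" and k = k and G = G, OF monval_add]
          unfolding d(3) by blast
        also have "(\<Sum>f\<in>Mon 2. k f * monval (($) u) f) = eval_poly (($) u) q"
          unfolding eval_form[OF fq] by (simp add: lq cong: sum.cong)
        also have "\<dots> = 0"
          using X u by (auto simp: zero_locus_def)
        finally show ?thesis
          by simp
      qed
      with X show "X \<in> base_locus (linear_system d s (\<lambda>i. if i \<le> 9 then m else ms i) p)"
        by (auto simp: base_locus_def zero_locus_def)
    qed
    ultimately show "\<exists>q. is_unique_quadric_through {1..9} p q \<and>
        (let L = linear_system (2 * m + \<alpha>) s (\<lambda>i. if i \<le> 9 then m else ms i) p
         in L \<noteq> {} \<longrightarrow> zero_locus q \<subseteq> base_locus L)"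
      unfolding d_def Let_def by blast
  qed (use assms h in auto)
qed

end
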